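(* Let $T = S_1 \cdot S_2 \cdots S_d$ be the concatenation of $d$ documents $S_j$, with $|T| = n$, and let $\mathsf{CSA}$ be a compressed suffix array on $T$, occupying $|\mathsf{CSA}|$ bits, searching for any pattern $P[1..m]$ in time $\mathsf{search}(m)$ and accessing any cell $\mathsf{SA}[i]$ in time $\mathsf{lookup}(n)$. Let $\rho$ be the number of runs in the interleaved LCP array $\mathsf{ILCP}$ of $T$. Then we can store $T$ in $$|\mathsf{CSA}| + \rho \lg (n/\rho) + O(\rho) + d \lg (n/d) + O(d) = |\mathsf{CSA}| + O((\rho+d)\lg n)$$ bits such that document listing (given a pattern $P[1..m]$, report the identifiers of all the $\mathsf{df}$ distinct documents in which $P$ occurs) takes $O(\mathsf{search}(m) + \mathsf{df}\cdot(\mathsf{lookup}(n)+\lg n))$ time.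
   Context: Strings are indexed from 1, and $\lg$ is the base-2 logarithm. Times are measured in the standard word-RAM model with words of $\Theta(\lg n)$ bits. Each document $S_j$ is a string over an ordered alphabet terminated with a special symbol $\$$, which is lexicographically smaller than every other symbol and occurs in $S_j$ only as its last symbol. $T[1..n] = S_1\cdots S_d$. Patterns $P[1..m]$, $m\ge 1$, are strings not containing $\$$. The suffix array $\mathsf{SA}[1..n]$ of $T$ is the permutation of $\{1,\dots,n\}$ with $T[\mathsf{SA}[i]..n] < T[\mathsf{SA}[i+1]..n]$ lexicographically for all $1\le i<n$. The suffix array $\mathsf{SA}_{S}$ of a string $S$ is defined in the same way. A compressed suffix array ($\mathsf{CSA}$) is a data structure that, given $P[1..m]$, finds in time $\mathsf{search}(m)$ the interval $[\ell..r]$ such that $\mathsf{SA}[\ell..r]$ contains exactly the starting positions of the suffixes of $T$ prefixed by $P$, and that computes any cell $\mathsf{SA}[i]$ in time $\mathsf{lookup}(n)$. The document array $\mathsf{DA}[1..n]$ is defined by letting $\mathsf{DA}[i]$ be the index $j$ of the document $S_j$ containing position $\mathsf{SA}[i]$ of $T$. For a sequence $X$, $\mathsf{rank}_c(X,i)$ is the number of occurrences of $c$ in $X[1..i]$. The longest-common-prefix array $\mathsf{LCP}_S[1..|S|]$ of a string $S$ has $\mathsf{LCP}_S[1]=0$ and, for $2\le i\le |S|$, $\mathsf{LCP}_S[i]$ is the length of the longest common prefix of $S[\mathsf{SA}_S[i-1]..|S|]$ and $S[\mathsf{SA}_S[i]..|S|]$. The interleaved LCP array of $T$ is defined for $1\le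 i\le n$ by $$\mathsf{ILCP}[i] = \mathsf{LCP}_{S_{\mathsf{DA}[i]}}\bigl[\mathsf{rank}_{\mathsf{DA}[i]}(\mathsf{DA},i)\bigr].$$ A run of $\mathsf{ILCP}$ is a maximal interval of consecutive positions holding equal values. *)

theory Defs
  imports Complex_Main "HOL-Library.Sublist" "HOL-Library.List_Lexorder"
begin

section \<open>Strings, suffix arrays and the interleaved LCP array\<close>

text \<open>
  Strings are lists over an ordered alphabet with a least symbol; the terminator \<open>$\<close> is
  \<^term>\<open>bot\<close>. All positions and identifiers are counted from 1, as are the entries of arrays,
  which are accessed with \<open>xs !\<^sub>1 i\<close>. The order on strings is the lexicographic one of
  \<^theory>\<open>HOL-Library.List_Lexorder\<close> (a proper prefix is smaller).
\<close>

definition nth1 :: "'a list \<Rightarrow> nat \<Rightarrow> 'a" (infixl "!\<^sub>1" 100) where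
  "xs !\<^sub>1 i = xs ! (i - 1)"

definition suffix_from :: "'a list \<Rightarrow> nat \<Rightarrow> 'a list" where
  "suffix_from S p = drop (p - 1) S"

definition document :: "'a::{linorder,order_bot} list \<Rightarrow> bool" where
  "document S \<longleftrightarrow> S \<noteq> [] \<and> last S = bot \<and> bot \<notin> set (butlast S)"

definition collection :: "'a::{linorder,order_bot} list list \<Rightarrow> bool" where
  "collection Ss \<longleftrightarrow> Ss \<noteq> [] \<and> (\<forall>S\<in>set Ss. document S)"

definition pattern :: "'a::{linorder,order_bot} list \<Rightarrow> bool" where
  "pattern P \<longleftrightarrow> P \<noteq> [] \<and> bot \<notin> set P"

definition suffix_array :: "'a::linorder list \<Rightarrow> nat list" where
  "suffix_array S = sort_key (suffix_from S) [1..<Suc (length S)]"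

definition doc_of :: "'a list list \<Rightarrow> nat \<Rightarrow> nat" where
  "doc_of Ss p = (LEAST j. p \<le> length (concat (take j Ss)))"

definition doc_array :: "'a::linorder list list \<Rightarrow> nat list" where
  "doc_array Ss = map (doc_of Ss) (suffix_array (concat Ss))"

definition seq_rank :: "'b \<Rightarrow> 'b list \<Rightarrow> nat \<Rightarrow> nat" where
  "seq_rank x xs i = count_list (take i xs) x"

definition lcp :: "'a list \<Rightarrow> 'a list \<Rightarrow> nat" where
  "lcp xs ys = length (longest_common_prefix xs ys)"

definition lcp_array :: "'a::linorder list \<Rightarrow> nat list" where
  "lcp_array S =
     map (\<lambda>i. if i = 1 then 0
              else lcp (suffix_from S (suffix_array S !\<^sub>1 (i - 1)))
                       (suffix_from S (suffix_array S !\<^sub>1 i)))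
         [1..<Suc (length S)]"

definition ilcp :: "'a::linorder list list \<Rightarrow> nat list" where
  "ilcp Ss =
     map (\<lambda>i. let j = doc_array Ss !\<^sub>1 i
              in lcp_array (Ss !\<^sub>1 j) !\<^sub>1 seq_rank j (doc_array Ss) i)
         [1..<Suc (length (concat Ss))]"

definition runs :: "'b list \<Rightarrow> (nat \<times> nat) set" where
  "runs xs = {(a, b). 1 \<le> a \<and> a \<le> b \<and> b \<le> length xs
      \<and> (\<forall>i\<in>{a..b}. xs !\<^sub>1 i = xs !\<^sub>1 a)
      \<and> (a > 1 \<longrightarrow> xs !\<^sub>1 (a - 1) \<noteq> xs !\<^sub>1 a)
      \<and> (b < length xs \<longrightarrow> xs !\<^sub>1 (b + 1) \<noteq> xs !\<^sub>1 b)}"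

definition docs_with :: "'a list list \<Rightarrow> 'a list \<Rightarrow> nat set" where
  "docs_with Ss P = {j \<in> {1..length Ss}. sublist P (Ss !\<^sub>1 j)}"

lemma suffix_from_inj: "inj_on (suffix_from S) {1..length S}"
proof (rule inj_onI)
  fix p q assume "p \<in> {1..length S}" "q \<in> {1..length S}" "suffix_from S p = suffix_from S q"
  then have "length S - (p - 1) = length S - (q - 1)"
    by (metis suffix_from_def length_drop)
  with \<open>p \<in> _\<close> \<open>q \<in> _\<close> show "p = q" by auto
qed

text \<open>
  The suffix array is the unique permutation of \<open>{1..n}\<close> that puts the suffixes in
  increasing order.
\<close>

lemma suffix_array_iff:
  "A = suffix_array S \<longleftrightarrow>
     length A = length S \<and> set A = {1..length S} \<and>
     (\<forall>i. 1 \<le> i \<and> i < length S \<longrightarrow> suffix_from S (A !\<^sub>1 i) < suffix_from S (A !\<^sub>1 (i + 1)))"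
  (is "_ \<longleftrightarrow> ?R A")
proof -
  let ?f = "suffix_from S" and ?n = "length S"
  have dist: "distinct (suffix_array S)" and set: "set (suffix_array S) = {1..?n}"
    and len: "length (suffix_array S) = ?n" and srt: "sorted (map ?f (suffix_array S))"
    by (simp_all add: suffix_array_def atLeastLessThanSuc_atLeastAtMost del: upt_Suc)
  have nxt: "(\<forall>i. 1 \<le> i \<and> i < ?n \<longrightarrow> ?f (B !\<^sub>1 i) < ?f (B !\<^sub>1 (i + 1))) \<longleftrightarrow>
      sorted_wrt (<) (map ?f B)" if "length B = ?n" for B
  proof -
    have "sorted_wrt (<) (map ?f B) \<longleftrightarrow> (\<forall>i. Suc i < ?n \<longrightarrow> ?f (B ! i) < ?f (B ! Suc i))"
      using that by (subst sorted_wrt_iff_nth_Suc_transp) (auto simp: transp_on_def)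
    also have "\<dots> \<longleftrightarrow> (\<forall>i. 1 \<le> i \<and> i < ?n \<longrightarrow> ?f (B !\<^sub>1 i) < ?f (B !\<^sub>1 (i + 1)))"
    proof (intro iffI allI impI)
      fix i
      assume *: "\<forall>i. Suc i < ?n \<longrightarrow> ?f (B ! i) < ?f (B ! Suc i)" and "1 \<le> i \<and> i < ?n"
      then obtain k where k: "i = Suc k" "Suc k < ?n" by (cases i) auto
      show "?f (B !\<^sub>1 i) < ?f (B !\<^sub>1 (i + 1))"
        using *[rule_format, OF k(2)] by (simp add: nth1_def k(1))
    next
      fix i
      assume *: "\<forall>i. 1 \<le> i \<and> i < ?n \<longrightarrow> ?f (B !\<^sub>1 i) < ?f (B !\<^sub>1 (i + 1))" and i: "Suc i < ?n"
      have "?f (B !\<^sub>1 Suc i) < ?f (B !\<^sub>1 (Suc i + 1))"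
        by (rule *[rule_format]) (simp add: i)
      then show "?f (B ! i) < ?f (B ! Suc i)" by (simp add: nth1_def)
    qed
    finally show ?thesis by (rule sym)
  qed
  have "sorted_wrt (<) (map ?f (suffix_array S))"
    using srt dist set suffix_from_inj[of S] by (simp add: strict_sorted_iff distinct_map)
  then have 1: "?R (suffix_array S)" unfolding nxt[OF len, symmetric] using set len by (intro conjI)
  have 2: "A = suffix_array S" if R: "?R A"
  proof -
    have "sorted_wrt (<) (map ?f (suffix_array S))" by fact
    moreover have "sorted_wrt (<) (map ?f A)"
      using R unfolding nxt[OF conjunct1[OF R], symmetric] by (elim conjE)
    moreover have "set (map ?f A) = set (map ?f (suffix_array S))" using R set by simp
    ultimately have "map ?f A = map ?f (suffix_array S)"
      by (rule strict_sorted_equal)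
    moreover have "inj_on ?f (set A \<union> set (suffix_array S))"
      using R set suffix_from_inj[of S] by simp
    ultimately show ?thesis by (simp add: inj_on_map_eq_map)
  qed
  show ?thesis
  proof
    assume "A = suffix_array S"
    then show "?R A" by (rule ssubst) (rule 1)
  qed (rule 2)
qed


section \<open>Compressed suffix arrays\<close>

text \<open>
  A compressed suffix array is a bit string \<open>c\<close> (whose length is the space it occupies) with
  two query algorithms, which see nothing but \<open>c\<close> and the query. It is used as a black box.
  \<^term>\<open>search_time\<close> (a function of the pattern length) and \<^term>\<open>lookup_time\<close>
  (a function of the text length) are bounds on the numbers of word-RAM steps of the queries;
  a query takes at least one step.
\<close>

record 'a csa =
  search :: "bool list \<Rightarrow> 'a list \<Rightarrow> nat \<times> nat"
  lookup :: "bool list \<Rightarrow> nat \<Rightarrow> nat"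
  search_time :: "nat \<Rightarrow> nat"
  lookup_time :: "nat \<Rightarrow> nat"

text \<open>
  A pattern that does not occur is answered with any \<open>[l..r]\<close> such that \<open>r < l\<close> and both
  bounds are within \<open>{0..n + 1}\<close>.
\<close>

definition is_csa ::
  "'a csa \<Rightarrow> bool list \<Rightarrow> 'a::{linorder,order_bot} list \<Rightarrow> bool" where
  "is_csa A c T \<longleftrightarrow>
     (\<forall>P l r. pattern P \<and> search A c P = (l, r) \<longrightarrow>
        l \<le> length T + 1 \<and> r \<le> length T \<and> {l..r} \<subseteq> {1..length T} \<and>
        (\<lambda>i. suffix_array T !\<^sub>1 i) ` {l..r} = {p \<in> {1..length T}. prefix P (suffix_from T p)}) \<and>
     (\<forall>i\<in>{1..length T}. lookup A c i = suffix_array T !\<^sub>1 i) \<and>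
     (\<forall>m\<ge>1. 1 \<le> search_time A m) \<and> 1 \<le> lookup_time A (length T)"


section \<open>The word RAM\<close>

text \<open>
  Registers and memory cells hold words of \<open>w\<close> bits, that is, numbers below \<open>2 ^ w\<close>, and
  addresses are words. The instructions are the usual unit-cost ones, plus calls of the two
  queries of the compressed suffix array, charged with \<^term>\<open>search_time\<close> and
  \<^term>\<open>lookup_time\<close>. A program has no access to the text or to the query pattern other
  than by these calls and through the contents of the memory.
\<close>

datatype operand = Reg nat | Const nat

datatype binop = Add | Sub | Mul | Div | Mod | And | Or | Xor | Shl | Shr

datatype test = Eq operand operand | Less operand operand

datatype com =
    Skip
  | Op binop nat operand operand   \<comment> \<open>register := operand op operand\<close>
  | Load nat operand               \<comment> \<open>register := memory[operand]\<close>
  | Store operand operand          \<comment> \<open>memory[operand] := operand\<close>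
  | Report operand
  | Search nat nat                 \<comment> \<open>the two ends of the interval of the query pattern\<close>
  | Lookup nat operand             \<comment> \<open>register := SA[operand]\<close>
  | Seq com com
  | Cond test com com
  | While test com

record state =
  regs :: "nat \<Rightarrow> nat"
  mem :: "nat \<Rightarrow> nat"
  reported :: "nat list"

fun operand_val :: "nat \<Rightarrow> state \<Rightarrow> operand \<Rightarrow> nat" where
  "operand_val w s (Reg x) = regs s x"
| "operand_val w s (Const k) = take_bit w k"

fun binop_val :: "nat \<Rightarrow> binop \<Rightarrow> nat \<Rightarrow> nat \<Rightarrow> nat" where
  "binop_val w Add x y = take_bit w (x + y)"
| "binop_val w Sub x y = take_bit w (x + 2 ^ w - y)"
| "binop_val w Mul x y = take_bit w (x * y)"
| "binop_val w Div x y = x div y"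
| "binop_val w Mod x y = x mod y"
| "binop_val w And x y = Bit_Operations.and x y"
| "binop_val w Or x y = Bit_Operations.or x y"
| "binop_val w Xor x y = Bit_Operations.xor x y"
| "binop_val w Shl x y = take_bit w (push_bit y x)"
| "binop_val w Shr x y = drop_bit y x"

fun test_val :: "nat \<Rightarrow> state \<Rightarrow> test \<Rightarrow> bool" where
  "test_val w s (Eq a b) \<longleftrightarrow> operand_val w s a = operand_val w s b"
| "test_val w s (Less a b) \<longleftrightarrow> operand_val w s a < operand_val w s b"

definition set_reg :: "nat \<Rightarrow> nat \<Rightarrow> state \<Rightarrow> state" where
  "set_reg x v s = s\<lparr>regs := (regs s)(x := v)\<rparr>"

text \<open>
  \<open>exec w A c n P q s t s'\<close>: with \<open>w\<close>-bit words, the compressed suffix array \<open>c\<close> of a text of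
  length \<open>n\<close> and the query pattern \<open>P\<close>, program \<open>q\<close> started in \<open>s\<close> halts in \<open>s'\<close> after time \<open>t\<close>.
\<close>

inductive exec ::
  "nat \<Rightarrow> 'a csa \<Rightarrow> bool list \<Rightarrow> nat \<Rightarrow> 'a list \<Rightarrow> com \<Rightarrow> state \<Rightarrow> nat \<Rightarrow> state \<Rightarrow> bool"
  for w A c n P
  where
  Skip: "exec w A c n P Skip s 1 s"
| Op: "exec w A c n P (Op f x a b) s 1
    (set_reg x (binop_val w f (operand_val w s a) (operand_val w s b)) s)"
| Load: "exec w A c n P (Load x a) s 1 (set_reg x (mem s (operand_val w s a)) s)"
| Store: "exec w A c n P (Store a b) s 1
    (s\<lparr>mem := (mem s)(operand_val w s a := operand_val w s b)\<rparr>)"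
| Report: "exec w A c n P (Report a) s 1 (s\<lparr>reported := reported s @ [operand_val w s a]\<rparr>)"
| Search: "search A c P = (l, r) \<Longrightarrow>
    exec w A c n P (Search x y) s (search_time A (length P))
      (set_reg y (take_bit w r) (set_reg x (take_bit w l) s))"
| Lookup: "exec w A c n P (Lookup x a) s (lookup_time A n)
    (set_reg x (take_bit w (lookup A c (operand_val w s a))) s)"
| Seq: "exec w A c n P q\<^sub>1 s t\<^sub>1 s' \<Longrightarrow> exec w A c n P q\<^sub>2 s' t\<^sub>2 s'' \<Longrightarrow>
    exec w A c n P (Seq q\<^sub>1 q\<^sub>2) s (t\<^sub>1 + t\<^sub>2) s''"
| CondTrue: "test_val w s b \<Longrightarrow> exec w A c n P q\<^sub>1 s t s' \<Longrightarrow>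
    exec w A c n P (Cond b q\<^sub>1 q\<^sub>2) s (Suc t) s'"
| CondFalse: "\<not> test_val w s b \<Longrightarrow> exec w A c n P q\<^sub>2 s t s' \<Longrightarrow>
    exec w A c n P (Cond b q\<^sub>1 q\<^sub>2) s (Suc t) s'"
| WhileFalse: "\<not> test_val w s b \<Longrightarrow> exec w A c n P (While b q) s 1 s"
| WhileTrue: "test_val w s b \<Longrightarrow> exec w A c n P q s t\<^sub>1 s' \<Longrightarrow>
    exec w A c n P (While b q) s' t\<^sub>2 s'' \<Longrightarrow>
    exec w A c n P (While b q) s (Suc (t\<^sub>1 + t\<^sub>2)) s''"

inductive_cases exec_SeqE: "exec w A c n P (Seq q\<^sub>1 q\<^sub>2) s t s'"
inductive_cases exec_CondE: "exec w A c n P (Cond b q\<^sub>1 q\<^sub>2) s t s'"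
inductive_cases exec_WhileE: "exec w A c n P (While b q) s t s'"

inductive_cases exec_atomEs:
  "exec w A c n P Skip s t s'"
  "exec w A c n P (Op f x a b) s t s'"
  "exec w A c n P (Load x a) s t s'"
  "exec w A c n P (Store a b) s t s'"
  "exec w A c n P (Report a) s t s'"
  "exec w A c n P (Search x y) s t s'"
  "exec w A c n P (Lookup x a) s t s'"

lemma exec_deterministic:
  "exec w A c n P q s t s' \<Longrightarrow> exec w A c n P q s u s'' \<Longrightarrow> t = u \<and> s' = s''"
proof (induction arbitrary: u s'' rule: exec.induct)
  case (Seq q\<^sub>1 s t\<^sub>1 s\<^sub>1 q\<^sub>2 t\<^sub>2 s\<^sub>2)
  from Seq.prems show ?case
  proof (rule exec_SeqE)
    fix u\<^sub>1 r u\<^sub>2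
    assume u: "u = u\<^sub>1 + u\<^sub>2"
      and 1: "exec w A c n P q\<^sub>1 s u\<^sub>1 r" and 2: "exec w A c n P q\<^sub>2 r u\<^sub>2 s''"
    have 3: "t\<^sub>1 = u\<^sub>1 \<and> s\<^sub>1 = r" by (rule Seq.IH(1)[OF 1])
    have "t\<^sub>2 = u\<^sub>2 \<and> s\<^sub>2 = s''" by (rule Seq.IH(2)) (use 2 3 in simp)
    with 3 u show ?thesis by simp
  qed
next
  case (CondTrue s b q\<^sub>1 t s' q\<^sub>2)
  from CondTrue.prems show ?case
    by (rule exec_CondE) (use CondTrue.hyps in \<open>auto dest: CondTrue.IH\<close>)
next
  case (CondFalse s b q\<^sub>2 t s' q\<^sub>1)
  from CondFalse.prems show ?case
    by (rule exec_CondE) (use CondFalse.hyps in \<open>auto dest: CondFalse.IH\<close>)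
next
  case (WhileFalse s b q)
  from WhileFalse.prems show ?case
    by (rule exec_WhileE) (use WhileFalse.hyps in simp_all)
next
  case (WhileTrue s b q t\<^sub>1 s\<^sub>1 t\<^sub>2 s\<^sub>2)
  from WhileTrue.prems show ?case
  proof (rule exec_WhileE)
    assume "\<not> test_val w s b"
    with WhileTrue.hyps show ?thesis by simp
  next
    fix u\<^sub>1 r u\<^sub>2
    assume u: "u = Suc (u\<^sub>1 + u\<^sub>2)"
      and 1: "exec w A c n P q s u\<^sub>1 r" and 2: "exec w A c n P (While b q) r u\<^sub>2 s''"
    have 3: "t\<^sub>1 = u\<^sub>1 \<and> s\<^sub>1 = r" by (rule WhileTrue.IH(1)[OF 1])
    have "t\<^sub>2 = u\<^sub>2 \<and> s\<^sub>2 = s''" by (rule WhileTrue.IH(2)) (use 2 3 in simp)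
    with 3 u show ?thesis by simp
  qed
qed (auto elim: exec_atomEs)

text \<open>
  The bit string \<open>E\<close> occupies the first cells of the memory, packed into \<open>w\<close>-bit words; all
  other bits of the memory are unconstrained.
\<close>

definition holds_bits :: "nat \<Rightarrow> (nat \<Rightarrow> nat) \<Rightarrow> bool list \<Rightarrow> bool" where
  "holds_bits w M E \<longleftrightarrow>
     (\<forall>a. M a < 2 ^ w) \<and> (\<forall>k<length E. bit (M (k div w)) (k mod w) = E ! k)"

text \<open>The parameters \<open>n\<close> and \<open>w\<close> of the machine are known to the program.\<close>

definition init_state :: "nat \<Rightarrow> nat \<Rightarrow> (nat \<Rightarrow> nat) \<Rightarrow> state" where
  "init_state w n M =
     \<lparr>regs = (\<lambda>_. 0)(0 := take_bit w n, 1 := take_bit w w), mem = M, reported = []\<rparr>"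

text \<open>
  With \<open>E\<close> stored next to the compressed suffix array, \<open>q\<close> reports each document containing \<open>P\<close>
  exactly once, in time at most \<open>b\<close>. The working space need not be initialised, and \<open>E\<close> is intact
  in the end, so that further queries can follow.
\<close>

definition lists_docs_within ::
  "nat \<Rightarrow> 'a csa \<Rightarrow> bool list \<Rightarrow> bool list \<Rightarrow> com \<Rightarrow> 'a list list \<Rightarrow> 'a list \<Rightarrow> real \<Rightarrow> bool" where
  "lists_docs_within w A c E q Ss P b \<longleftrightarrow>
     (\<forall>M. holds_bits w M E \<longrightarrow>
        (\<exists>t s. exec w A c (length (concat Ss)) P q (init_state w (length (concat Ss)) M) t s \<and>
           distinct (reported s) \<and> set (reported s) = docs_with Ss P \<and>
           holds_bits w (mem s) E \<and> real t \<le> b))"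

end

theory Submission
  imports Defs "HOL-Library.Discrete_Functions"
begin

text \<open>
  Let \<open>[l..r]\<close> be the interval of \<open>P\<close>. The suffixes of one document that start with \<open>P\<close> are
  consecutive in its own suffix array, and only the first of them agrees with its predecessor on
  fewer than \<open>|P|\<close> symbols. So \<open>ILCP[i] < |P|\<close> holds for exactly one \<open>i\<close> in \<open>[l..r]\<close> per document
  containing \<open>P\<close>, its first occurrence in \<open>DA[l..r]\<close>. These positions fill whole runs (clipped to
  \<open>[l..r]\<close>), and they are found from left to right by recursive range-minimum queries over the runs;
  the values of \<open>ILCP\<close> are not needed, since a range of runs is exhausted as soon as the document at
  the start of its leftmost minimal run has already been reported.

  The starts of the runs and of the documents are stored as Elias--Fano sequences, in which a
  predecessor query takes \<open>O(lg n)\<close> time; \<open>DA[i]\<close> is the predecessor of \<open>SA[i]\<close>. For the range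
  minima, the runs are cut into blocks of one run per bit of a word: inside a block two bits per run
  encode the minima of all windows, and a segment tree has two words per block, so that \<open>O(\<rho>)\<close>
  bits suffice and a query takes \<open>O(lg n)\<close> time.
\<close>

section \<open>Documents and the interleaved LCP array\<close>

text \<open>The shape of the data structures comes from a balance: \<open>lg n\<close> steps per
  query leave time to go bit by bit through one block of \<open>w\<close> bits, and linearly many
  extra bits leave room for one word per \<open>w\<close> entries. The test that replaces the values
  of ILCP rests on the order of work: everything left of the current range is finished. If the
  minimum of the range is at least \<open>|P|\<close>, no first occurrence lies in the range, so the
  first occurrence of the tested document is further left and has been reported. If the minimum is
  smaller, every row of the clipped run is a first occurrence, so the tested document is new.
  Marking documents in a bit array would need \<open>d\<close> bits to be cleared per query; a list
  with back pointers tolerates uninitialised memory instead. The running time is amortised: an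
  answered window disappears from the stack, and a step that reports documents adds at most two
  ranges, each to be cut into at most three pieces. The program knows only \<open>n\<close> and
  \<open>w\<close>, so the stored bits must also reveal \<rho> and \<open>d\<close>.\<close>

lemma document_drop: "document S \<Longrightarrow> k < length S \<Longrightarrow> document (drop k S)"
  by (auto simp: document_def last_drop butlast_drop dest: in_set_dropD)

lemma document_Cons:
  "document (a # u) \<longleftrightarrow> (if u = [] then a = bot else a \<noteq> bot \<and> document u)"
  by (auto simp: document_def)

text \<open>The terminator occurs only at the end, so of two distinct documents neither is a prefix
  of the other, and their first difference decides the comparison whatever follows.\<close>

lemma append_less_iff_document:
  assumes "document u" "document v" "u \<noteq> v"
  shows "u @ x < v @ y \<longleftrightarrow> u < v"
  using assms
proof (induction u arbitrary: v)
  case Nil then show ?case by (simp add: document_def)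
next
  case (Cons a u)
  then obtain b v' where v: "v = b # v'" by (cases v) (auto simp: document_def)
  show ?case
    using Cons v by (cases "a = b") (auto simp: document_Cons split: if_splits)
qed

text \<open>A pattern avoids the terminator, so a match cannot run past the end of
  \<open>u\<close>.\<close>

lemma prefix_append_document:
  assumes "document u" "bot \<notin> set P"
  shows "prefix P (u @ x) \<longleftrightarrow> prefix P u"
  using assms
proof (induction u arbitrary: P)
  case Nil then show ?case by (simp add: document_def)
next
  case (Cons a u)
  then show ?case by (cases P) (auto simp: document_Cons split: if_splits)
qed

lemma suffix_array_props:
  shows length_suffix_array: "length (suffix_array S) = length S"
    and set_suffix_array: "set (suffix_array S) = {1..length S}"
    and distinct_suffix_array: "distinct (suffix_array S)"
  by (simp_all add: suffix_array_def atLeastLessThanSuc_atLeastAtMost del: upt_Suc)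

lemma sorted_suffix_array:
  "sorted_wrt (\<lambda>p q. suffix_from S p < suffix_from S q) (suffix_array S)"
proof -
  have "sorted (map (suffix_from S) (suffix_array S))"
    by (simp add: suffix_array_def)
  moreover have "distinct (map (suffix_from S) (suffix_array S))"
    using suffix_array_props[of S] suffix_from_inj[of S] by (simp add: distinct_map)
  ultimately show ?thesis
    by (simp add: strict_sorted_iff flip: sorted_wrt_map)
qed

lemma suffix_array_eqI:
  assumes "set B = {1..length S}" "sorted_wrt (\<lambda>p q. suffix_from S p < suffix_from S q) B"
  shows "B = suffix_array S"
proof -
  have "distinct B"
    using assms(2) by (induction B) auto
  then have len: "length B = length S"
    using assms(1) distinct_card[of B] by simp
  have "suffix_from S (B !\<^sub>1 i) < suffix_from S (B !\<^sub>1 (i + 1))" if "1 \<le> i \<and> i < length S" for i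
    using sorted_wrt_nth_less[OF assms(2), of "i - 1" i] that len by (simp add: nth1_def)
  then show ?thesis
    unfolding suffix_array_iff using assms len by blast
qed

text \<open>Documents are numbered from 0 here: \<open>Ss ! j\<close> occupies the text positions
  from \<open>doc_start Ss j + 1\<close> to \<open>doc_start Ss (Suc j)\<close>.\<close>

definition doc_start :: "'a list list \<Rightarrow> nat \<Rightarrow> nat" where
  "doc_start Ss j = length (concat (take j Ss))"

lemma doc_start_0 [simp]: "doc_start Ss 0 = 0"
  by (simp add: doc_start_def)

lemma doc_start_Suc: "j < length Ss \<Longrightarrow> doc_start Ss (Suc j) = doc_start Ss j + length (Ss ! j)"
  by (simp add: doc_start_def take_Suc_conv_app_nth)

lemma doc_start_length: "doc_start Ss (length Ss) = length (concat Ss)"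
  by (simp add: doc_start_def)

lemma doc_start_mono: "i \<le> j \<Longrightarrow> doc_start Ss i \<le> doc_start Ss j"
  unfolding doc_start_def
  by (metis append_take_drop_id concat_append le_add1 length_append min.absorb1 take_take)

lemma doc_start_less:
  assumes "collection Ss" "i < j" "j \<le> length Ss" shows "doc_start Ss i < doc_start Ss j"
proof -
  have "Ss ! i \<noteq> []" using assms by (auto simp: collection_def document_def)
  then have "doc_start Ss i < doc_start Ss (Suc i)"
    using assms by (simp add: doc_start_Suc)
  also have "\<dots> \<le> doc_start Ss j" using assms by (intro doc_start_mono) simp
  finally show ?thesis .
qed

lemma doc_ofI:
  assumes "j < length Ss" "doc_start Ss j < p" "p \<le> doc_start Ss (Suc j)"
  shows "doc_of Ss p = Suc j"
  unfolding doc_of_def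
proof (rule Least_equality)
  show "p \<le> length (concat (take (Suc j) Ss))" using assms by (simp add: doc_start_def)
next
  fix i assume "p \<le> length (concat (take i Ss))"
  then have "doc_start Ss j < doc_start Ss i" using assms by (simp add: doc_start_def)
  then show "Suc j \<le> i" using doc_start_mono[of i j Ss] by (meson not_less not_less_eq_eq)
qed

lemma ex_doc:
  assumes "p \<in> {1..length (concat Ss)}"
  obtains j where "j < length Ss" "doc_start Ss j < p" "p \<le> doc_start Ss (Suc j)"
proof -
  define i where "i = (LEAST i. p \<le> doc_start Ss i)"
  have ex: "p \<le> doc_start Ss (length Ss)" using assms by (simp add: doc_start_length)
  have i: "p \<le> doc_start Ss i" unfolding i_def by (rule LeastI) (rule ex)
  have il: "i \<le> length Ss" unfolding i_def by (rule Least_le) (rule ex)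
  have "i \<noteq> 0" using i assms by (intro notI) simp
  then obtain j where j: "i = Suc j" by (cases i) auto
  have "\<not> p \<le> doc_start Ss j"
    using not_less_Least[of j "\<lambda>i. p \<le> doc_start Ss i"] j by (simp flip: i_def)
  then show ?thesis using that[of j] i il j by (simp add: not_le)
qed

lemma suffix_from_concat:
  assumes "j < length Ss" "doc_start Ss j < p" "p \<le> doc_start Ss (Suc j)"
  shows "suffix_from (concat Ss) p =
    suffix_from (Ss ! j) (p - doc_start Ss j) @ concat (drop (Suc j) Ss)"
proof -
  have "concat Ss = concat (take j Ss) @ Ss ! j @ concat (drop (Suc j) Ss)"
    using assms(1) by (metis concat.simps(2) concat_append id_take_nth_drop)
  then show ?thesis
    using assms by (simp add: suffix_from_def doc_start_def take_Suc_conv_app_nth)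
qed

lemma document_suffix_from:
  "document S \<Longrightarrow> 1 \<le> p \<Longrightarrow> p \<le> length S \<Longrightarrow> document (suffix_from S p)"
  unfolding suffix_from_def by (rule document_drop) auto

section \<open>Suffixes of one document inside the text\<close>

context
  fixes Ss :: "'a::{linorder,order_bot} list list"
  assumes coll: "collection Ss"
begin

private abbreviation (input) "T \<equiv> concat Ss"
private abbreviation (input) "SA \<equiv> suffix_array (concat Ss)"

lemma doc_nth: "j < length Ss \<Longrightarrow> document (Ss ! j)"
  using coll by (auto simp: collection_def)

lemma doc_of_eq_Suc_iff:
  assumes "p \<in> {1..length T}" "j < length Ss"
  shows "doc_of Ss p = Suc j \<longleftrightarrow> doc_start Ss j < p \<and> p \<le> doc_start Ss (Suc j)"
proof -
  obtain i where i: "i < length Ss" "doc_start Ss i < p" "p \<le> doc_start Ss (Suc i)"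
    using ex_doc assms by blast
  then have "doc_of Ss p = Suc i" by (rule doc_ofI)
  then show ?thesis using i doc_ofI[OF assms(2)] by auto
qed

lemma local_pos:
  assumes "p \<in> {1..length T}" "j < length Ss" "doc_of Ss p = Suc j"
  shows "p - doc_start Ss j \<in> {1..length (Ss ! j)}"
    and "suffix_from T p = suffix_from (Ss ! j) (p - doc_start Ss j) @ concat (drop (Suc j) Ss)"
    and "document (suffix_from (Ss ! j) (p - doc_start Ss j))"
proof -
  have *: "doc_start Ss j < p" "p \<le> doc_start Ss (Suc j)"
    using doc_of_eq_Suc_iff assms by blast+
  show "p - doc_start Ss j \<in> {1..length (Ss ! j)}"
    using * assms by (auto simp: doc_start_Suc)
  then show "document (suffix_from (Ss ! j) (p - doc_start Ss j))"
    using doc_nth assms by (intro document_suffix_from) auto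
  show "suffix_from T p = suffix_from (Ss ! j) (p - doc_start Ss j) @ concat (drop (Suc j) Ss)"
    using suffix_from_concat * assms by blast
qed

text \<open>The part inside the document decides the order of two text suffixes that start in it, so
  filtering the sorted list of all suffixes leaves the suffixes of the document sorted.\<close>

lemma suffix_array_document:
  assumes j: "j < length Ss"
  shows "map (\<lambda>p. p - doc_start Ss j) (filter (\<lambda>p. doc_of Ss p = Suc j) SA) = suffix_array (Ss ! j)"
    (is "map ?loc ?F = _")
proof (rule suffix_array_eqI)
  have F: "set ?F = {p \<in> {1..length T}. doc_of Ss p = Suc j}"
    by (auto simp: set_suffix_array)
  show "set (map ?loc ?F) = {1..length (Ss ! j)}"
  proof
    show "set (map ?loc ?F) \<subseteq> {1..length (Ss ! j)}"
      unfolding set_map F using local_pos(1)[OF _ j] by blast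
    show "{1..length (Ss ! j)} \<subseteq> set (map ?loc ?F)"
    proof
      fix q assume q: "q \<in> {1..length (Ss ! j)}"
      let ?p = "q + doc_start Ss j"
      have "doc_start Ss (Suc j) \<le> length T"
        using j doc_start_mono[of "Suc j" "length Ss" Ss] by (simp add: doc_start_length)
      then have "?p \<in> {1..length T}"
        using q j by (simp add: doc_start_Suc)
      moreover have "doc_of Ss ?p = Suc j"
        using q j by (intro doc_ofI) (auto simp: doc_start_Suc)
      ultimately have "?p \<in> set ?F" using F by blast
      then show "q \<in> set (map ?loc ?F)" by force
    qed
  qed
  have "sorted_wrt (\<lambda>p q. suffix_from T p < suffix_from T q) ?F"
    by (rule sorted_wrt_filter) (rule sorted_suffix_array)
  moreover have "suffix_from (Ss ! j) (?loc p) < suffix_from (Ss ! j) (?loc q)"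
    if p: "p \<in> set ?F" and q: "q \<in> set ?F" and lt: "suffix_from T p < suffix_from T q" for p q
  proof -
    have p': "p \<in> {1..length T}" "doc_of Ss p = Suc j" and q': "q \<in> {1..length T}" "doc_of Ss q = Suc j"
      using p q F by blast+
    note eqs = local_pos(2)[OF p'(1) j p'(2)] local_pos(2)[OF q'(1) j q'(2)]
    have ne: "suffix_from (Ss ! j) (?loc p) \<noteq> suffix_from (Ss ! j) (?loc q)"
      using lt unfolding eqs by auto
    show ?thesis
      using lt append_less_iff_document[OF local_pos(3)[OF p'(1) j p'(2)] local_pos(3)[OF q'(1) j q'(2)] ne]
      unfolding eqs by blast
  qed
  ultimately show "sorted_wrt (\<lambda>p q. suffix_from (Ss ! j) p < suffix_from (Ss ! j) q) (map ?loc ?F)"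
    unfolding sorted_wrt_map by (rule sorted_wrt_mono_rel[rotated])
qed

lemma prefix_suffix_from:
  assumes "p \<in> {1..length T}" "j < length Ss" "doc_of Ss p = Suc j" "pattern P"
  shows "prefix P (suffix_from T p) \<longleftrightarrow> prefix P (suffix_from (Ss ! j) (p - doc_start Ss j))"
  using local_pos[OF assms(1-3)] assms(4) by (simp add: prefix_append_document pattern_def)

lemma docs_with_eq:
  assumes P: "pattern P"
  shows "docs_with Ss P = doc_of Ss ` {p \<in> {1..length T}. prefix P (suffix_from T p)}"
proof
  show "doc_of Ss ` {p \<in> {1..length T}. prefix P (suffix_from T p)} \<subseteq> docs_with Ss P"
  proof clarify
    fix p assume p: "p \<in> {1..length T}" "prefix P (suffix_from T p)"
    then obtain j where j: "j < length Ss" "doc_of Ss p = Suc j"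
      using ex_doc doc_ofI by metis
    then have "prefix P (suffix_from (Ss ! j) (p - doc_start Ss j))"
      using prefix_suffix_from p P by blast
    then have "sublist P (Ss ! j)"
      unfolding suffix_from_def by (meson prefix_imp_sublist sublist_drop sublist_order.order.trans)
    then show "doc_of Ss p \<in> docs_with Ss P"
      using j by (simp add: docs_with_def nth1_def)
  qed
  show "docs_with Ss P \<subseteq> doc_of Ss ` {p \<in> {1..length T}. prefix P (suffix_from T p)}"
  proof
    fix i assume "i \<in> docs_with Ss P"
    then obtain j where j: "i = Suc j" "j < length Ss" "sublist P (Ss ! j)"
      by (cases i) (auto simp: docs_with_def nth1_def)
    then obtain u v where uv: "Ss ! j = u @ P @ v" by (auto simp: sublist_def)
    let ?q = "Suc (length u)"
    let ?p = "?q + doc_start Ss j"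
    have pre: "prefix P (suffix_from (Ss ! j) ?q)" by (simp add: suffix_from_def uv)
    have "P \<noteq> []" using P by (simp add: pattern_def)
    then have q: "?q \<le> length (Ss ! j)" by (cases P) (simp_all add: uv)
    have "doc_start Ss (Suc j) \<le> length T"
      using j doc_start_mono[of "Suc j" "length Ss" Ss] by (simp add: doc_start_length)
    then have p: "?p \<in> {1..length T}"
      using q j by (simp add: doc_start_Suc)
    have d: "doc_of Ss ?p = Suc j"
      using q j by (intro doc_ofI) (auto simp: doc_start_Suc)
    have "prefix P (suffix_from T ?p)"
      using prefix_suffix_from[OF p j(2) d P] pre by simp
    then show "i \<in> doc_of Ss ` {p \<in> {1..length T}. prefix P (suffix_from T p)}"
      using p d j(1) by force
  qed
qed

text \<open>The rank in the definition of \<open>ilcp\<close> counts the rows of the same document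
  up to row \<open>i\<close>, and the suffix array of the document lists these rows in the same
  order. Its LCP entry therefore compares row \<open>i\<close> with the closest earlier row of that
  document, the last entry of \<open>G\<close>.\<close>

lemma ilcp_nth:
  fixes i
  defines "p \<equiv> SA ! i"
  assumes i: "i < length T" and j: "j < length Ss" "doc_of Ss p = Suc j"
  defines "G \<equiv> filter (\<lambda>q. doc_of Ss q = Suc j) (take i SA)"
  shows "ilcp Ss ! i = (if G = [] then 0 else
    lcp (suffix_from (Ss ! j) (last G - doc_start Ss j)) (suffix_from (Ss ! j) (p - doc_start Ss j)))"
proof -
  let ?loc = "\<lambda>p. p - doc_start Ss j"
  let ?F = "filter (\<lambda>p. doc_of Ss p = Suc j) SA"
  let ?k = "Suc (length G)"
  have SA: "SA = take i SA @ p # drop (Suc i) SA"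
    using i unfolding p_def by (simp add: id_take_nth_drop length_suffix_array)
  have F: "?F = G @ p # filter (\<lambda>p. doc_of Ss p = Suc j) (drop (Suc i) SA)"
    by (subst SA) (simp add: G_def j)
  have len: "?k \<le> length (Ss ! j)"
    using arg_cong[OF suffix_array_document[OF j(1)], of length] F by (simp add: length_suffix_array)
  have loc: "suffix_array (Ss ! j) ! q = ?loc (?F ! q)" if "q < ?k" for q
    using that F unfolding suffix_array_document[OF j(1), symmetric] by (subst nth_map) simp_all
  have da: "doc_array Ss ! i = Suc j"
    using i j by (simp add: doc_array_def length_suffix_array p_def)
  have "take (Suc i) SA = take i SA @ [p]"
    using i by (simp add: take_Suc_conv_app_nth length_suffix_array p_def)
  then have rank: "seq_rank (Suc j) (doc_array Ss) (Suc i) = ?k"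
    using j by (simp add: seq_rank_def doc_array_def take_map G_def count_list_eq_length_filter
      filter_map o_def eq_commute)
  have "ilcp Ss ! i = lcp_array (Ss ! j) ! length G"
    using i da rank by (simp add: ilcp_def nth1_def Let_def del: upt_Suc)
  also have "\<dots> = (if G = [] then 0 else lcp (suffix_from (Ss ! j) (suffix_array (Ss ! j) ! (length G - 1)))
     (suffix_from (Ss ! j) (suffix_array (Ss ! j) ! length G)))"
    using len by (auto simp: lcp_array_def nth1_def simp del: upt_Suc)
  also have "\<dots> = (if G = [] then 0 else lcp (suffix_from (Ss ! j) (?loc (last G)))
     (suffix_from (Ss ! j) (?loc p)))"
    using F loc[of "length G - 1"] loc[of "length G"]
    by (auto simp: nth_append last_conv_nth)
  finally show ?thesis .
qed

lemma length_le_lcp_iff: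
  assumes "prefix P v" shows "length P \<le> lcp u v \<longleftrightarrow> prefix P u"
proof
  assume "prefix P u"
  then have "prefix P (longest_common_prefix u v)"
    using assms by (rule longest_common_prefix_max_prefix)
  then show "length P \<le> lcp u v" by (simp add: lcp_def prefix_length_le)
next
  assume "length P \<le> lcp u v"
  then have "prefix P (longest_common_prefix u v)"
    unfolding lcp_def by (rule prefix_length_prefix[OF assms longest_common_prefix_prefix2])
  then show "prefix P u" using longest_common_prefix_prefix1 prefix_order.trans by blast
qed

text \<open>The closest earlier row of the same document agrees with row \<open>i\<close> on
  \<open>length P\<close> symbols iff its suffix starts with \<open>P\<close>, that is, iff it lies
  in the interval. Being the closest, it lies there iff any earlier row of the document
  does.\<close>

lemma ilcp_less_iff:
  assumes P: "pattern P" and hi: "hi \<le> length T"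
    and ivl: "\<And>i. i < length T \<Longrightarrow> prefix P (suffix_from T (SA ! i)) \<longleftrightarrow> lo \<le> i \<and> i < hi"
    and i: "lo \<le> i" "i < hi"
  shows "ilcp Ss ! i < length P \<longleftrightarrow> doc_array Ss ! i \<notin> (\<lambda>q. doc_array Ss ! q) ` {lo..<i}"
proof -
  have SA: "SA ! q \<in> {1..length T}" if "q < length T" for q
    using that set_suffix_array[of T] nth_mem[of q SA] by (auto simp: length_suffix_array)
  have da: "doc_array Ss ! q = doc_of Ss (SA ! q)" if "q < length T" for q
    using that by (simp add: doc_array_def length_suffix_array)
  have iT: "i < length T" using i hi by simp
  obtain j where j: "j < length Ss" "doc_of Ss (SA ! i) = Suc j"
    using ex_doc[OF SA[OF iT]] doc_ofI by metis
  define G where "G = filter (\<lambda>q. doc_of Ss q = Suc j) (take i SA)"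
  have il: "ilcp Ss ! i = (if G = [] then 0 else
    lcp (suffix_from (Ss ! j) (last G - doc_start Ss j)) (suffix_from (Ss ! j) (SA ! i - doc_start Ss j)))"
    unfolding G_def by (rule ilcp_nth[OF iT j])
  have pre_i: "prefix P (suffix_from (Ss ! j) (SA ! i - doc_start Ss j))"
    using prefix_suffix_from[OF SA[OF iT] j P] ivl[OF iT] i by simp
  have "length P > 0" using P by (simp add: pattern_def)
  show ?thesis
  proof (cases "G = []")
    case True
    have "doc_array Ss ! q \<noteq> Suc j" if "q < i" for q
    proof -
      have "SA ! q \<in> set (take i SA)"
        using that iT by (auto simp: in_set_conv_nth length_suffix_array)
      then show ?thesis using True that iT da[of q] by (auto simp: G_def filter_empty_conv)
    qed
    then show ?thesis
      using True il \<open>length P > 0\<close> da[OF iT] j by (auto simp: image_iff) (metis)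
  next
    case False
    let ?Q = "\<lambda>q. q < i \<and> doc_of Ss (SA ! q) = Suc j"
    \<comment> \<open>The interval speaks of rows, whereas \<open>last G\<close> is a text position;
      it is traced back to the largest row below \<open>i\<close> of this document.\<close>
    have Gq: "\<exists>q. ?Q q \<and> last G = SA ! q \<and> (\<forall>q'. ?Q q' \<longrightarrow> q' \<le> q)"
    proof -
      have "filter (\<lambda>q. doc_of Ss q = Suc j) (take k SA) = [] \<or>
        (\<exists>q. q < k \<and> doc_of Ss (SA ! q) = Suc j \<and> last (filter (\<lambda>q. doc_of Ss q = Suc j) (take k SA)) = SA ! q \<and>
          (\<forall>q'. q' < k \<and> doc_of Ss (SA ! q') = Suc j \<longrightarrow> q' \<le> q))" if "k \<le> i" for k
        using that
      proof (induction k)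
        case 0 then show ?case by simp
      next
        case (Suc k)
        have tk: "take (Suc k) SA = take k SA @ [SA ! k]"
          using Suc.prems iT by (simp add: take_Suc_conv_app_nth length_suffix_array)
        show ?case
        proof (cases "doc_of Ss (SA ! k) = Suc j")
          case True
          then show ?thesis unfolding tk by (intro disjI2 exI[of _ k]) auto
        next
          case False
          then show ?thesis using Suc.IH Suc.prems unfolding tk
            by (auto simp: less_Suc_eq)
        qed
      qed
      from this[of i] False show ?thesis by (auto simp: G_def)
    qed
    then obtain q where q: "q < i" "doc_of Ss (SA ! q) = Suc j" "last G = SA ! q"
      and qmax: "\<And>q'. q' < i \<Longrightarrow> doc_of Ss (SA ! q') = Suc j \<Longrightarrow> q' \<le> q" by blast
    have qT: "q < length T" using q iT by simp
    have "length P \<le> ilcp Ss ! i \<longleftrightarrow> prefix P (suffix_from (Ss ! j) (SA ! q - doc_start Ss j))"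
      using il False q(3) length_le_lcp_iff[OF pre_i] by simp
    also have "\<dots> \<longleftrightarrow> lo \<le> q \<and> q < hi"
      using prefix_suffix_from[OF SA[OF qT] j(1) q(2) P] ivl[OF qT] by simp
    also have "\<dots> \<longleftrightarrow> doc_array Ss ! i \<in> (\<lambda>q. doc_array Ss ! q) ` {lo..<i}"
    proof
      assume "lo \<le> q \<and> q < hi"
      then show "doc_array Ss ! i \<in> (\<lambda>q. doc_array Ss ! q) ` {lo..<i}"
        using q da[OF iT] da[OF qT] j by (intro rev_image_eqI[of q]) auto
    next
      assume "doc_array Ss ! i \<in> (\<lambda>q. doc_array Ss ! q) ` {lo..<i}"
      then obtain q' where q': "lo \<le> q'" "q' < i" "doc_array Ss ! q' = doc_array Ss ! i" by auto
      have "q' \<le> q"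
        using qmax[OF q'(2)] q'(3) da[OF iT] da[OF less_trans[OF q'(2) iT]] j(2) by simp
      then show "lo \<le> q \<and> q < hi" using q' q i by simp
    qed
    finally show ?thesis by (meson not_le)
  qed
qed

end

section \<open>Runs and their left ends\<close>

definition run_starts :: "'b list \<Rightarrow> nat list" where
  "run_starts xs = filter (\<lambda>p. p = 0 \<or> xs ! (p - 1) \<noteq> xs ! p) [0..<length xs]"

text \<open>A run is determined by its left end. Conversely, each position that differs from its
  predecessor, and position 0, extends to a maximal constant stretch.\<close>

lemma card_runs: "card (runs xs) = length (run_starts xs)"
proof -
  let ?S = "{p. p < length xs \<and> (p = 0 \<or> xs ! (p - 1) \<noteq> xs ! p)}"
  have "bij_betw (\<lambda>r. fst r - 1) (runs xs) ?S"
    unfolding bij_betw_def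
  proof
    have uniq: "b \<le> b'" if "(a, b) \<in> runs xs" "(a, b') \<in> runs xs" for a b b'
    proof (rule ccontr)
      assume lt: "\<not> b \<le> b'"
      have b: "b \<le> length xs" "\<And>i. i \<in> {a..b} \<Longrightarrow> xs !\<^sub>1 i = xs !\<^sub>1 a"
        using that(1) unfolding runs_def by blast+
      have b': "a \<le> b'" "b' < length xs \<Longrightarrow> xs !\<^sub>1 (b' + 1) \<noteq> xs !\<^sub>1 b'"
        using that(2) unfolding runs_def by blast+
      have "xs !\<^sub>1 (b' + 1) = xs !\<^sub>1 b'"
        using b(2)[of "b' + 1"] b(2)[of b'] b'(1) lt by simp
      then show False using b'(2) b(1) lt by simp
    qed
    have lb: "1 \<le> a" "a \<le> b" "b \<le> length xs" "a > 1 \<longrightarrow> xs !\<^sub>1 (a - 1) \<noteq> xs !\<^sub>1 a"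
      if "(a, b) \<in> runs xs" for a b
      using that unfolding runs_def by blast+
    show "inj_on (\<lambda>r. fst r - 1) (runs xs)"
    proof (rule inj_onI)
      fix r r' assume r: "r \<in> runs xs" "r' \<in> runs xs" "fst r - 1 = fst r' - 1"
      obtain a b a' b' where ab: "r = (a, b)" "r' = (a', b')" by (metis surj_pair)
      have "a = a'" using r ab lb(1)[of a b] lb(1)[of a' b'] by simp
      then show "r = r'" using r ab uniq[of a b b'] uniq[of a b' b] by auto
    qed
    show "(\<lambda>r. fst r - 1) ` runs xs = ?S"
    proof
      show "(\<lambda>r. fst r - 1) ` runs xs \<subseteq> ?S"
      proof clarify
        fix a b assume "(a, b) \<in> runs xs"
        from lb[OF this] show "fst (a, b) - 1 < length xs \<and>
          (fst (a, b) - 1 = 0 \<or> xs ! (fst (a, b) - 1 - 1) \<noteq> xs ! (fst (a, b) - 1))"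
          by (cases "a = 1") (auto simp: nth1_def)
      qed
      show "?S \<subseteq> (\<lambda>r. fst r - 1) ` runs xs"
      proof
        fix p assume p: "p \<in> ?S"
        define R where "R b \<longleftrightarrow> Suc p \<le> b \<and> b \<le> length xs \<and>
          (\<forall>i\<in>{Suc p..b}. xs !\<^sub>1 i = xs !\<^sub>1 (Suc p))" for b
        have R0: "R (Suc p)" using p by (auto simp: R_def)
        have bnd: "b \<le> length xs" if "R b" for b using that by (simp add: R_def)
        define b where "b = Greatest R"
        have b: "R b" unfolding b_def by (rule GreatestI_nat[of R, OF R0]) (rule bnd)
        then have b': "Suc p \<le> b" "b \<le> length xs"
          and beq: "\<And>i. i \<in> {Suc p..b} \<Longrightarrow> xs !\<^sub>1 i = xs !\<^sub>1 (Suc p)"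
          unfolding R_def by blast+
        have "xs !\<^sub>1 (b + 1) \<noteq> xs !\<^sub>1 b" if "b < length xs"
        proof
          assume eq: "xs !\<^sub>1 (b + 1) = xs !\<^sub>1 b"
          have "xs !\<^sub>1 i = xs !\<^sub>1 (Suc p)" if "i \<in> {Suc p..b + 1}" for i
            using that beq[of i] beq[of b] eq b'(1) by (cases "i = b + 1") simp_all
          moreover have "Suc p \<le> b + 1" "b + 1 \<le> length xs" using b'(1) that by simp_all
          ultimately have "R (b + 1)" unfolding R_def by blast
          then have "b + 1 \<le> b" unfolding b_def by (rule Greatest_le_nat[of R]) (rule bnd)
          then show False by simp
        qed
        moreover have "Suc p > 1 \<longrightarrow> xs !\<^sub>1 (Suc p - 1) \<noteq> xs !\<^sub>1 (Suc p)"
          using p by (auto simp: nth1_def)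
        moreover have "1 \<le> Suc p" by simp
        ultimately have "(Suc p, b) \<in> runs xs"
          using b'(1,2) beq unfolding runs_def by blast
        then show "p \<in> (\<lambda>r. fst r - 1) ` runs xs" by force
      qed
    qed
  qed
  then have "card (runs xs) = card ?S" by (rule bij_betw_same_card)
  also have "?S = set (run_starts xs)" by (auto simp: run_starts_def)
  also have "card \<dots> = length (run_starts xs)"
    by (rule distinct_card) (simp add: run_starts_def)
  finally show ?thesis .
qed

section \<open>Bit strings in memory and a calculus for running times\<close>

fun block :: "com list \<Rightarrow> com" where
  "block [] = Skip"
| "block [q] = q"
| "block (q # q' # qs) = Seq q (block (q' # qs))"

definition table :: "nat \<Rightarrow> nat \<Rightarrow> (nat \<Rightarrow> nat) \<Rightarrow> bool list" where
  "table m k f = map (\<lambda>p. bit (f (p div k)) (p mod k)) [0..<m * k]"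

definition segment :: "bool list \<Rightarrow> nat \<Rightarrow> bool list \<Rightarrow> bool" where
  "segment E B xs \<longleftrightarrow> B + length xs \<le> length E \<and> take (length xs) (drop B E) = xs"

definition bits_at :: "bool list \<Rightarrow> nat \<Rightarrow> nat \<Rightarrow> nat" where
  "bits_at E p k = horner_sum of_bool 2 (take k (drop p E))"

lemma length_table [simp]: "length (table m k f) = m * k"
  by (simp add: table_def)

lemma segment_append:
  "segment E B (xs @ ys) \<longleftrightarrow> segment E B xs \<and> segment E (B + length xs) ys"
proof -
  have "take (length xs + length ys) (drop B E) =
      take (length xs) (drop B E) @ take (length ys) (drop (B + length xs) E)"
    by (simp add: take_add add.commute)
  moreover have "length (take (length xs) (drop B E)) = length xs" if "B + length xs \<le> length E"
    using that by simp
  ultimately show ?thesis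
    unfolding segment_def by (auto simp: append_eq_append_conv)
qed

lemma segment_self: "segment E 0 E"
  by (simp add: segment_def)

lemma bits_at_table:
  assumes "segment E B (table m k f)" "j < m"
  shows "bits_at E (B + j * k) k = take_bit k (f j)" and "B + j * k + k \<le> length E"
proof -
  have "j * k + k \<le> m * k"
    using assms(2) by (metis Suc_leI add.commute mult_Suc mult_le_mono1)
  then show len: "B + j * k + k \<le> length E"
    using assms(1) by (simp add: segment_def)
  have "take k (drop (B + j * k) E) = take k (drop (j * k) (take (m * k) (drop B E)))"
    using \<open>j * k + k \<le> m * k\<close> by (simp add: drop_take min_absorb1 min.absorb2 add.commute)
  also have "take (m * k) (drop B E) = table m k f"
    using assms(1) by (simp add: segment_def)
  also have "take k (drop (j * k) (table m k f)) = map (bit (f j)) [0..<k]"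
    using \<open>j * k + k \<le> m * k\<close>
    using assms(2) by (intro nth_equalityI) (simp_all add: table_def add.commute)
  finally show "bits_at E (B + j * k) k = take_bit k (f j)"
    by (simp add: bits_at_def horner_sum_bit_eq_take_bit)
qed

lemma bit_bits_at: "p + k \<le> length E \<Longrightarrow> bit (bits_at E p k) i \<longleftrightarrow> i < k \<and> E ! (p + i)"
  by (auto simp: bits_at_def bit_horner_sum_bit_iff)

text \<open>A frame condition: a routine whose scratch registers are numbered from \<open>K\<close>
  on preserves whatever its caller keeps below \<open>K\<close>.\<close>

definition same :: "nat \<Rightarrow> state \<Rightarrow> state \<Rightarrow> bool" where
  "same K s s' \<longleftrightarrow> (\<forall>r<K. regs s' r = regs s r) \<and> mem s' = mem s \<and> reported s' = reported s"

fun below :: "nat \<Rightarrow> operand \<Rightarrow> bool" where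
  "below K (Reg r) \<longleftrightarrow> r < K"
| "below K (Const k) \<longleftrightarrow> True"

lemma set_reg_simps [simp]:
  "regs (set_reg x v s) = (regs s)(x := v)"
  "mem (set_reg x v s) = mem s"
  "reported (set_reg x v s) = reported s"
  by (simp_all add: set_reg_def)

lemma same_refl [simp]: "same K s s" by (simp add: same_def)

lemma same_set_reg [simp]: "K \<le> x \<Longrightarrow> same K s (set_reg x v s') \<longleftrightarrow> same K s s'"
  by (auto simp: same_def)

lemma same_set_reg' [simp]: "K \<le> x \<Longrightarrow> same K (set_reg x v s) s' \<longleftrightarrow> same K s s'"
  by (auto simp: same_def)

lemma same_trans: "same K s s' \<Longrightarrow> same L s' s'' \<Longrightarrow> K \<le> L \<Longrightarrow> same K s s''"
  by (auto simp: same_def)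

lemma same_operand: "same K s s' \<Longrightarrow> below K a \<Longrightarrow> operand_val w s' a = operand_val w s a"
  by (cases a) (auto simp: same_def)

lemma below_mono: "below K a \<Longrightarrow> K \<le> L \<Longrightarrow> below L a"
  by (cases a) auto

lemma operand_set_reg: "below K a \<Longrightarrow> K \<le> x \<Longrightarrow> operand_val w (set_reg x v s) a = operand_val w s a"
  by (cases a) auto

text \<open>The field starts at bit \<open>p\<close> and has \<open>k\<close> bits; it may straddle
  two words, so two words are always loaded and glued. If \<open>p\<close> is aligned, the second
  word is shifted by the full word length and vanishes; otherwise the mask cuts off what lies beyond
  the field.\<close>

definition read :: "operand \<Rightarrow> operand \<Rightarrow> com" where
  "read p k = block [
     Op Div 100 p (Reg 1),
     Op Mod 101 p (Reg 1),
     Load 102 (Reg 100),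
     Op Shr 102 (Reg 102) (Reg 101),
     Op Add 100 (Reg 100) (Const 1),
     Load 103 (Reg 100),
     Op Sub 104 (Reg 1) (Reg 101),
     Op Shl 103 (Reg 103) (Reg 104),
     Op Or 102 (Reg 102) (Reg 103),
     Op Shl 104 (Const 1) k,
     Op Sub 104 (Reg 104) (Const 1),
     Op And 100 (Reg 102) (Reg 104)]"

text \<open>\<open>X\<close> exceeds the length of \<open>E\<close> and every packed pair
  \<open>x * (n + 1) + y\<close> with \<open>x\<close> and \<open>y\<close> at most
  \<open>n\<close>. It is also the first address of the working space, so small multiples of
  \<open>X\<close> have to be valid words.\<close>

locale ram =
  fixes w :: nat and A :: "'a csa" and c :: "bool list" and n :: nat and P :: "'a list"
    and X :: nat and E :: "bool list"
  assumes E: "length E < X" and X_def: "X = 64 * (n + 1) * (n + 1)"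
    and w20: "w \<ge> 20" and Xw: "1000 * X \<le> 2 ^ w" and ww: "1000 * w \<le> 2 ^ w"
begin

text \<open>A weakest precondition for total correctness whose postcondition also sees the running
  time.\<close>

definition W :: "com \<Rightarrow> (nat \<Rightarrow> state \<Rightarrow> bool) \<Rightarrow> state \<Rightarrow> bool" where
  "W q Q s \<longleftrightarrow> (\<exists>t s'. exec w A c n P q s t s' \<and> Q t s')"

lemma W_mono: "W q Q s \<Longrightarrow> (\<And>t s'. Q t s' \<Longrightarrow> Q' t s') \<Longrightarrow> W q Q' s"
  by (auto simp: W_def)

lemma W_atoms [simp]:
  "W Skip Q s \<longleftrightarrow> Q 1 s"
  "W (Op f x a b) Q s \<longleftrightarrow>
     Q 1 (set_reg x (binop_val w f (operand_val w s a) (operand_val w s b)) s)"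
  "W (Load x a) Q s \<longleftrightarrow> Q 1 (set_reg x (mem s (operand_val w s a)) s)"
  "W (Store a b) Q s \<longleftrightarrow>
     Q 1 (s\<lparr>mem := (mem s)(operand_val w s a := operand_val w s b)\<rparr>)"
  "W (Report a) Q s \<longleftrightarrow> Q 1 (s\<lparr>reported := reported s @ [operand_val w s a]\<rparr>)"
  "W (Lookup x a) Q s \<longleftrightarrow>
     Q (lookup_time A n) (set_reg x (take_bit w (lookup A c (operand_val w s a))) s)"
  unfolding W_def by (auto elim!: exec_atomEs intro: exec.intros[unfolded One_nat_def])

lemma W_Search [simp]:
  "W (Search x y) Q s \<longleftrightarrow> Q (search_time A (length P))
     (set_reg y (take_bit w (snd (search A c P))) (set_reg x (take_bit w (fst (search A c P))) s))"
  unfolding W_def by (cases "search A c P") (auto elim!: exec_atomEs intro!: exI exec.Search)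

lemma W_Seq [simp]: "W (Seq q\<^sub>1 q\<^sub>2) Q s \<longleftrightarrow> W q\<^sub>1 (\<lambda>t. W q\<^sub>2 (\<lambda>u. Q (t + u))) s"
  unfolding W_def by (blast elim: exec_SeqE intro: exec.Seq)

lemma W_Cond [simp]:
  "W (Cond b q\<^sub>1 q\<^sub>2) Q s \<longleftrightarrow>
     (if test_val w s b then W q\<^sub>1 (\<lambda>t. Q (Suc t)) s else W q\<^sub>2 (\<lambda>t. Q (Suc t)) s)"
  unfolding W_def
  by (cases "test_val w s b") (auto elim!: exec_CondE intro!: exec.CondTrue exec.CondFalse; blast intro: exec.CondTrue exec.CondFalse)+

text \<open>\<open>\<phi>\<close> bounds the time still to be spent: each round, including its test,
  is paid by a drop of \<open>\<phi>\<close>, so the same number is a termination measure and a time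
  bound. The extra 1 is the final failing test.\<close>

lemma W_While:
  assumes "I \<phi> s"
    and step: "\<And>\<phi> s. I \<phi> s \<Longrightarrow> test_val w s b \<Longrightarrow> W q (\<lambda>t s'. \<exists>\<phi>'. Suc t + \<phi>' \<le> \<phi> \<and> I \<phi>' s') s"
  shows "W (While b q) (\<lambda>t s'. \<exists>\<phi>'. t + \<phi>' \<le> \<phi> + 1 \<and> I \<phi>' s' \<and> \<not> test_val w s' b) s"
  using assms(1)
proof (induction \<phi> arbitrary: s rule: less_induct)
  case (less \<phi>)
  show ?case
  proof (cases "test_val w s b")
    case False
    then have "exec w A c n P (While b q) s 1 s" by (rule exec.WhileFalse)
    then show ?thesis using less.prems False unfolding W_def by (metis add.commute order.refl)
  next
    case True
    then obtain t s' \<phi>' where t: "exec w A c n P q s t s'" "Suc t + \<phi>' \<le> \<phi>" "I \<phi>' s'"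
      using step[OF less.prems] by (auto simp: W_def)
    then have "W (While b q) (\<lambda>t s'. \<exists>\<psi>. t + \<psi> \<le> \<phi>' + 1 \<and> I \<psi> s' \<and> \<not> test_val w s' b) s'"
      using less.IH[of \<phi>' s'] by simp
    then obtain u s'' \<psi> where u: "exec w A c n P (While b q) s' u s''" "u + \<psi> \<le> \<phi>' + 1" "I \<psi> s''"
        "\<not> test_val w s'' b"
      by (auto simp: W_def)
    have "exec w A c n P (While b q) s (Suc (t + u)) s''"
      using True t(1) u(1) by (rule exec.WhileTrue)
    moreover have "Suc (t + u) + \<psi> \<le> \<phi> + 1" using t u by simp
    ultimately show ?thesis using u unfolding W_def by blast
  qed
qed

lemma X_pos: "X \<ge> 64 * (n + 1)" "X \<ge> 64" "X > n"
  unfolding X_def by auto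

lemma pow_ge: "2 ^ w \<ge> (20000::nat)" "w < 2 ^ w" "X < 2 ^ w" "n < 2 ^ w"
  using w20 ww Xw X_pos by linarith+

declare One_nat_def [simp del]

declare binop_val.simps(1,2,3,9) [simp del] operand_val.simps(2) [simp del]

lemma Const_simp [simp]: "k < 2 ^ w \<Longrightarrow> operand_val w s (Const k) = k"
  by (simp add: operand_val.simps take_bit_nat_eq_self)

lemma small_numeral [simp]: "numeral k \<le> (1000::nat) \<Longrightarrow> numeral k < (2::nat) ^ w" "0 < (2::nat) ^ w" "1 < (2::nat) ^ w"
  using pow_ge w20 by (auto intro: le_less_trans[of _ 1000])

lemma Add_simp [simp]: "x + y < 2 ^ w \<Longrightarrow> binop_val w Add x y = x + y"
  by (simp add: binop_val.simps take_bit_nat_eq_self)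

lemma Mul_simp [simp]: "x * y < 2 ^ w \<Longrightarrow> binop_val w Mul x y = x * y"
  by (simp add: binop_val.simps take_bit_nat_eq_self)

lemma Sub_simp [simp]: "y \<le> x \<Longrightarrow> x < 2 ^ w \<Longrightarrow> binop_val w Sub x y = x - y"
proof -
  assume "y \<le> x" "x < 2 ^ w"
  then have "x + 2 ^ w - y = (x - y) + 2 ^ w" by simp
  then have "take_bit w (x + 2 ^ w - y) = take_bit w (x - y)"
    by (simp only: take_bit_eq_mod mod_add_self2)
  then show ?thesis using \<open>x < 2 ^ w\<close> by (simp add: binop_val.simps take_bit_nat_eq_self)
qed

lemma Shl_simp [simp]: "x * 2 ^ y < 2 ^ w \<Longrightarrow> binop_val w Shl x y = x * 2 ^ y"
  by (simp add: binop_val.simps take_bit_nat_eq_self push_bit_eq_mult)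

text \<open>For \<open>k = w\<close> the shift overflows to 0 and the subtraction wraps around to
  the full mask, so no case distinction is needed in the program.\<close>

lemma Sub_wrap: "k \<le> w \<Longrightarrow> binop_val w Sub (binop_val w Shl 1 k) 1 = mask k"
proof (cases "k = w")
  case True
  have "take_bit w (2 ^ w) = (0::nat)" by (simp add: take_bit_eq_mod)
  then show ?thesis using True
    by (simp add: binop_val.simps push_bit_eq_mult take_bit_nat_eq_self mask_eq_exp_minus_1)
next
  case False
  assume "k \<le> w"
  with False have "(2::nat) ^ k < 2 ^ w" by simp
  then show ?thesis by (simp add: mask_eq_exp_minus_1)
qed

lemma W_read:
  assumes hold: "holds_bits w (mem s) E" and r1: "regs s 1 = w"
    and pk: "below 100 p" "below 100 k" "operand_val w s k \<le> w"
    and len: "operand_val w s p + operand_val w s k \<le> length E"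
  shows "W (read p k) (\<lambda>t s'. t = 12 \<and> same 100 s s' \<and>
    regs s' 100 = bits_at E (operand_val w s p) (operand_val w s k)) s"
proof -
  let ?p = "operand_val w s p" and ?k = "operand_val w s k"
  let ?M = "mem s"
  have pw: "?p div w + 1 < 2 ^ w"
    using len E pow_ge(3) div_le_dividend[of ?p w] Xw X_pos by linarith
  have o: "?p mod w \<le> w" using w20 by (simp add: less_imp_le)
  have ops: "operand_val w (set_reg x v s') p = operand_val w s' p"
    "operand_val w (set_reg x v s') k = operand_val w s' k" if "x \<ge> 100" for x v s'
    using pk that by (auto intro: operand_set_reg)
  have dm: "(a * w + b) div w = a" "(a * w + b) mod w = b" if "b < w" for a b :: nat
    using that by simp_all
  let ?v = "and (or (drop_bit (?p mod w) (?M (?p div w)))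
     (binop_val w Shl (?M (?p div w + 1)) (w - ?p mod w))) (mask ?k)"
  have v: "?v = bits_at E ?p ?k"
  proof (rule bit_eqI)
    fix i
    have Mlt: "?M a < 2 ^ w" for a using hold by (simp add: holds_bits_def)
    have bM: "\<not> bit (?M a) j" if "j \<ge> w" for a j
      using Mlt[of a] that by (metis bit_take_bit_iff not_le take_bit_nat_eq_self)
    have "bit (or (drop_bit (?p mod w) (?M (?p div w)))
     (binop_val w Shl (?M (?p div w + 1)) (w - ?p mod w))) i \<longleftrightarrow> E ! (?p + i)" if i: "i < ?k"
    proof -
      have h: "bit (?M ((?p + i) div w)) ((?p + i) mod w) = E ! (?p + i)"
        using hold i len by (simp add: holds_bits_def)
      have pd: "?p = (?p div w) * w + ?p mod w" by simp
      show ?thesis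
      \<comment> \<open>Bit \<open>i\<close> of the field lies in the first word or has run over
        into the second.\<close>
      proof (cases "?p mod w + i < w")
        case True
        have e: "?p + i = (?p div w) * w + (?p mod w + i)"
          using pd by simp
        have "(?p + i) div w = ?p div w" "(?p + i) mod w = ?p mod w + i"
          unfolding e using True by (simp_all only: dm)
        then show ?thesis using h True i
          by (auto simp: bit_or_iff bit_drop_bit_eq binop_val.simps bit_take_bit_iff bit_push_bit_iff)
      next
        case False
        let ?j = "?p mod w + i - w"
        have jw: "?j < w" using i pk(3) w20 mod_less_divisor[of w ?p] by linarith
        have e: "?p + i = (?p div w + 1) * w + ?j"
          unfolding add_mult_distrib mult_1 using False by (subst pd) linarith
        have "(?p + i) div w = ?p div w + 1" "(?p + i) mod w = ?j"
          unfolding e using jw by (simp_all only: dm)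
        moreover have "i \<ge> w - ?p mod w" "i - (w - ?p mod w) = ?j"
          using False o by auto
        moreover have "i < w" using i pk(3) by simp
        ultimately show ?thesis using h False bM[of "?p mod w + i" "?p div w"]
          by (auto simp: bit_or_iff bit_drop_bit_eq binop_val.simps bit_take_bit_iff bit_push_bit_iff)
      qed
    qed
    then show "bit ?v i \<longleftrightarrow> bit (bits_at E ?p ?k) i"
      using bit_bits_at[OF len, of i] by (auto simp: bit_and_iff bit_mask_iff)
  qed
  show ?thesis
    unfolding read_def using pk(3) o pw pow_ge(2)
    by (simp add: r1 ops Sub_wrap v)
qed

end

section \<open>Elias--Fano sequences\<close>

text \<open>Upper parts in unary: this is the position of the one that stands for entry
  \<open>i\<close>, preceded by \<open>i\<close> earlier ones and \<open>a i div 2 ^ l\<close>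
  zeros.\<close>

definition ef_high :: "nat \<Rightarrow> (nat \<Rightarrow> nat) \<Rightarrow> nat \<Rightarrow> nat" where
  "ef_high l a i = i + a i div 2 ^ l"

definition ef_rank :: "nat \<Rightarrow> nat \<Rightarrow> (nat \<Rightarrow> nat) \<Rightarrow> nat \<Rightarrow> nat" where
  "ef_rank l N a p = card {i. i < N \<and> ef_high l a i < p}"

text \<open>The default \<open>n\<close> exceeds every entry and every query by value, so a boundary
  behind the last entry is never accepted.\<close>

definition ef_next :: "nat \<Rightarrow> nat \<Rightarrow> (nat \<Rightarrow> nat) \<Rightarrow> nat \<Rightarrow> nat" where
  "ef_next n N a r = (if r < N then a r else n)"

text \<open>Lower parts, unary upper parts, and a directory with one word per full block of
  \<open>w\<close> upper bits, hence of at most \<open>3 * N\<close> bits. A directory word packs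
  the rank at the end of its block with the next entry, so that a single read serves searches by
  index and by value; boundary 0 is implicit.\<close>

definition ef_bits :: "nat \<Rightarrow> nat \<Rightarrow> nat \<Rightarrow> (nat \<Rightarrow> nat) \<Rightarrow> bool list" where
  "ef_bits w n N a = (let l = floor_log (n div N) in
     table N l a @
     table (3 * N) 1 (\<lambda>p. of_bool (\<exists>i<N. ef_high l a i = p)) @
     table (3 * N div w) w (\<lambda>b. let r = ef_rank l N a ((b + 1) * w) in r * (n + 1) + ef_next n N a r))"

declare floor_log.simps [simp del]

lemma length_ef_bits:
  "length (ef_bits w n N a) = N * floor_log (n div N) + 3 * N + 3 * N div w * w"
  by (simp add: ef_bits_def Let_def)

lemma downward_closed_eq_lessThan:
  fixes S :: "nat set"
  assumes "finite S" "\<And>i j. j \<in> S \<Longrightarrow> i < j \<Longrightarrow> i \<in> S"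
  shows "S = {..<card S}"
proof -
  define m where "m = (LEAST m. m \<notin> S)"
  have "\<exists>m. m \<notin> S" using ex_new_if_finite[OF infinite_UNIV_nat assms(1)] .
  then have m: "m \<notin> S" unfolding m_def by (rule LeastI_ex)
  have "i \<in> S" if "i < m" for i using not_less_Least[OF that[unfolded m_def]] by blast
  moreover have "i < m" if "i \<in> S" for i
    using that m assms(2)[OF that, of m] by (metis linorder_neqE_nat)
  ultimately have "S = {..<m}" by auto
  then show ?thesis by simp
qed

locale ef_seq =
  fixes n N :: nat and a :: "nat \<Rightarrow> nat"
  assumes N: "N > 0" and mono: "\<And>i j. i < j \<Longrightarrow> j < N \<Longrightarrow> a i < a j"
    and a0: "a 0 = 0" and an: "\<And>i. i < N \<Longrightarrow> a i < n"
begin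

abbreviation "l \<equiv> floor_log (n div N)"
abbreviation "high \<equiv> ef_high l a"
abbreviation "rank \<equiv> ef_rank l N a"
abbreviation "next_val \<equiv> ef_next n N a"

text \<open>One search serves two purposes: by index it selects an entry, by value it finds a
  predecessor.\<close>

definition key :: "bool \<Rightarrow> nat \<Rightarrow> nat" where
  "key m i = (if m then i else a i)"

definition next_key :: "bool \<Rightarrow> nat \<Rightarrow> nat" where
  "next_key m r = (if m then r else next_val r)"

lemma mono_le: "i \<le> j \<Longrightarrow> j < N \<Longrightarrow> a i \<le> a j"
  using mono[of i j] by (cases "i = j") auto

lemma ge_index: "i < N \<Longrightarrow> i \<le> a i"
proof (induction i)
  case (Suc i)
  then show ?case using mono[of i "Suc i"] by simp
qed simp

lemma N_le: "N \<le> n"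
  using ge_index[of "N - 1"] an[of "N - 1"] N by simp

lemma two_l: "2 ^ l \<le> n div N" "n < N * (2 * 2 ^ l)"
proof -
  have "0 < n div N" using N N_le by (simp add: div_greater_zero_iff)
  then show "2 ^ l \<le> n div N" by (rule floor_log_exp2_le)
  have "n div N < 2 * 2 ^ l" by (rule floor_log_exp2_gt)
  then show "n < N * (2 * 2 ^ l)" using N by (simp add: div_less_iff_less_mult mult.commute)
qed

lemma high_mono: "i < j \<Longrightarrow> j < N \<Longrightarrow> high i < high j"
  unfolding ef_high_def using mono_le[of i j] by (simp add: add_less_le_mono div_le_mono)

text \<open>By the choice of \<open>l\<close> the upper parts stay below \<open>2 * N\<close>, and
  the index adds less than \<open>N\<close>.\<close>

lemma high_less: "i < N \<Longrightarrow> high i < 3 * N"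
proof -
  assume i: "i < N"
  have "a i < (2 * N) * 2 ^ l" using an[OF i] two_l(2) by (simp add: mult_ac)
  then have "a i div 2 ^ l < 2 * N" by (simp add: div_less_iff_less_mult)
  then show ?thesis using i by (simp add: ef_high_def)
qed

lemma less_rank_iff: "i < rank p \<longleftrightarrow> i < N \<and> high i < p"
proof -
  have "{i. i < N \<and> high i < p} = {..<rank p}"
    unfolding ef_rank_def
    by (rule downward_closed_eq_lessThan) (use high_mono in \<open>auto intro: less_trans\<close>)
  then show ?thesis by blast
qed

lemma rank_le: "rank p \<le> N"
  using less_rank_iff[of N p] by simp

lemma rank_mono: "p \<le> q \<Longrightarrow> rank p \<le> rank q"
  unfolding ef_rank_def by (intro card_mono) auto

lemma rank_0: "rank 0 = 0"
  using less_rank_iff[of 0 0] by simp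

lemma rank_full: "3 * N \<le> p \<Longrightarrow> rank p = N"
proof -
  assume "3 * N \<le> p"
  then have "N - 1 < rank p" using less_rank_iff[of "N - 1" p] high_less[of "N - 1"] N by simp
  then show ?thesis using rank_le[of p] by simp
qed

lemma rank_high: assumes "i < N" shows "rank (high i) = i" "rank (Suc (high i)) = Suc i"
proof -
  have *: "high j < high i \<longleftrightarrow> j < i" "high j < Suc (high i) \<longleftrightarrow> j < Suc i" if "j < N" for j
    using high_mono[of i j] high_mono[of j i] assms that by (metis less_Suc_eq linorder_neqE_nat not_less_iff_gr_or_eq)+
  have "{j. j < N \<and> high j < high i} = {..<i}" "{j. j < N \<and> high j < Suc (high i)} = {..<Suc i}"
    using * assms by auto
  then show "rank (high i) = i" "rank (Suc (high i)) = Suc i"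
    by (simp_all add: ef_rank_def)
qed

lemma rank_Suc_no: assumes "\<not> (\<exists>i<N. high i = p)" shows "rank (Suc p) = rank p"
proof -
  have "{i. i < N \<and> high i < Suc p} = {i. i < N \<and> high i < p}"
    using assms by (auto simp: less_Suc_eq)
  then show ?thesis by (simp add: ef_rank_def)
qed

lemma high_split: "i < N \<Longrightarrow> (high i - i) * 2 ^ l + a i mod 2 ^ l = a i"
  by (simp only: ef_high_def add_diff_cancel_left' div_mult_mod_eq)

lemma key_mono: "i \<le> j \<Longrightarrow> j < N \<Longrightarrow> key m i \<le> key m j"
  by (simp add: key_def mono_le)

lemma next_key_mono: "r \<le> r' \<Longrightarrow> r' \<le> N \<Longrightarrow> next_key m r \<le> next_key m r'"
  using mono_le[of r r'] an[of r] by (auto simp: next_key_def ef_next_def)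

lemma next_key_eq: "r < N \<Longrightarrow> next_key m r = key m r"
  by (simp add: next_key_def ef_next_def key_def)

lemma next_key_N: "next_key m N = (if m then N else n)"
  by (simp add: next_key_def ef_next_def)

text \<open>Once the block of \<open>w\<close> high bits is found, the predecessor has its high bit in that block.\<close>

lemma pred_in_block:
  assumes t: "t < (if m then N else n)"
    and lo: "lo = 0 \<or> next_key m (rank (lo * w)) \<le> t"
    and hi: "\<And>b. lo < b \<Longrightarrow> b \<le> 3 * N div w \<Longrightarrow> t < next_key m (rank (b * w))"
    and p: "p = min (lo * w + w) (3 * N)" and w: "w > 0"
    and i: "\<And>j. rank (lo * w) \<le> j \<Longrightarrow> j < rank p \<Longrightarrow> key m j \<le> t \<Longrightarrow> j \<le> i"
    and j: "j < N" "key m j \<le> t"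
  shows "j \<le> i"
proof -
  \<comment> \<open>The next boundary is already beyond \<open>t\<close>, or there is none and the
    block extends to the end of the bit vector.\<close>
  have less: "j < rank p" if "j < N" "key m j \<le> t" for j
  proof (cases "lo + 1 \<le> 3 * N div w")
    case True
    then have "(lo + 1) * w \<le> 3 * N" using w by (simp add: less_eq_div_iff_mult_less_eq)
    then have "p = (lo + 1) * w" using p by simp
    then have "t < next_key m (rank p)" using hi[of "lo + 1"] True by simp
    moreover have "next_key m (rank p) \<le> key m j" if "rank p \<le> j"
      using next_key_eq[of "rank p" m] key_mono[OF that \<open>j < N\<close>, of m] that \<open>j < N\<close> by simp
    ultimately show ?thesis using that(2) by (metis le_trans not_less)
  next
    case False
    then have "3 * N < (lo + 1) * w" using w by (simp add: div_less_iff_less_mult not_le)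
    then have "p = 3 * N" using p by simp
    then show ?thesis using rank_full that by simp
  qed
  let ?r = "rank (lo * w)"
  \<comment> \<open>The first entry after the accepted boundary is admissible; for boundary 0 this
    is entry 0, whose key is 0.\<close>
  have r: "?r < N" "key m ?r \<le> t"
  proof -
    show "?r < N"
    proof (rule ccontr)
      assume "\<not> ?r < N"
      then have "?r = N" using rank_le[of "lo * w"] by simp
      then show False using lo t next_key_N[of m] rank_0 N by (auto split: if_splits)
    qed
    then show "key m ?r \<le> t"
      using lo next_key_eq[of ?r m] rank_0 a0 by (auto simp: key_def)
  qed
  show ?thesis
  proof (cases "?r \<le> j")
    case True then show ?thesis using i less j by blast
  next
    case False
    moreover have "?r \<le> i" using i[of ?r] less r by blast
    ultimately show ?thesis by simp
  qed
qed

end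

text \<open>Registers from 100 on are scratch space of \<open>read\<close>, those from 50 on of the queries.\<close>

definition key_op :: "bool \<Rightarrow> binop" where
  "key_op m = (if m then Div else Mod)"

text \<open>Binary search over the block boundaries with steps halved from
  \<open>2 ^ (w - 1)\<close> down to 1, in register 51. Register 50 holds the last accepted
  boundary, register 61 its rank.\<close>

definition dir_loop :: "bool \<Rightarrow> operand \<Rightarrow> com" where
  "dir_loop m T = While (Less (Const 0) (Reg 51)) (block [
     Op Add 55 (Reg 50) (Reg 51),
     Cond (Less (Reg 52) (Reg 55)) Skip (block [
       Op Sub 56 (Reg 55) (Const 1),
       Op Mul 56 (Reg 56) (Reg 1),
       Op Add 56 (Reg 56) (Reg 53),
       read (Reg 56) (Reg 1),
       Op (key_op m) 58 (Reg 100) (Reg 57),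
       Cond (Less T (Reg 58)) Skip (block [
         Op Add 50 (Reg 55) (Const 0),
         Op Div 61 (Reg 100) (Reg 57)])]),
     Op Shr 51 (Reg 51) (Const 1)])"

definition key_reg :: "bool \<Rightarrow> operand" where
  "key_reg m = (if m then Reg 61 else Reg 58)"

definition scan_loop :: "bool \<Rightarrow> operand \<Rightarrow> operand \<Rightarrow> operand \<Rightarrow> com" where
  "scan_loop m B L T = While (Less (Reg 60) (Reg 62)) (block [
     Op Add 56 (Reg 54) (Reg 60),
     read (Reg 56) (Const 1),
     Cond (Eq (Reg 100) (Const 1)) (block [
       Op Mul 56 (Reg 61) L,
       Op Add 56 (Reg 56) B,
       read (Reg 56) L,
       Op Sub 58 (Reg 60) (Reg 61),
       Op Shl 58 (Reg 58) L,
       Op Add 58 (Reg 58) (Reg 100),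
       Cond (Less T (key_reg m)) Skip (block [
         Op Add 63 (Reg 61) (Const 0),
         Op Add 64 (Reg 58) (Const 0)]),
       Op Add 61 (Reg 61) (Const 1)]) Skip,
     Op Add 60 (Reg 60) (Const 1)])"

text \<open>The index found is left in register 63, its value in register 64.\<close>

definition pred :: "bool \<Rightarrow> operand \<Rightarrow> operand \<Rightarrow> operand \<Rightarrow> operand \<Rightarrow> com" where
  "pred m B N L T = block [
     Op Mul 54 N L,
     Op Add 54 (Reg 54) B,
     Op Mul 59 (Const 3) N,
     Op Add 53 (Reg 54) (Reg 59),
     Op Div 52 (Reg 59) (Reg 1),
     Op Add 57 (Reg 0) (Const 1),
     Op Sub 51 (Reg 1) (Const 1),
     Op Shl 51 (Const 1) (Reg 51),
     Op Add 50 (Const 0) (Const 0),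
     Op Add 61 (Const 0) (Const 0),
     dir_loop m T,
     Op Mul 60 (Reg 50) (Reg 1),
     Op Add 62 (Reg 60) (Reg 1),
     Cond (Less (Reg 59) (Reg 62)) (Op Add 62 (Reg 59) (Const 0)) Skip,
     Op Add 63 (Const 0) (Const 0),
     Op Add 64 (Const 0) (Const 0),
     scan_loop m B L T]"

section \<open>Correctness and running time of predecessor queries\<close>

context ram
begin

lemma same_operand': "same K s s' \<Longrightarrow> below L a \<Longrightarrow> L \<le> K \<Longrightarrow> operand_val w s' a = operand_val w s a"
  by (cases a) (auto simp: same_def operand_val.simps)

lemma X_n: "64 * n + 64 \<le> X" "64 * ((n + 1) * (n + 1)) = X"
  unfolding X_def by (simp_all add: algebra_simps)

definition ready :: "state \<Rightarrow> bool" where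
  "ready s \<longleftrightarrow> holds_bits w (mem s) E \<and> regs s 0 = n \<and> regs s 1 = w"

lemma same_reg: "same K s s' \<Longrightarrow> r < K \<Longrightarrow> regs s' r = regs s r"
  by (simp add: same_def)

lemma same_mem: "same K s s' \<Longrightarrow> mem s' = mem s"
  by (simp add: same_def)

end

locale ram_ef = ram + ef_seq +
  fixes B :: nat
  assumes seg: "segment E B (ef_bits w n N a)"
begin

abbreviation "Hbase \<equiv> B + N * l"
abbreviation "M \<equiv> 3 * N div w"
abbreviation "Dbase \<equiv> Hbase + 3 * N"

lemma wpos: "w > 0" using w20 by simp

lemma len: "Dbase + M * w \<le> length E"
  using seg by (simp add: segment_def length_ef_bits)

lemma low_bits:
  assumes "i < N"
  shows "bits_at E (B + i * l) l = a i mod 2 ^ l" "B + i * l + l \<le> length E"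
  using bits_at_table[of E B N l a i] seg assms
  by (simp_all add: ef_bits_def Let_def segment_append take_bit_eq_mod)

lemma high_bits:
  assumes "p < 3 * N"
  shows "bits_at E (Hbase + p) 1 = of_bool (\<exists>i<N. high i = p)" "Hbase + p + 1 \<le> length E"
  using bits_at_table[of E Hbase "3 * N" 1 "\<lambda>p. of_bool (\<exists>i<N. high i = p)" p] seg assms
  by (simp_all add: ef_bits_def Let_def segment_append take_bit_eq_mod)

lemma entry_less: "r \<le> N \<Longrightarrow> r * (n + 1) + next_val r < 2 ^ w"
proof -
  assume r: "r \<le> N"
  have "next_val r \<le> n" using an[of r] by (auto simp: ef_next_def)
  moreover have "r * (n + 1) \<le> (n + 1) * (n + 1)" using r N_le by (intro mult_le_mono1) simp
  ultimately have "r * (n + 1) + next_val r < X" using X_n by linarith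
  then show ?thesis using pow_ge by simp
qed

lemma dir_bits:
  assumes "1 \<le> b" "b \<le> M"
  shows "bits_at E (Dbase + (b - 1) * w) w =
      rank (b * w) * (n + 1) + next_val (rank (b * w))"
    "Dbase + (b - 1) * w + w \<le> length E"
proof -
  let ?f = "\<lambda>b. let r = rank ((b + 1) * w) in r * (n + 1) + next_val r"
  have s: "segment E Dbase (table M w ?f)"
    using seg by (simp add: ef_bits_def Let_def segment_append add.assoc)
  have "b - 1 < M" "b - 1 + 1 = b" using assms by auto
  then show "bits_at E (Dbase + (b - 1) * w) w =
      rank (b * w) * (n + 1) + next_val (rank (b * w))"
    using bits_at_table(1)[OF s, of "b - 1"] entry_less[OF rank_le]
    by (simp add: Let_def take_bit_nat_eq_self)
  show "Dbase + (b - 1) * w + w \<le> length E"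
    using bits_at_table(2)[OF s \<open>b - 1 < M\<close>] .
qed

lemma entry_div: "r \<le> N \<Longrightarrow> (r * (n + 1) + next_val r) div (n + 1) = r"
  and entry_mod: "r \<le> N \<Longrightarrow> (r * (n + 1) + next_val r) mod (n + 1) = next_val r"
proof -
  have "next_val r < n + 1" using an[of r] by (auto simp: ef_next_def)
  then show "(r * (n + 1) + next_val r) div (n + 1) = r"
    "(r * (n + 1) + next_val r) mod (n + 1) = next_val r"
    by simp_all
qed

text \<open>\<open>j\<close> counts the remaining rounds. Boundaries at distance
  \<open>2 ^ j\<close> or more from the accepted one are known to be beyond \<open>t\<close>;
  boundary 0 counts as accepted without a test.\<close>

definition dir_inv :: "state \<Rightarrow> bool \<Rightarrow> nat \<Rightarrow> nat \<Rightarrow> state \<Rightarrow> bool" where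
  "dir_inv s0 m t j s \<longleftrightarrow> same 50 s0 s \<and> regs s 51 = (if j = 0 then 0 else 2 ^ (j - 1)) \<and> j \<le> w \<and>
     regs s 52 = M \<and> regs s 53 = Dbase \<and> regs s 54 = Hbase \<and> regs s 57 = n + 1 \<and> regs s 59 = 3 * N \<and>
     regs s 50 \<le> M \<and> regs s 61 = rank (regs s 50 * w) \<and>
     (regs s 50 = 0 \<or> next_key m (rank (regs s 50 * w)) \<le> t) \<and>
     (\<forall>b. regs s 50 + 2 ^ j \<le> b \<and> b \<le> M \<longrightarrow> t < next_key m (rank (b * w)))"

lemma M_less: "M < X" "M * w < X" "Dbase < X" "3 * N < X"
proof -
  have "M \<le> 3 * N" by (rule div_le_dividend)
  moreover have "3 * N < X" using N_le X_n by linarith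
  moreover have "M * w \<le> 3 * N" by simp
  ultimately show "M < X" "M * w < X" "3 * N < X" by linarith+
  show "Dbase < X" using len E by linarith
qed

lemma dir_step:
  assumes I: "dir_inv s0 m t j s" and s0: "ready s0" and T: "below 50 T" "operand_val w s0 T = t"
    and test: "test_val w s (Less (Const 0) (Reg 51))"
  shows "W (block [
     Op Add 55 (Reg 50) (Reg 51),
     Cond (Less (Reg 52) (Reg 55)) Skip (block [
       Op Sub 56 (Reg 55) (Const 1),
       Op Mul 56 (Reg 56) (Reg 1),
       Op Add 56 (Reg 56) (Reg 53),
       read (Reg 56) (Reg 1),
       Op (key_op m) 58 (Reg 100) (Reg 57),
       Cond (Less T (Reg 58)) Skip (block [
         Op Add 50 (Reg 55) (Const 0),
         Op Div 61 (Reg 100) (Reg 57)])]),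
     Op Shr 51 (Reg 51) (Const 1)]) (\<lambda>u s'. u \<le> 30 \<and> dir_inv s0 m t (j - 1) s' \<and> j > 0) s"
proof -
  obtain lo where lo: "regs s 50 = lo" by simp
  have j: "j > 0" using I test by (auto simp: dir_inv_def split: if_splits)
  define st where "st = (2::nat) ^ (j - 1)"
  have pj: "2 ^ j = st + st" using j unfolding st_def by (cases j) auto
  have r51: "regs s 51 = st" using I j by (simp add: dir_inv_def st_def)
  have same: "same 50 s0 s" and r: "regs s 52 = M" "regs s 53 = Dbase" "regs s 54 = Hbase" "regs s 57 = n + 1"
    "regs s 59 = 3 * N" "lo \<le> M" "regs s 61 = rank (lo * w)" "j \<le> w"
    and lokey: "lo = 0 \<or> next_key m (rank (lo * w)) \<le> t"
    and hikey: "\<And>b. lo + 2 ^ j \<le> b \<Longrightarrow> b \<le> M \<Longrightarrow> t < next_key m (rank (b * w))"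
    using I lo by (auto simp: dir_inv_def)
  have r01: "regs s 0 = n" "regs s 1 = w" and hold: "holds_bits w (mem s) E"
    using same s0 by (auto simp: ready_def same_def)
  have jw: "j - 1 \<le> w" using r(8) by simp
  have "2 ^ j \<le> (2::nat) ^ w" using r(8) by (intro power_increasing) auto
  then have st2: "st + st \<le> 2 ^ w" using pj by simp
  have lost: "lo + st < 2 ^ w" using r(6) M_less(1) Xw st2 by linarith
  have half: "st div 2 = (if j - 1 = 0 then 0 else 2 ^ (j - 1 - 1))"
    unfolding st_def by (cases "j - 1") auto
  \<comment> \<open>Keys at the boundaries never decrease, so a boundary that fails, or that lies
    behind the last one, excludes all later ones.\<close>
  have hi': "t < next_key m (rank (b * w))" if "lo + st \<le> b" "b \<le> M" "lo + st > M \<or> t < next_key m (rank ((lo + st) * w))" for b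
  proof -
    have "rank ((lo + st) * w) \<le> rank (b * w)" using that by (intro rank_mono mult_le_mono1)
    then have "next_key m (rank ((lo + st) * w)) \<le> next_key m (rank (b * w))"
      by (rule next_key_mono) (rule rank_le)
    then show ?thesis using that by linarith
  qed
  show ?thesis
  proof (cases "M < lo + st")
    case True
    have "\<forall>b. lo + 2 ^ (j - 1) \<le> b \<and> b \<le> M \<longrightarrow> t < next_key m (rank (b * w))"
      using hi' True by (simp add: st_def)
    then show ?thesis
      using True lost j half same lokey r(6) jw by (simp add: r r51 lo dir_inv_def drop_bit_eq_div)
  next
    case False
    let ?b = "lo + st"
    have "1 \<le> st" by (simp add: st_def)
    then have b: "1 \<le> ?b" "?b \<le> M" using False by simp_all
    let ?e = "rank (?b * w) * (n + 1) + next_val (rank (?b * w))"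
    have ent: "bits_at E (Dbase + (?b - 1) * w) w = ?e" "Dbase + (?b - 1) * w + w \<le> length E"
      using dir_bits[OF b] by simp_all
    have lw: "?b * w \<le> M * w" using b by simp
    have m1: "(?b - 1) * w < 2 ^ w" "(?b - 1) * w + Dbase < 2 ^ w" using ent(2) E pow_ge by linarith+
    have m1': "(?b - 1) * w + Dbase + w \<le> length E" using ent(2) by linarith
    have bl: "?b < 2 ^ w" using lost .
    let ?s = "set_reg 56 ((?b - 1) * w + Dbase) (set_reg 56 ((?b - 1) * w)
      (set_reg 56 (?b - 1) (set_reg 55 ?b s)))"
    have rd: "W (read (Reg 56) (Reg 1)) (\<lambda>u s'. u = 12 \<and> same 100 ?s s' \<and> regs s' 100 = ?e) ?s"
      using W_read[of ?s "Reg 56" "Reg 1"] hold r01 m1' ent(1) by (simp add: add.commute)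
    have kk: "(if m then ?e div (n + 1) else ?e mod (n + 1)) = next_key m (rank (?b * w))"
      using entry_div[OF rank_le] entry_mod[OF rank_le] by (simp add: next_key_def)
    have kd: "binop_val w (key_op m) ?e (n + 1) = next_key m (rank (?b * w))"
      using kk by (cases m) (simp_all add: key_op_def)
    have fin: "dir_inv s0 m t (j - 1) (set_reg 51 (st div 2) (set_reg 61 (rank (?b * w)) (set_reg 50 ?b
          (set_reg 58 v s'))))"
      if s': "same 100 ?s s'" and le: "next_key m (rank (?b * w)) \<le> t" for s' v
    proof -
      have "same 50 ?s s'" using s' by (auto simp: same_def)
      then have "same 50 s0 s'" using same same_trans[of 50 s0 s 50 s'] by simp
      then show ?thesis
        using half le b hikey jw same_reg[OF s'] r pj st_def
        by (simp add: dir_inv_def)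
    qed
    have fin': "dir_inv s0 m t (j - 1) (set_reg 51 (st div 2) (set_reg 58 v s'))"
      if s': "same 100 ?s s'" and gt: "t < next_key m (rank (?b * w))" for s' v
    proof -
      have "same 50 ?s s'" using s' by (auto simp: same_def)
      then have "same 50 s0 s'" using same same_trans[of 50 s0 s 50 s'] by simp
      then show ?thesis
        using half gt b hi' jw same_reg[OF s'] r lo lokey st_def
        by (simp add: dir_inv_def)
    qed
    have eval: "W (block [Op (key_op m) 58 (Reg 100) (Reg 57),
       Cond (Less T (Reg 58)) Skip (block [
         Op Add 50 (Reg 55) (Const 0),
         Op Div 61 (Reg 100) (Reg 57)])]) (\<lambda>u s'. u \<le> 5 \<and>
           dir_inv s0 m t (j - 1) (set_reg 51 (st div 2) s') \<and> regs s' 51 = st) s'"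
      if s': "same 100 ?s s'" "regs s' 100 = ?e" for s'
    proof -
      have q: "regs s' 57 = n + 1" "regs s' 55 = ?b" "regs s' 51 = st"
        using same_reg[OF s'(1)] r r51 by simp_all
      have "operand_val w s' T = t"
      proof -
        have "operand_val w s' T = operand_val w ?s T"
          by (rule same_operand'[OF s'(1) T(1)]) simp
        also have "\<dots> = operand_val w s T"
          using T(1) by (cases T) (auto simp: operand_val.simps)
        also have "\<dots> = t" using same_operand[OF same T(1)] T(2) by simp
        finally show ?thesis .
      qed
      then have Tv: "operand_val w (set_reg 58 v s') T = t" for v
        using T(1) by (cases T) (auto simp: operand_val.simps)
      show ?thesis
        using kd entry_div[OF rank_le, of "?b * w"] fin[OF s'(1)] fin'[OF s'(1)] bl
        by (simp add: s'(2) q Tv del: One_nat_def)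
    qed
    show ?thesis
      using False b m1 bl j lost
      apply (simp add: r r51 lo r01)
      apply (rule W_mono[OF rd[simplified]])
      apply (elim conjE)
      apply (rule W_mono)
       apply (rule eval[unfolded block.simps])
        apply (simp_all add: drop_bit_eq_div)
      done
  qed
qed

lemma W_dir_loop:
  assumes I: "dir_inv s0 m t j s" and s0: "ready s0" and T: "below 50 T" "operand_val w s0 T = t"
  shows "W (dir_loop m T) (\<lambda>u s'. u \<le> 31 * j + 1 \<and> dir_inv s0 m t 0 s') s"
  unfolding dir_loop_def
proof (rule W_mono[OF W_While[where I = "\<lambda>\<phi> s. \<exists>j. \<phi> = 31 * j \<and> dir_inv s0 m t j s" and \<phi> = "31 * j"]])
  show "\<exists>j'. 31 * j = 31 * j' \<and> dir_inv s0 m t j' s" using I by blast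
next
  fix \<phi> s assume "\<exists>j. \<phi> = 31 * j \<and> dir_inv s0 m t j s" and test: "test_val w s (Less (Const 0) (Reg 51))"
  then obtain j where j: "\<phi> = 31 * j" "dir_inv s0 m t j s" by blast
  show "W (block [Op Add 55 (Reg 50) (Reg 51),
     Cond (Less (Reg 52) (Reg 55)) Skip (block [
       Op Sub 56 (Reg 55) (Const 1),
       Op Mul 56 (Reg 56) (Reg 1),
       Op Add 56 (Reg 56) (Reg 53),
       read (Reg 56) (Reg 1),
       Op (key_op m) 58 (Reg 100) (Reg 57),
       Cond (Less T (Reg 58)) Skip (block [
         Op Add 50 (Reg 55) (Const 0),
         Op Div 61 (Reg 100) (Reg 57)])]),
     Op Shr 51 (Reg 51) (Const 1)])
     (\<lambda>t' s'. \<exists>\<phi>'. Suc t' + \<phi>' \<le> \<phi> \<and> (\<exists>j. \<phi>' = 31 * j \<and> dir_inv s0 m t j s')) s"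
  proof (rule W_mono[OF dir_step[OF j(2) s0 T test]])
    fix u :: nat and s' assume "u \<le> 30 \<and> dir_inv s0 m t (j - 1) s' \<and> j > 0"
    moreover from this have "Suc u + 31 * (j - 1) \<le> \<phi>" using j(1) by (auto simp: One_nat_def)
    ultimately show "\<exists>\<phi>'. Suc u + \<phi>' \<le> \<phi> \<and> (\<exists>j. \<phi>' = 31 * j \<and> dir_inv s0 m t j s')"
      by blast
  qed
next
  fix u s' assume "\<exists>\<phi>'. u + \<phi>' \<le> 31 * j + 1 \<and> (\<exists>j. \<phi>' = 31 * j \<and> dir_inv s0 m t j s') \<and>
    \<not> test_val w s' (Less (Const 0) (Reg 51))"
  then show "u \<le> 31 * j + 1 \<and> dir_inv s0 m t 0 s'"
    by (auto simp: dir_inv_def split: if_splits)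
qed

definition scan_inv :: "state \<Rightarrow> bool \<Rightarrow> nat \<Rightarrow> nat \<Rightarrow> nat \<Rightarrow> nat \<Rightarrow> state \<Rightarrow> bool" where
  "scan_inv s0 m t lo e p s \<longleftrightarrow> same 50 s0 s \<and> regs s 54 = Hbase \<and> regs s 60 = p \<and> regs s 62 = e \<and>
     p \<le> e \<and> e \<le> 3 * N \<and> regs s 61 = rank p \<and>
     regs s 63 < N \<and> regs s 64 = a (regs s 63) \<and> key m (regs s 63) \<le> t \<and>
     (\<forall>j. rank (lo * w) \<le> j \<and> j < rank p \<and> key m j \<le> t \<longrightarrow> j \<le> regs s 63)"

lemma l_less: "l < w" "2 ^ l \<le> n"
proof -
  show "2 ^ l \<le> n" using two_l(1) div_le_dividend order.trans by blast
  then have "2 ^ l < (2::nat) ^ w" using pow_ge by linarith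
  then show "l < w" by simp
qed

lemma scan_step:
  assumes I: "scan_inv s0 m t lo e p s" and s0: "ready s0"
    and ops: "below 50 T" "operand_val w s0 T = t" "below 50 b" "operand_val w s0 b = B"
      "below 50 L" "operand_val w s0 L = l"
    and test: "p < e"
  shows "W (block [
     Op Add 56 (Reg 54) (Reg 60),
     read (Reg 56) (Const 1),
     Cond (Eq (Reg 100) (Const 1)) (block [
       Op Mul 56 (Reg 61) L,
       Op Add 56 (Reg 56) b,
       read (Reg 56) L,
       Op Sub 58 (Reg 60) (Reg 61),
       Op Shl 58 (Reg 58) L,
       Op Add 58 (Reg 58) (Reg 100),
       Cond (Less T (key_reg m)) Skip (block [
         Op Add 63 (Reg 61) (Const 0),
         Op Add 64 (Reg 58) (Const 0)]),
       Op Add 61 (Reg 61) (Const 1)]) Skip,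
     Op Add 60 (Reg 60) (Const 1)]) (\<lambda>u s'. u \<le> 40 \<and> scan_inv s0 m t lo e (p + 1) s') s"
proof -
  have same: "same 50 s0 s" and r: "regs s 54 = Hbase" "regs s 60 = p" "regs s 62 = e" "e \<le> 3 * N"
      "regs s 61 = rank p"
    and best: "regs s 63 < N" "regs s 64 = a (regs s 63)" "key m (regs s 63) \<le> t"
      "\<And>j. rank (lo * w) \<le> j \<Longrightarrow> j < rank p \<Longrightarrow> key m j \<le> t \<Longrightarrow> j \<le> regs s 63"
    using I by (auto simp: scan_inv_def)
  have r01: "regs s 0 = n" "regs s 1 = w" and hold: "holds_bits w (mem s) E"
    using same s0 by (auto simp: ready_def same_def)
  have p3: "p < 3 * N" using test r by simp
  note hb = high_bits[OF p3]
  have Hp: "Hbase + p < 2 ^ w" using hb(2) E pow_ge by linarith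
  have p1: "p + 1 < 2 ^ w" using hb(2) E pow_ge by linarith
  have opv: "operand_val w s' q = operand_val w s0 q" if "same 50 s0 s'" "below 50 q" for q s'
    using same_operand[OF that] .
  let ?s = "set_reg 56 (Hbase + p) s"
  have rd: "W (read (Reg 56) (Const 1)) (\<lambda>u s'. u = 12 \<and> same 100 ?s s' \<and>
      regs s' 100 = of_bool (\<exists>i<N. high i = p)) ?s"
    using W_read[of ?s "Reg 56" "Const 1"] hold r01 hb w20 by simp
  show ?thesis
  proof (cases "\<exists>i<N. high i = p")
    case False
    have fin: "scan_inv s0 m t lo e (p + 1) (set_reg 60 (p + 1) s')" if s': "same 100 ?s s'" for s'
    proof -
      have "same 50 ?s s'" using s' by (auto simp: same_def)
      then have "same 50 s0 s'" using same same_trans[of 50 s0 s 50 s'] by simp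
      then show ?thesis
        using rank_Suc_no[OF False, unfolded Suc_eq_plus1] best test same_reg[OF s'] r
        by (auto simp: scan_inv_def)
    qed
    show ?thesis
      using Hp p1
      apply (simp add: r)
      apply (rule W_mono[OF rd])
      using False fin p1 by (auto simp: same_reg r)
  next
    case True
    then obtain i where i: "i < N" "high i = p" by blast
    have rk: "rank p = i" "rank (p + 1) = i + 1" using rank_high[OF i(1), unfolded Suc_eq_plus1] i(2) by simp_all
    note lb = low_bits[OF i(1)]
    have il: "i * l + B + l \<le> length E" using lb(2) by linarith
    have il': "i * l < 2 ^ w" "i * l + B < 2 ^ w" using il E pow_ge by linarith+
    have ip: "i \<le> p" using i(2) by (auto simp: ef_high_def)
    \<comment> \<open>A one at position \<open>p\<close> with \<open>i\<close> ones before it has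
      \<open>p - i\<close> zeros before it, and this is the upper part of entry
      \<open>i\<close>.\<close>
    have val: "(p - i) * 2 ^ l + a i mod 2 ^ l = a i" using high_split[OF i(1)] i(2) by simp
    have an': "a i < 2 ^ w" using an[OF i(1)] pow_ge by simp
    have val1: "(p - i) * 2 ^ l < 2 ^ w" using val an' by linarith
    have i1: "i + 1 < 2 ^ w" using ip p1 by simp
    define qb where "qb = block [
       Op Mul 56 (Reg 61) L,
       Op Add 56 (Reg 56) b,
       read (Reg 56) L,
       Op Sub 58 (Reg 60) (Reg 61),
       Op Shl 58 (Reg 58) L,
       Op Add 58 (Reg 58) (Reg 100),
       Cond (Less T (key_reg m)) Skip (block [
         Op Add 63 (Reg 61) (Const 0),
         Op Add 64 (Reg 58) (Const 0)]),
       Op Add 61 (Reg 61) (Const 1)]"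
    have rest: "W qb (\<lambda>u s'. u \<le> 25 \<and> regs s' 60 = p \<and>
         scan_inv s0 m t lo e (p + 1) (set_reg 60 (p + 1) s')) s'"
      if s': "same 100 ?s s'" for s'
    proof -
      have "same 50 ?s s'" using s' by (auto simp: same_def)
      then have same': "same 50 s0 s'" using same same_trans[of 50 s0 s 50 s'] by simp
      have q: "regs s' 61 = i" "regs s' 60 = p" "regs s' 54 = Hbase" "regs s' 62 = e"
          "regs s' 63 = regs s 63" "regs s' 64 = regs s 64"
        using same_reg[OF s'] r rk by simp_all
      have hold': "holds_bits w (mem s') E" using same_mem[OF s'] hold by simp
      have r1': "regs s' 1 = w" using same_reg[OF s'] r01 by simp
      have ov: "operand_val w (set_reg x v s'') q = operand_val w s'' q" if "below 50 q" "x \<ge> 50" for x v s'' q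
        using that by (rule operand_set_reg)
      have ov': "operand_val w s' T = t" "operand_val w s' L = l" "operand_val w s' b = B"
        using opv[OF same'] ops by simp_all
      let ?s' = "set_reg 56 (i * l + B) (set_reg 56 (i * l) s')"
      have rd2: "W (read (Reg 56) L) (\<lambda>u s'. u = 12 \<and> same 100 ?s' s' \<and>
        regs s' 100 = a i mod 2 ^ l) ?s'"
        using W_read[of ?s' "Reg 56" L] hold' r1' il lb(1) l_less(1) ops(5) below_mono[OF ops(5), of 100]
        by (simp add: ov ov' add.commute)
      have fin: "regs s'' 60 = p \<and> scan_inv s0 m t lo e (p + 1) (set_reg 60 (p + 1)
          (set_reg 61 (i + 1) (set_reg 64 (a i) (set_reg 63 i (set_reg 58 v1 (set_reg 58 v2 (set_reg 58 v3 s'')))))))"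
        if s'': "same 100 ?s' s''" and le: "key m i \<le> t" for s'' v1 v2 v3
      proof -
        have "same 50 ?s' s''" using s'' by (auto simp: same_def)
        then have "same 50 s0 s''" using same' same_trans[of 50 s0 s' 50 s''] by simp
        then show ?thesis
          using best test same_reg[OF s''] r q rk i le
          by (auto simp: scan_inv_def)
      qed
      have fin': "regs s'' 60 = p \<and> scan_inv s0 m t lo e (p + 1) (set_reg 60 (p + 1)
          (set_reg 61 (i + 1) (set_reg 58 v1 (set_reg 58 v2 (set_reg 58 v3 s'')))))"
        if s'': "same 100 ?s' s''" and gt: "t < key m i" for s'' v1 v2 v3
      proof -
        have "same 50 ?s' s''" using s'' by (auto simp: same_def)
        then have same'': "same 50 s0 s''" using same' same_trans[of 50 s0 s' 50 s''] by simp
        have "j \<le> regs s 63" if "rank (lo * w) \<le> j" "j < i + 1" "key m j \<le> t" for j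
        proof -
          have "j \<noteq> i" using that gt by auto
          then show ?thesis using best(4)[of j] that rk by simp
        qed
        with same'' show ?thesis
          using best test same_reg[OF s''] r q rk i
          by (auto simp: scan_inv_def)
      qed
      have tail: "W (block [
         Op Sub 58 (Reg 60) (Reg 61),
         Op Shl 58 (Reg 58) L,
         Op Add 58 (Reg 58) (Reg 100),
         Cond (Less T (key_reg m)) Skip (block [
           Op Add 63 (Reg 61) (Const 0),
           Op Add 64 (Reg 58) (Const 0)]),
         Op Add 61 (Reg 61) (Const 1)]) (\<lambda>u s'. u \<le> 11 \<and> regs s' 60 = p \<and>
           scan_inv s0 m t lo e (p + 1) (set_reg 60 (p + 1) s')) s''"
        if s'': "same 100 ?s' s''" and r100: "regs s'' 100 = a i mod 2 ^ l" for s''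
      proof -
        have q': "regs s'' 61 = i" "regs s'' 60 = p" using same_reg[OF s''] q by simp_all
        have ov'': "operand_val w s'' T = t" "operand_val w s'' L = l"
        proof -
          have "operand_val w s'' q = operand_val w ?s' q" if "below 50 q" for q
            using same_operand'[OF s'' that] by simp
          then show "operand_val w s'' T = t" "operand_val w s'' L = l"
            using ops ov ov' by simp_all
        qed
        show ?thesis
          using fin[OF s''] fin'[OF s''] ip val val1 an' i1 p1
          by (cases m) (simp_all add: key_reg_def q' r100 ov ov'' ops key_def)
      qed
      show ?thesis
        unfolding qb_def using il'
        apply (simp add: q ov ov' ops)
        apply (rule W_mono[OF rd2])
        apply (elim conjE)
        apply (rule W_mono)
         apply (rule tail[unfolded block.simps])
          apply simp_all
        done
    qed
    show ?thesis
      unfolding qb_def[symmetric] using Hp p1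
      apply (simp add: r)
      apply (rule W_mono[OF rd])
      using True apply simp
      apply (elim conjE)
      apply (rule W_mono)
       apply (erule rest)
      apply simp
      done
  qed
qed

lemma W_scan_loop:
  assumes I: "scan_inv s0 m t lo e p s" and s0: "ready s0"
    and ops: "below 50 T" "operand_val w s0 T = t" "below 50 b" "operand_val w s0 b = B"
      "below 50 L" "operand_val w s0 L = l"
  shows "W (scan_loop m b L T) (\<lambda>u s'. u \<le> 41 * (e - p) + 1 \<and> scan_inv s0 m t lo e e s') s"
  unfolding scan_loop_def
proof (rule W_mono[OF W_While[where \<phi> = "41 * (e - p)" and
      I = "\<lambda>\<phi> s. \<exists>p. \<phi> = 41 * (e - p) \<and> scan_inv s0 m t lo e p s"]], goal_cases)
  case 1 then show ?case using I by blast
next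
  case (2 \<phi> s)
  then obtain p where p: "\<phi> = 41 * (e - p)" "scan_inv s0 m t lo e p s" by blast
  then have "p < e" using 2(2) by (simp add: scan_inv_def)
  show ?case
  proof (rule W_mono[OF scan_step[OF p(2) s0 ops \<open>p < e\<close>]])
    fix u :: nat and s' assume "u \<le> 40 \<and> scan_inv s0 m t lo e (p + 1) s'"
    moreover from this have "Suc u + 41 * (e - (p + 1)) \<le> \<phi>" using p(1) \<open>p < e\<close> by (auto simp: One_nat_def)
    ultimately show "\<exists>\<phi>'. Suc u + \<phi>' \<le> \<phi> \<and> (\<exists>p. \<phi>' = 41 * (e - p) \<and> scan_inv s0 m t lo e p s')"
      by blast
  qed
next
  case (3 u s')
  then obtain \<phi>' p' where *: "u + \<phi>' \<le> 41 * (e - p) + 1" "\<phi>' = 41 * (e - p')" "scan_inv s0 m t lo e p' s'"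
    "\<not> test_val w s' (Less (Reg 60) (Reg 62))" by blast
  then have "p' = e" by (simp add: scan_inv_def)
  then show ?case using * by simp
qed

definition pred_index :: "bool \<Rightarrow> nat \<Rightarrow> nat \<Rightarrow> bool" where
  "pred_index m t i \<longleftrightarrow> i < N \<and> key m i \<le> t \<and> (\<forall>j<N. key m j \<le> t \<longrightarrow> j \<le> i)"

text \<open>The binary search takes at most \<open>31 * w + 1\<close> steps and the scan of one
  block at most \<open>41 * w + 1\<close>; the remaining constant number of steps is absorbed
  because \<open>w\<close> is at least 20.\<close>

lemma W_pred:
  assumes s: "ready s"
    and ops: "below 50 T" "operand_val w s T = t" "below 50 b" "operand_val w s b = B"
      "below 50 L" "operand_val w s L = l" "below 50 K" "operand_val w s K = N"
    and t: "t < (if m then N else n)"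
  shows "W (pred m b K L T) (\<lambda>u s'. u \<le> 80 * w \<and> same 50 s s' \<and>
    pred_index m t (regs s' 63) \<and> regs s' 64 = a (regs s' 63)) s"
proof -
  have r: "regs s 0 = n" "regs s 1 = w" using s by (auto simp: ready_def)
  have ov: "operand_val w (set_reg x v s'') q = operand_val w s'' q" if "below 50 q" "x \<ge> 50" for x v s'' q
    using that by (rule operand_set_reg)
  let ?s1 = "set_reg 61 0 (set_reg 50 0 (set_reg 51 (2 ^ (w - 1)) (set_reg 51 (w - 1)
     (set_reg 57 (n + 1) (set_reg 52 M (set_reg 53 (N * l + B + 3 * N) (set_reg 59 (3 * N)
       (set_reg 54 (N * l + B) (set_reg 54 (N * l) s)))))))))"
  have "M < 2 ^ w" using M_less pow_ge by linarith
  then have dir0: "dir_inv s m t w ?s1"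
    using wpos rank_0 by (simp add: dir_inv_def add.commute[of B])
  have b1: "N * l < 2 ^ w" "N * l + B < 2 ^ w" "3 * N < 2 ^ w" "N * l + B + 3 * N < 2 ^ w" "n + 1 < 2 ^ w"
    using len E pow_ge M_less X_n by linarith+
  have b2: "2 ^ (w - 1) < (2::nat) ^ w" using wpos by simp
  have tail: "W (block [
     Op Mul 60 (Reg 50) (Reg 1),
     Op Add 62 (Reg 60) (Reg 1),
     Cond (Less (Reg 59) (Reg 62)) (Op Add 62 (Reg 59) (Const 0)) Skip,
     Op Add 63 (Const 0) (Const 0),
     Op Add 64 (Const 0) (Const 0),
     scan_loop m b L T]) (\<lambda>u s'. u \<le> 41 * w + 10 \<and> same 50 s s' \<and>
    pred_index m t (regs s' 63) \<and> regs s' 64 = a (regs s' 63)) s'" if I: "dir_inv s m t 0 s'" for s'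
  proof -
    obtain lo where lo: "regs s' 50 = lo" by simp
    have q: "same 50 s s'" "regs s' 59 = 3 * N" "regs s' 54 = Hbase" "lo \<le> M" "regs s' 61 = rank (lo * w)"
      and keys: "lo = 0 \<or> next_key m (rank (lo * w)) \<le> t"
        "\<And>b. lo < b \<Longrightarrow> b \<le> M \<Longrightarrow> t < next_key m (rank (b * w))"
      using I lo by (auto simp: dir_inv_def)
    have r1: "regs s' 1 = w" using same_reg[OF q(1), of 1] r by simp
    have low: "lo * w \<le> 3 * N"
      using mult_le_mono1[OF q(4), of w] by (meson div_times_less_eq_dividend order.trans)
    have b3: "lo * w < 2 ^ w" "lo * w + w < 2 ^ w" using low M_less Xw ww by linarith+
    let ?e = "min (lo * w + w) (3 * N)"
    have inv: "scan_inv s m t lo ?e (lo * w) (set_reg 64 0 (set_reg 63 0 s''))"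
      if s'': "s'' = (if 3 * N < lo * w + w then set_reg 62 (3 * N) (set_reg 62 (lo * w + w) (set_reg 60 (lo * w) s'))
        else set_reg 62 (lo * w + w) (set_reg 60 (lo * w) s'))" for s''
      using q low N a0 by (auto simp: scan_inv_def s'' key_def)
    have post: "pred_index m t (regs s' 63) \<and> regs s' 64 = a (regs s' 63) \<and> same 50 s s'"
      if I: "scan_inv s m t lo ?e ?e s'" for s'
    proof -
      have "regs s' 63 < N" "key m (regs s' 63) \<le> t" "regs s' 64 = a (regs s' 63)" "same 50 s s'"
        and best: "\<And>j. rank (lo * w) \<le> j \<Longrightarrow> j < rank ?e \<Longrightarrow> key m j \<le> t \<Longrightarrow> j \<le> regs s' 63"
        using I by (auto simp: scan_inv_def)
      moreover have "j \<le> regs s' 63" if "j < N" "key m j \<le> t" for j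
        by (rule pred_in_block[OF t keys refl wpos best that])
      ultimately show ?thesis by (simp add: pred_index_def)
    qed
    have ew: "?e - lo * w \<le> w" by simp
    have sl: "W (scan_loop m b L T) (\<lambda>u s'. u \<le> 41 * w + 1 \<and> same 50 s s' \<and>
        pred_index m t (regs s' 63) \<and> regs s' 64 = a (regs s' 63)) (set_reg 64 0 (set_reg 63 0 s''))"
      if s'': "s'' = (if 3 * N < lo * w + w then set_reg 62 (3 * N) (set_reg 62 (lo * w + w) (set_reg 60 (lo * w) s'))
        else set_reg 62 (lo * w + w) (set_reg 60 (lo * w) s'))" for s''
      by (rule W_mono[OF W_scan_loop[OF inv[OF s''] s ops(1-6)]])
        (use post ew mult_le_mono2[OF ew, of 41] in \<open>auto\<close>)
    show ?thesis
    proof (cases "3 * N < lo * w + w")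
      case True
      show ?thesis
        using True b3 b1 apply (simp add: lo r1 q)
        apply (rule W_mono)
         apply (rule sl[OF refl, unfolded if_P[OF True]])
        by simp
    next
      case False
      show ?thesis
        using False b3 b1 apply (simp add: lo r1 q)
        apply (rule W_mono)
         apply (rule sl[OF refl, unfolded if_not_P[OF False]])
        by simp
    qed
  qed
  show ?thesis
    unfolding pred_def using b1 b2 wpos
    apply (simp add: r ov ops)
    apply (rule W_mono)
     apply (rule W_dir_loop[OF dir0 s ops(1,2)])
    apply (elim conjE)
    apply (rule W_mono)
     apply (rule tail[unfolded block.simps])
     apply assumption
    using w20 apply simp
    done
qed

end

section \<open>Range minima from stack codes\<close>

text \<open>
  The bits record the pushes (\<open>True\<close>) and pops (\<open>False\<close>) of a scan that keeps the suffix minima on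
  the stack; they determine the minima of all windows, so the values need not be stored.
\<close>

fun stack_code :: "nat list \<Rightarrow> nat list \<Rightarrow> bool list" where
  "stack_code stk [] = []"
| "stack_code [] (v # vs) = True # stack_code [v] vs"
| "stack_code (u # stk) (v # vs) =
    (if v < u then False # stack_code stk (v # vs) else True # stack_code (v # u # stk) vs)"

text \<open>Every value is pushed once and popped at most once; this is where two bits per run come
  from.\<close>

lemma length_stack_code: "length (stack_code stk vs) \<le> length stk + 2 * length vs"
  by (induction stk vs rule: stack_code.induct) auto

text \<open>\<open>e\<close> is the index of the value being inserted. A pop at \<open>c = 0\<close>
  removes the current minimum itself, so \<open>e\<close> becomes the candidate, and truncated
  subtraction keeps \<open>c\<close> at 0 during further pops.\<close>

definition scan_step :: "nat \<Rightarrow> bool \<Rightarrow> nat \<times> nat \<times> nat \<Rightarrow> nat \<times> nat \<times> nat" where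
  "scan_step a x = (\<lambda>(e, k, c).
     if x then (Suc e, k, if a < e \<and> k \<noteq> e then Suc c else c)
     else (e, if a < e \<and> c = 0 then e else k, if a < e then c - 1 else c))"

text \<open>
  \<open>k\<close> is the leftmost minimum of the window from \<open>a\<close>, and \<open>c\<close> counts the stack entries above it.
  While \<open>e\<close> is being compared with the stack, \<open>k = e\<close> means that the minimum was popped.
\<close>

definition scan_ok :: "(nat \<Rightarrow> nat) \<Rightarrow> nat \<Rightarrow> nat list \<Rightarrow> nat \<times> nat \<times> nat \<Rightarrow> bool" where
  "scan_ok V a stk = (\<lambda>(e, k, c).
     if e \<le> a then k = a \<and> c = 0
     else if k = e then c = 0 \<and> (\<forall>i\<in>{a..<e}. V e \<le> V i)
     else a \<le> k \<and> k < e \<and> (\<forall>i\<in>{a..<e}. V k \<le> V i) \<and>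
       (\<exists>top rest. stk = top @ V k # rest \<and> length top = c \<and> (\<forall>u\<in>set top. V k \<le> u)))"

lemma scan_ok_pop:
  assumes "scan_ok V a (u # stk) (e, k, c)" "V e < u"
  shows "scan_ok V a stk (scan_step a False (e, k, c))"
proof (cases "e \<le> a \<or> k = e")
  case True
  then show ?thesis using assms by (auto simp: scan_ok_def scan_step_def)
next
  case False
  then obtain top rest where s: "u # stk = top @ V k # rest" "length top = c" "\<forall>u\<in>set top. V k \<le> u"
    and k: "a \<le> k" "k < e" "\<forall>i\<in>{a..<e}. V k \<le> V i"
    using assms by (auto simp: scan_ok_def split: if_splits)
  show ?thesis
  proof (cases top)
    case Nil
    then have "c = 0" "V e < V k" using s assms(2) by auto
    then have "\<forall>i\<in>{a..<e}. V e \<le> V i" using k(3) by (meson less_imp_le order.trans)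
    then show ?thesis using False \<open>c = 0\<close> by (simp add: scan_ok_def scan_step_def)
  next
    case (Cons u' top')
    then have "stk = top' @ V k # rest" "length top' = c - 1" "\<forall>u\<in>set top'. V k \<le> u" "c \<noteq> 0"
      using s by auto
    then have "\<exists>top rest. stk = top @ V k # rest \<and> length top = c - 1 \<and> (\<forall>u\<in>set top. V k \<le> u)"
      by blast
    then show ?thesis using False \<open>c \<noteq> 0\<close> k by (simp add: scan_ok_def scan_step_def)
  qed
qed

text \<open>A push happens only when the top of the stack is at most \<open>V e\<close>. A minimum
  still on the stack is at most all entries above it, hence at most \<open>V e\<close> as
  well.\<close>

lemma scan_ok_push:
  assumes ok: "scan_ok V a stk (e, k, c)" and top: "stk = [] \<or> hd stk \<le> V e"
  shows "scan_ok V a (V e # stk) (scan_step a True (e, k, c))"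
proof -
  consider "e < a" | "e = a" | "e > a" "k = e" | "e > a" "k \<noteq> e" by linarith
  then show ?thesis
  proof cases
    case 1
    then show ?thesis using ok by (simp add: scan_ok_def scan_step_def)
  next
    case 2
    then have k: "k = a" "c = 0" using ok by (simp_all add: scan_ok_def)
    have "\<exists>top rest. V a # stk = top @ V a # rest \<and> length top = 0 \<and> (\<forall>u\<in>set top. V a \<le> u)"
      by (intro exI[of _ "[]"] exI[of _ stk]) simp
    then show ?thesis using 2 k by (simp add: scan_ok_def scan_step_def)
  next
    case 3
    then have k: "c = 0" "\<forall>i\<in>{a..<e}. V e \<le> V i" using ok by (simp_all add: scan_ok_def)
    then have "\<forall>i\<in>{a..<Suc e}. V e \<le> V i" by (auto elim!: less_SucE)
    moreover have "\<exists>top rest. V e # stk = top @ V e # rest \<and> length top = 0 \<and> (\<forall>u\<in>set top. V e \<le> u)"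
      by (intro exI[of _ "[]"] exI[of _ stk]) simp
    ultimately show ?thesis using 3 k(1) by (simp add: scan_ok_def scan_step_def)
  next
    case 4
    then obtain top rest where s: "stk = top @ V k # rest" "length top = c" "\<forall>u\<in>set top. V k \<le> u"
      and k: "a \<le> k" "k < e" "\<forall>i\<in>{a..<e}. V k \<le> V i"
      using ok 4 by (auto simp: scan_ok_def)
    have ke: "V k \<le> V e"
      using top s by (cases top) auto
    then have *: "\<forall>i\<in>{a..<Suc e}. V k \<le> V i" using k(3) by (auto elim!: less_SucE)
    have "V e # stk = (V e # top) @ V k # rest" "length (V e # top) = Suc c" "\<forall>u\<in>set (V e # top). V k \<le> u"
      using s ke by simp_all
    then have "\<exists>top rest. V e # stk = top @ V k # rest \<and> length top = Suc c \<and> (\<forall>u\<in>set top. V k \<le> u)"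
      by blast
    then show ?thesis using 4 k * by (simp add: scan_ok_def scan_step_def)
  qed
qed

lemma scan_ok_step:
  assumes "scan_ok V a stk (e, k, c)" "e < be"
  obtains x stk' xs where "stack_code stk (map V [e..<be]) = x # xs"
    "fst (scan_step a x (e, k, c)) = (if x then Suc e else e)"
    "xs = stack_code stk' (map V [(if x then Suc e else e)..<be])"
    "scan_ok V a stk' (scan_step a x (e, k, c))"
proof -
  have up: "map V [e..<be] = V e # map V [Suc e..<be]" using assms(2) by (simp add: upt_conv_Cons)
  have f: "fst (scan_step a x (e, k, c)) = (if x then Suc e else e)" for x
    by (simp add: scan_step_def)
  show ?thesis
  proof (cases "stk = [] \<or> hd stk \<le> V e")
    case True
    have "stack_code stk (map V [e..<be]) = True # stack_code (V e # stk) (map V [Suc e..<be])"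
      unfolding up using True by (cases stk) simp_all
    then show ?thesis
      using scan_ok_push[OF assms(1) True] f by (intro that[of True]) simp_all
  next
    case False
    then obtain u stk' where stk: "stk = u # stk'" "V e < u" by (cases stk) auto
    have "stack_code stk (map V [e..<be]) = False # stack_code stk' (map V [e..<be])"
      unfolding up using stk by simp
    then show ?thesis
      using scan_ok_pop[OF assms(1)[unfolded stk] stk(2)] f by (intro that[of False]) simp_all
  qed
qed

section \<open>Layout of the stack codes and of the segment tree\<close>

definition block_code :: "nat \<Rightarrow> nat \<Rightarrow> (nat \<Rightarrow> nat) \<Rightarrow> nat \<Rightarrow> bool list" where
  "block_code w N V j = stack_code [] (map V [j * w..<min (j * w + w) N])"

text \<open>Block \<open>j\<close> owns the bits from \<open>2 * w * j\<close> on, however short its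
  code is, so no pointers are stored. The last block may be shorter, but so is its code, and
  \<open>2 * N\<close> bits suffice.\<close>

definition code_bits :: "nat \<Rightarrow> nat \<Rightarrow> (nat \<Rightarrow> nat) \<Rightarrow> bool list" where
  "code_bits w N V = table (2 * N) 1 (\<lambda>p. of_bool
     (let xs = block_code w N V (p div (2 * w)) in p mod (2 * w) < length xs \<and> xs ! (p mod (2 * w))))"

text \<open>A segment tree in heap numbering: node \<open>x\<close> has the children
  \<open>2 * x\<close> and \<open>2 * x + 1\<close>, and leaf \<open>b\<close> is node
  \<open>M + b\<close>, for any \<open>M\<close>. Node 0 is cut off because it would be its own
  child.\<close>

function tree_val :: "nat \<Rightarrow> (nat \<Rightarrow> nat) \<Rightarrow> nat \<Rightarrow> nat" where
  "tree_val M f x = (if x = 0 \<or> M \<le> x then f (x - M) else min (tree_val M f (2 * x)) (tree_val M f (2 * x + 1)))"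
  by pat_completeness auto
termination by (relation "measure (\<lambda>(M, f, x). M - x)") auto

declare tree_val.simps [simp del]

text \<open>The least key of a range holds the position of its leftmost minimum.\<close>

definition run_key :: "nat \<Rightarrow> (nat \<Rightarrow> nat) \<Rightarrow> nat \<Rightarrow> nat" where
  "run_key n V i = V i * (n + 1) + i"

definition block_key :: "nat \<Rightarrow> nat \<Rightarrow> (nat \<Rightarrow> nat) \<Rightarrow> nat \<Rightarrow> nat" where
  "block_key w n V b = Min (run_key n V ` {b * w..<b * w + w})"

text \<open>Two words per full block, hence at most \<open>2 * N\<close> bits. A final partial block
  has no leaf; ranges inside it are answered from its stack code.\<close>

definition tree_bits :: "nat \<Rightarrow> nat \<Rightarrow> nat \<Rightarrow> (nat \<Rightarrow> nat) \<Rightarrow> bool list" where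
  "tree_bits w n N V = table (2 * (N div w)) w (tree_val (N div w) (block_key w n V))"

lemma tree_val_leaf: "M \<le> x \<Longrightarrow> tree_val M f x = f (x - M)"
  by (subst tree_val.simps) simp

lemma tree_val_node: "0 < x \<Longrightarrow> x < M \<Longrightarrow>
    tree_val M f x = min (tree_val M f (2 * x)) (tree_val M f (2 * x + 1))"
  by (subst tree_val.simps) simp

lemma tree_val_less:
  assumes "\<And>b. b < M \<Longrightarrow> f b < K" "0 < x" "x < 2 * M"
  shows "tree_val M f x < K"
  using assms
proof (induction M f x rule: tree_val.induct)
  case (1 M f x)
  show ?case
  proof (cases "M \<le> x")
    case True
    then show ?thesis using "1.prems" by (simp add: tree_val_leaf)
  next
    case False
    then show ?thesis using 1 by (simp add: tree_val_node)
  qed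
qed

text \<open>Doubling both ends replaces the nodes of a range by their children, so a range with even
  ends may be lifted one level.\<close>

lemma tree_level:
  assumes "1 \<le> x" "y \<le> M"
  shows "(\<forall>i\<in>{2 * x..<2 * y}. z \<le> tree_val M f i) \<longleftrightarrow> (\<forall>i\<in>{x..<y}. z \<le> tree_val M f i)"
proof -
  have "z \<le> tree_val M f i \<longleftrightarrow> z \<le> tree_val M f (2 * i) \<and> z \<le> tree_val M f (2 * i + 1)"
    if "i \<in> {x..<y}" for i
    using that assms tree_val_node[of i M f] by simp
  then have "(\<forall>i\<in>{x..<y}. z \<le> tree_val M f i) \<longleftrightarrow>
      (\<forall>i\<in>{x..<y}. z \<le> tree_val M f (2 * i) \<and> z \<le> tree_val M f (2 * i + 1))"
    by blast
  also have "\<dots> \<longleftrightarrow> (\<forall>i\<in>{2 * x..<2 * y}. z \<le> tree_val M f i)"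
  proof
    assume *: "\<forall>i\<in>{x..<y}. z \<le> tree_val M f (2 * i) \<and> z \<le> tree_val M f (2 * i + 1)"
    show "\<forall>i\<in>{2 * x..<2 * y}. z \<le> tree_val M f i"
    proof
      fix i assume "i \<in> {2 * x..<2 * y}"
      then have "i div 2 \<in> {x..<y}" by auto
      moreover have "i = 2 * (i div 2) \<or> i = 2 * (i div 2) + 1" by presburger
      ultimately show "z \<le> tree_val M f i" using * by metis
    qed
  next
    assume *: "\<forall>i\<in>{2 * x..<2 * y}. z \<le> tree_val M f i"
    show "\<forall>i\<in>{x..<y}. z \<le> tree_val M f (2 * i) \<and> z \<le> tree_val M f (2 * i + 1)"
      using * by auto
  qed
  finally show ?thesis by simp
qed

text \<open>The code is replayed from the start of the block, because only then is the stack known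
  to be empty. Registers 50, 51 and 52 hold \<open>e\<close>, \<open>k\<close> and \<open>c\<close>
  of the scan, register 53 the address of the next code bit.\<close>

definition in_block :: "operand \<Rightarrow> operand \<Rightarrow> operand \<Rightarrow> com" where
  "in_block a b C = block [
     Op Div 50 a (Reg 1),
     Op Mul 50 (Reg 50) (Reg 1),
     Op Add 53 (Reg 50) (Reg 50),
     Op Add 53 (Reg 53) C,
     Op Add 51 a (Const 0),
     Op Add 52 (Const 0) (Const 0),
     While (Less (Reg 50) b) (block [
       read (Reg 53) (Const 1),
       Op Add 53 (Reg 53) (Const 1),
       Cond (Eq (Reg 100) (Const 1))
         (block [
           Cond (Less a (Reg 50)) (Cond (Eq (Reg 51) (Reg 50)) Skip (Op Add 52 (Reg 52) (Const 1))) Skip,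
           Op Add 50 (Reg 50) (Const 1)])
         (Cond (Less a (Reg 50))
           (Cond (Eq (Reg 52) (Const 0)) (Op Add 51 (Reg 50) (Const 0)) (Op Sub 52 (Reg 52) (Const 1)))
           Skip)])]"

definition tree_min :: "nat \<Rightarrow> operand \<Rightarrow> com" where
  "tree_min r B = block [
     Op Mul 55 (Reg r) (Reg 1),
     Op Add 55 (Reg 55) B,
     read (Reg 55) (Reg 1),
     Cond (Less (Reg 100) (Reg 51)) (Op Add 51 (Reg 100) (Const 0)) Skip]"

text \<open>\<open>0 - 1\<close> wraps around to the largest word, which serves as infinity; the
  final \<open>Mod\<close> extracts the position from the least key.\<close>

definition block_range :: "operand \<Rightarrow> operand \<Rightarrow> operand \<Rightarrow> operand \<Rightarrow> com" where
  "block_range a b M B = block [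
     Op Div 52 a (Reg 1),
     Op Add 52 (Reg 52) M,
     Op Div 53 b (Reg 1),
     Op Add 53 (Reg 53) M,
     Op Sub 51 (Const 0) (Const 1),
     While (Less (Reg 52) (Reg 53)) (block [
       Op Mod 54 (Reg 52) (Const 2),
       Cond (Eq (Reg 54) (Const 1)) (block [tree_min 52 B, Op Add 52 (Reg 52) (Const 1)]) Skip,
       Op Mod 54 (Reg 53) (Const 2),
       Cond (Eq (Reg 54) (Const 1)) (block [Op Sub 53 (Reg 53) (Const 1), tree_min 53 B]) Skip,
       Op Div 52 (Reg 52) (Const 2),
       Op Div 53 (Reg 53) (Const 2)]),
     Op Add 54 (Reg 0) (Const 1),
     Op Mod 51 (Reg 51) (Reg 54)]"

section \<open>Correctness and running time of range-minimum queries\<close>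

locale ram_rmq = ram +
  fixes N :: nat and V :: "nat \<Rightarrow> nat" and C B :: nat
  assumes N_le: "N \<le> n" and V_le: "\<And>i. i < N \<Longrightarrow> V i \<le> n"
    and codes: "segment E C (code_bits w N V)"
    and tree: "segment E B (tree_bits w n N V)"
begin

definition argmin_on :: "nat \<Rightarrow> nat \<Rightarrow> nat \<Rightarrow> bool" where
  "argmin_on a b k \<longleftrightarrow> a \<le> k \<and> k < b \<and> (\<forall>i\<in>{a..<b}. V k \<le> V i)"

lemma wpos: "w > 0" using w20 by simp

lemma length_block_code: "length (block_code w N V j) \<le> 2 * (min (j * w + w) N - j * w)"
  using length_stack_code[of "[]" "map V [j * w..<min (j * w + w) N]"] by (simp add: block_code_def)

lemma code_bit:
  assumes q: "q < length (block_code w N V j)" and j: "j * w < N"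
  shows "bits_at E (C + (2 * w * j + q)) 1 = of_bool (block_code w N V j ! q)"
    "C + (2 * w * j + q) + 1 \<le> length E"
proof -
  have q2: "q < 2 * (min (j * w + w) N - j * w)" using q length_block_code[of j] by linarith
  then have qw: "q < 2 * w" by linarith
  have i: "2 * w * j + q < 2 * N" using q2 j by (simp add: mult.commute)
  have dm: "(2 * w * j + q) div (2 * w) = j" "(2 * w * j + q) mod (2 * w) = q"
    using qw by simp_all
  let ?f = "\<lambda>p. of_bool (let xs = block_code w N V (p div (2 * w)) in
    p mod (2 * w) < length xs \<and> xs ! (p mod (2 * w)))"
  have s: "segment E C (table (2 * N) 1 ?f)" using codes by (simp add: code_bits_def)
  show "bits_at E (C + (2 * w * j + q)) 1 = of_bool (block_code w N V j ! q)"
    "C + (2 * w * j + q) + 1 \<le> length E"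
    using bits_at_table[OF s i] q unfolding Let_def dm by (simp_all add: take_bit_eq_mod)
qed

text \<open>\<open>q\<close> code bits have been consumed. The clause on \<open>k = e\<close>
  excludes stopping at \<open>b\<close> just after the minimum was popped, when \<open>k\<close>
  would point outside the window.\<close>

definition scan_inv :: "state \<Rightarrow> nat \<Rightarrow> nat \<Rightarrow> nat \<Rightarrow> state \<Rightarrow> bool" where
  "scan_inv s0 a b q s \<longleftrightarrow> same 50 s0 s \<and> (let j = a div w; xs = block_code w N V j;
      e = regs s 50; k = regs s 51; c = regs s 52 in
     q \<le> length xs \<and> regs s 53 = C + (2 * w * j + q) \<and> e \<le> b \<and> (k = e \<longrightarrow> e < b) \<and> c \<le> q \<and>
     (\<exists>stk. drop q xs = stack_code stk (map V [e..<min (j * w + w) N]) \<and> scan_ok V a stk (e, k, c)))"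

lemma in_block_step:
  assumes I: "scan_inv s0 av bv q s" and s0: "ready s0"
    and ops: "below 50 a" "operand_val w s0 a = av" "below 50 b" "operand_val w s0 b = bv"
    and ab: "av < bv" "bv \<le> N" "bv \<le> av div w * w + w" and e: "regs s 50 < bv"
  shows "W (block [
       read (Reg 53) (Const 1),
       Op Add 53 (Reg 53) (Const 1),
       Cond (Eq (Reg 100) (Const 1))
         (block [
           Cond (Less a (Reg 50)) (Cond (Eq (Reg 51) (Reg 50)) Skip (Op Add 52 (Reg 52) (Const 1))) Skip,
           Op Add 50 (Reg 50) (Const 1)])
         (Cond (Less a (Reg 50))
           (Cond (Eq (Reg 52) (Const 0)) (Op Add 51 (Reg 50) (Const 0)) (Op Sub 52 (Reg 52) (Const 1)))
           Skip)])
     (\<lambda>u s'. u \<le> 20 \<and> scan_inv s0 av bv (q + 1) s') s"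
proof -
  let ?j = "av div w" and ?e = "regs s 50" and ?k = "regs s 51" and ?c = "regs s 52"
  let ?xs = "block_code w N V (av div w)" and ?be = "min (av div w * w + w) N"
  obtain stk where same: "same 50 s0 s" and q: "q \<le> length ?xs" "regs s 53 = C + (2 * w * ?j + q)"
      "?e \<le> bv" "?c \<le> q"
    and dr: "drop q ?xs = stack_code stk (map V [?e..<?be])" and ok: "scan_ok V av stk (?e, ?k, ?c)"
    using I by (auto simp: scan_inv_def Let_def)
  have ebe: "?e < ?be" using e ab by simp
  obtain x stk' xs where st: "stack_code stk (map V [?e..<?be]) = x # xs"
    "fst (scan_step av x (?e, ?k, ?c)) = (if x then Suc ?e else ?e)"
    "xs = stack_code stk' (map V [(if x then Suc ?e else ?e)..<?be])"
    "scan_ok V av stk' (scan_step av x (?e, ?k, ?c))"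
    by (rule scan_ok_step[OF ok ebe])
  have ql: "q < length ?xs" using dr st(1) by (metis drop_all list.distinct(1) not_le)
  have xq: "?xs ! q = x" "drop (Suc q) ?xs = xs"
    using dr st(1) by (metis Cons_nth_drop_Suc ql list.inject)+
  have jw: "?j * w < N" using ab div_times_less_eq_dividend[of av w] by linarith
  note cb = code_bit[OF ql jw]
  have r1: "regs s 1 = w" and hold: "holds_bits w (mem s) E"
    using same s0 by (auto simp: ready_def same_def)
  have b1: "C + (2 * w * ?j + q) + 1 < 2 ^ w" using cb(2) E pow_ge by linarith
  have b2: "?e + 1 < 2 ^ w" using e ab N_le pow_ge X_n by linarith
  have "q \<le> 2 * w" using ql length_block_code[of ?j] by linarith
  then have b3: "?c + 1 < 2 ^ w" using q(4) ww wpos by linarith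
  have rd: "W (read (Reg 53) (Const 1)) (\<lambda>u s'. u = 12 \<and> same 100 s s' \<and> regs s' 100 = of_bool x) s"
    using W_read[of s "Reg 53" "Const 1"] hold r1 cb q(2) xq w20 by simp
  obtain e' k' c' where stp: "scan_step av x (?e, ?k, ?c) = (e', k', c')" by (metis prod_cases3)
  have fin: "scan_inv s0 av bv (q + 1) s'"
    if "same 50 s s'" "regs s' 50 = e'" "regs s' 51 = k'" "regs s' 52 = c'" "regs s' 53 = C + (2 * w * ?j + q) + 1" for s'
  proof -
    have "same 50 s0 s'" using same_trans[OF same that(1)] by simp
    moreover have "e' \<le> bv" "k' = e' \<longrightarrow> e' < bv" "c' \<le> q + 1"
    proof -
      have ek: "?k = av \<or> ?k \<le> ?e" using ok by (auto simp: scan_ok_def split: if_splits)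
      show "e' \<le> bv" "c' \<le> q + 1"
        using e q(4) stp by (auto simp: scan_step_def split: if_splits)
      show "k' = e' \<longrightarrow> e' < bv"
        using e ek ab(1) stp by (auto simp: scan_step_def split: if_splits)
    qed
    moreover have "\<exists>stk. drop (q + 1) ?xs = stack_code stk (map V [e'..<?be]) \<and> scan_ok V av stk (e', k', c')"
      using st(2-4) xq(2)[unfolded Suc_eq_plus1] stp by (intro exI[of _ stk']) simp
    ultimately show ?thesis using that ql by (simp add: scan_inv_def Let_def)
  qed
  have av: "operand_val w s' a = av" if "same 50 s s'" for s'
    using same_operand[OF same_trans[OF same that order.refl] ops(1)] ops(2) by simp
  have tail: "W (block [
       Op Add 53 (Reg 53) (Const 1),
       Cond (Eq (Reg 100) (Const 1))
         (block [
           Cond (Less a (Reg 50)) (Cond (Eq (Reg 51) (Reg 50)) Skip (Op Add 52 (Reg 52) (Const 1))) Skip,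
           Op Add 50 (Reg 50) (Const 1)])
         (Cond (Less a (Reg 50))
           (Cond (Eq (Reg 52) (Const 0)) (Op Add 51 (Reg 50) (Const 0)) (Op Sub 52 (Reg 52) (Const 1)))
           Skip)])
     (\<lambda>u s'. u \<le> 8 \<and> scan_inv s0 av bv (q + 1) s') s'"
    if s': "same 100 s s'" "regs s' 100 = of_bool x" for s'
  proof -
    have s50: "same 50 s s'" using s' by (auto simp: same_def)
    have r: "regs s' 50 = ?e" "regs s' 51 = ?k" "regs s' 52 = ?c" "regs s' 53 = C + (2 * w * ?j + q)"
      using same_reg[OF s'(1)] q by simp_all
    have avs: "operand_val w (set_reg 53 v s') a = av" for v
      using av[of "set_reg 53 v s'"] s50 by simp
    show ?thesis
    proof (cases x)
      case True
      then show ?thesis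
        using b1 b2 b3 s50 stp
        by (auto simp: s'(2) r avs scan_step_def split: if_splits intro!: fin)
    next
      case False
      have "?c < 2 ^ w" "?e < 2 ^ w" using b2 b3 by simp_all
      then show ?thesis
        using b1 b2 b3 s50 stp False
        by (auto simp: s'(2) r avs scan_step_def split: if_splits intro!: fin)
    qed
  qed
  show ?thesis
    apply (simp only: block.simps W_Seq)
    apply (rule W_mono[OF rd])
    apply (elim conjE)
    apply (rule W_mono)
     apply (rule tail[unfolded block.simps])
      apply simp_all
    done
qed

text \<open>A block has at most \<open>2 * w\<close> code bits, and each costs at most 21
  steps.\<close>

lemma W_in_block:
  assumes s: "ready s"
    and ops: "below 50 a" "operand_val w s a = av" "below 50 b" "operand_val w s b = bv"
      "below 50 Cb" "operand_val w s Cb = C"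
    and ab: "av < bv" "bv \<le> N" "bv \<le> av div w * w + w"
  shows "W (in_block a b Cb) (\<lambda>u s'. u \<le> 50 * w \<and> same 50 s s' \<and> argmin_on av bv (regs s' 51)) s"
proof -
  let ?j = "av div w" and ?xs = "block_code w N V (av div w)" and ?be = "min (av div w * w + w) N"
  let ?\<phi> = "21 * length ?xs"
  define body where "body = block [
       read (Reg 53) (Const 1),
       Op Add 53 (Reg 53) (Const 1),
       Cond (Eq (Reg 100) (Const 1))
         (block [
           Cond (Less a (Reg 50)) (Cond (Eq (Reg 51) (Reg 50)) Skip (Op Add 52 (Reg 52) (Const 1))) Skip,
           Op Add 50 (Reg 50) (Const 1)])
         (Cond (Less a (Reg 50))
           (Cond (Eq (Reg 52) (Const 0)) (Op Add 51 (Reg 50) (Const 0)) (Op Sub 52 (Reg 52) (Const 1)))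
           Skip)]"
  have jw: "?j * w \<le> av" by (rule div_times_less_eq_dividend)
  have xl: "length ?xs \<le> 2 * w" using length_block_code[of ?j] by linarith
  have "C + 2 * N \<le> length E" using codes by (simp add: segment_def code_bits_def)
  then have b1: "2 * (?j * w) + C < 2 ^ w" "?j * w + ?j * w < 2 ^ w" "?j * w < 2 ^ w" "av < 2 ^ w"
    using jw ab E pow_ge by linarith+
  let ?s = "set_reg 52 0 (set_reg 51 av (set_reg 53 (?j * w + ?j * w + C)
     (set_reg 53 (?j * w + ?j * w) (set_reg 50 (?j * w) (set_reg 50 ?j s)))))"
  have inv0: "scan_inv s av bv 0 ?s"
  proof -
    have "scan_ok V av [] (?j * w, av, 0)" using jw by (simp add: scan_ok_def)
    moreover have "?xs = stack_code [] (map V [?j * w..<?be])" by (simp add: block_code_def)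
    moreover have "?j * w \<le> bv" using jw ab by linarith
    ultimately show ?thesis using jw ab by (auto simp: scan_inv_def Let_def algebra_simps)
  qed
  have loop: "W (While (Less (Reg 50) b) body) (\<lambda>u s'. u \<le> ?\<phi> + 1 \<and> same 50 s s' \<and> argmin_on av bv (regs s' 51)) ?s"
  proof (rule W_mono[OF W_While[where \<phi> = ?\<phi> and
        I = "\<lambda>\<phi> s'. \<exists>q. \<phi> = 21 * (length ?xs - q) \<and> scan_inv s av bv q s'"]], goal_cases)
    case 1 then show ?case using inv0 by (intro exI[of _ 0]) simp
  next
    case (2 \<phi> s')
    then obtain q where q: "\<phi> = 21 * (length ?xs - q)" "scan_inv s av bv q s'" by blast
    then have "same 50 s s'" by (simp add: scan_inv_def)
    then have "operand_val w s' b = bv" using same_operand ops by metis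
    then have e: "regs s' 50 < bv" using 2(2) by simp
    show ?case unfolding body_def
    proof (rule W_mono[OF in_block_step[OF q(2) s ops(1-4) ab e]])
      fix u :: nat and s'' assume *: "u \<le> 20 \<and> scan_inv s av bv (q + 1) s''"
      then have "q + 1 \<le> length ?xs" by (simp add: scan_inv_def Let_def)
      then have "Suc u + 21 * (length ?xs - (q + 1)) \<le> \<phi>" using * q(1) by (auto simp: One_nat_def)
      then show "\<exists>\<phi>'. Suc u + \<phi>' \<le> \<phi> \<and> (\<exists>q. \<phi>' = 21 * (length ?xs - q) \<and> scan_inv s av bv q s'')"
        using * by blast
    qed
  next
    case (3 u s')
    then obtain q where q: "u \<le> ?\<phi> + 1" "scan_inv s av bv q s'" "\<not> test_val w s' (Less (Reg 50) b)"
      by auto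
    then have sm: "same 50 s s'" by (simp add: scan_inv_def)
    then have "operand_val w s' b = bv" using same_operand ops by metis
    then have e: "regs s' 50 = bv" "regs s' 51 \<noteq> bv"
      using q by (auto simp: scan_inv_def Let_def)
    obtain stk where "scan_ok V av stk (bv, regs s' 51, regs s' 52)"
      using q(2) e(1) by (auto simp: scan_inv_def Let_def)
    then have "argmin_on av bv (regs s' 51)"
      using ab e(2) by (auto simp: scan_ok_def argmin_on_def)
    then show ?case using q(1) sm by simp
  qed
  have ov: "operand_val w (set_reg x v s'') q = operand_val w s'' q" if "below 50 q" "x \<ge> 50" for x v s'' q
    using that by (rule operand_set_reg)
  have r1: "regs s 1 = w" using s by (simp add: ready_def)
  show ?thesis
    unfolding in_block_def body_def[symmetric] using b1
    apply (simp add: ov ops r1)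
    apply (rule W_mono)
     apply (rule loop)
    using xl w20 apply simp
    done
qed

section \<open>Minima over whole blocks by the segment tree\<close>

abbreviation "M \<equiv> N div w"
abbreviation "tv \<equiv> tree_val M (block_key w n V)"

lemma run_key_less: "i < N \<Longrightarrow> run_key n V i < X"
proof -
  assume i: "i < N"
  have "V i * (n + 1) \<le> n * (n + 1)" using V_le[OF i] by (rule mult_le_mono1)
  moreover have "n * (n + 1) + n < (n + 1) * (n + 1)" by (simp add: algebra_simps One_nat_def)
  ultimately show ?thesis unfolding run_key_def using i N_le X_n by linarith
qed

lemma block_in: "b < M \<Longrightarrow> i < b * w + w \<Longrightarrow> i < N"
proof -
  assume b: "b < M" and i: "i < b * w + w"
  have "Suc b * w \<le> M * w" using b by (intro mult_le_mono1) simp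
  also have "\<dots> \<le> N" by (rule div_times_less_eq_dividend)
  finally show ?thesis using i by simp
qed

lemma block_key_less: "b < M \<Longrightarrow> block_key w n V b < X"
proof -
  assume b: "b < M"
  have "block_key w n V b \<in> run_key n V ` {b * w..<b * w + w}"
    unfolding block_key_def using wpos by (intro Min_in) auto
  then show ?thesis using run_key_less block_in[OF b] by auto
qed

lemma tree_node:
  assumes "0 < x" "x < 2 * M"
  shows "bits_at E (x * w + B) w = tv x" "x * w + B + w \<le> length E" "tv x < X"
proof -
  show "tv x < X" by (rule tree_val_less) (use assms block_key_less in auto)
  then have "tv x < 2 ^ w" using pow_ge by linarith
  moreover have s: "segment E B (table (2 * M) w tv)" using tree by (simp add: tree_bits_def)
  ultimately show "bits_at E (x * w + B) w = tv x"
    using bits_at_table(1)[OF s assms(2)] by (simp add: take_bit_nat_eq_self add.commute)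
  show "x * w + B + w \<le> length E"
    using bits_at_table(2)[OF s assms(2)] by (simp add: add.commute)
qed

lemma W_tree_min:
  assumes hold: "holds_bits w (mem s) E" and r1: "regs s 1 = w" and ops: "below 50 b" "operand_val w s b = B"
    and x: "0 < regs s r" "regs s r < 2 * M" and r: "r < 55" "r \<noteq> 51"
  shows "W (tree_min r b) (\<lambda>u s'. u \<le> 16 \<and> (\<forall>i<55. i \<noteq> 51 \<longrightarrow> regs s' i = regs s i) \<and>
    mem s' = mem s \<and> reported s' = reported s \<and> regs s' 51 = min (regs s 51) (tv (regs s r))) s"
proof -
  let ?x = "regs s r"
  note tn = tree_node[OF x]
  have b1: "?x * w < 2 ^ w" "?x * w + B < 2 ^ w" using tn(2) E pow_ge by linarith+
  let ?s = "set_reg 55 (?x * w + B) (set_reg 55 (?x * w) s)"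
  have rd: "W (read (Reg 55) (Reg 1)) (\<lambda>u s'. u = 12 \<and> same 100 ?s s' \<and> regs s' 100 = tv ?x) ?s"
    using W_read[of ?s "Reg 55" "Reg 1"] hold r1 tn by simp
  have ov: "operand_val w (set_reg x v s'') q = operand_val w s'' q" if "below 50 q" "x \<ge> 50" for x v s'' q
    using that by (rule operand_set_reg)
  have "tv ?x < 2 ^ w" using tn(3) pow_ge by linarith
  then show ?thesis
    unfolding tree_min_def using b1 r
    apply (simp add: r1 ov ops)
    apply (rule W_mono)
     apply (rule rd)
    apply (auto simp: same_def min_def)
    done
qed

text \<open>The final answer \<open>G\<close> is described by its lower bounds, so an empty range of
  nodes needs no minimum of its own. The right end is below \<open>2 ^ j\<close>, which bounds the
  number of levels left to climb.\<close>

definition range_inv :: "state \<Rightarrow> nat \<Rightarrow> nat \<Rightarrow> state \<Rightarrow> bool" where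
  "range_inv s0 G j s \<longleftrightarrow> same 50 s0 s \<and> 1 \<le> regs s 52 \<and> regs s 53 \<le> 2 * M \<and> regs s 53 < 2 ^ j \<and>
    regs s 52 \<le> 2 * M \<and>
    (\<forall>z. z \<le> G \<longleftrightarrow> z \<le> regs s 51 \<and> (\<forall>i\<in>{regs s 52..<regs s 53}. z \<le> tv i))"

lemma range_step:
  assumes I: "range_inv s0 G j s" and s0: "ready s0" and ops: "below 50 b" "operand_val w s0 b = B"
    and lt: "regs s 52 < regs s 53"
  shows "W (block [
       Op Mod 54 (Reg 52) (Const 2),
       Cond (Eq (Reg 54) (Const 1)) (block [tree_min 52 b, Op Add 52 (Reg 52) (Const 1)]) Skip,
       Op Mod 54 (Reg 53) (Const 2),
       Cond (Eq (Reg 54) (Const 1)) (block [Op Sub 53 (Reg 53) (Const 1), tree_min 53 b]) Skip,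
       Op Div 52 (Reg 52) (Const 2),
       Op Div 53 (Reg 53) (Const 2)]) (\<lambda>u s'. u \<le> 45 \<and> range_inv s0 G (j - 1) s' \<and> j > 0) s"
proof -
  let ?L = "regs s 52" and ?R = "regs s 53"
  define L where "L = (if ?L mod 2 = 1 then ?L + 1 else ?L)"
  define R where "R = (if ?R mod 2 = 1 then ?R - 1 else ?R)"
  define m1 where "m1 = (if ?L mod 2 = 1 then min (regs s 51) (tv ?L) else regs s 51)"
  define m2 where "m2 = (if ?R mod 2 = 1 then min m1 (tv R) else m1)"
  have same: "same 50 s0 s" and bd: "1 \<le> ?L" "?R \<le> 2 * M" "?R < 2 ^ j"
    and G: "\<And>z. z \<le> G \<longleftrightarrow> z \<le> regs s 51 \<and> (\<forall>i\<in>{?L..<?R}. z \<le> tv i)"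
    using I by (auto simp: range_inv_def)
  have j: "j > 0" using bd lt by (cases j) auto
  have LR: "L mod 2 = 0" "R mod 2 = 0" "L \<le> ?R" "1 \<le> L" "R \<le> 2 * M" "R \<le> ?R"
  proof -
    have odd_even: "(if x mod 2 = 1 then x + 1 else x) mod 2 = 0" "(if x mod 2 = 1 then x - 1 else x) mod 2 = 0"
      for x :: nat by (auto split: if_splits) presburger+
    then show "L mod 2 = 0" "R mod 2 = 0" by (simp_all add: L_def R_def)
    show "L \<le> ?R" "1 \<le> L" "R \<le> ?R" using lt bd by (auto simp: L_def R_def)
    then show "R \<le> 2 * M" using bd by linarith
  qed
  have halfle: "x div 2 \<le> m" if "x \<le> 2 * m" for x m :: nat
    using that by presburger
  have Mw: "2 * M < 2 ^ w"
    using div_le_dividend[of N w] N_le X_n pow_ge by linarith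
  \<comment> \<open>An odd left end is a right child, and the node before an odd right end is a left
    child. Their parents would also cover a node outside the range, so these nodes are evaluated
    separately.\<close>
  have split: "(\<forall>i\<in>{?L..<?R}. z \<le> tv i) \<longleftrightarrow>
      (?L mod 2 = 1 \<longrightarrow> z \<le> tv ?L) \<and> (?R mod 2 = 1 \<longrightarrow> z \<le> tv R) \<and> (\<forall>i\<in>{L..<R}. z \<le> tv i)" for z
  proof -
    have "{?L..<?R} = (if ?L mod 2 = 1 then {?L} else {}) \<union> {L..<?R}"
      using lt by (auto simp: L_def)
    moreover have "{L..<?R} = (if ?R mod 2 = 1 then {R} else {}) \<union> {L..<R}"
    proof (cases "?R mod 2 = 1")
      case True
      then have "?R = Suc R" using lt by (simp add: R_def)
      moreover have "L \<noteq> ?R" using True LR(1) by auto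
      ultimately have "?R = Suc R" "L \<le> R" using LR(3) by simp_all
      then show ?thesis using True by auto
    next
      case False
      then show ?thesis by (simp add: R_def)
    qed
    ultimately show ?thesis by auto
  qed
  have half: "range_inv s0 G (j - 1) s'"
    if "same 50 s s'" "regs s' 52 = L div 2" "regs s' 53 = R div 2" "regs s' 51 = m2" for s'
  proof -
    have 1: "same 50 s0 s'" using same_trans[OF same that(1)] by simp
    have ev: "L = 2 * (L div 2)" "R = 2 * (R div 2)" using LR(1,2) by presburger+
    have 2: "1 \<le> L div 2" using LR(1,4) by presburger
    have 3: "R div 2 \<le> M" by (rule halfle) (rule LR)
    have "z \<le> G \<longleftrightarrow> z \<le> m2 \<and> (\<forall>i\<in>{L div 2..<R div 2}. z \<le> tv i)" for z
      using G[of z] split[of z] tree_level[OF 2 3, of z] ev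
      by (auto simp: m1_def m2_def)
    moreover have "R div 2 < 2 ^ (j - 1)" using bd(3) LR(6) j by (cases j) auto
    moreover have "L div 2 \<le> 2 * M" "R div 2 \<le> 2 * M"
      using LR bd by (intro order.trans[OF div_le_dividend]; linarith)+
    ultimately show ?thesis using 1 2 that unfolding range_inv_def by simp
  qed
  have holds: "holds_bits w (mem s') E" "regs s' 1 = w" "operand_val w s' b = B" if "same 50 s s'" for s'
    using that same s0 same_operand[OF same_trans[OF same that order.refl] ops(1)] ops(2)
    by (auto simp: ready_def same_def)
  define q1 where "q1 = block [tree_min 52 b, Op Add 52 (Reg 52) (Const 1)]"
  define q2 where "q2 = block [Op Sub 53 (Reg 53) (Const 1), tree_min 53 b]"
  have c1: "W (Cond (Eq (Reg 54) (Const 1)) q1 Skip) (\<lambda>u s'. u \<le> 18 \<and> same 50 s s' \<and>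
      regs s' 52 = L \<and> regs s' 53 = ?R \<and> regs s' 51 = m1) (set_reg 54 (?L mod 2) s)"
  proof (cases "?L mod 2 = 1")
    case True
    let ?s = "set_reg 54 1 s"
    have "W (tree_min 52 b) (\<lambda>u s'. u \<le> 16 \<and> (\<forall>i<55. i \<noteq> 51 \<longrightarrow> regs s' i = regs ?s i) \<and>
      mem s' = mem ?s \<and> reported s' = reported ?s \<and> regs s' 51 = min (regs ?s 51) (tv (regs ?s 52))) ?s"
      by (rule W_tree_min) (use bd lt holds[of ?s] ops in simp_all)
    moreover have "?L + 1 < 2 ^ w" using lt bd Mw by linarith
    ultimately show ?thesis
      using True unfolding q1_def
      apply (simp add: L_def m1_def)
      apply (erule W_mono)
      apply (auto simp: same_def)
      done
  next
    case False
    then show ?thesis by (simp add: L_def m1_def)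
  qed
  have c2: "W (Cond (Eq (Reg 54) (Const 1)) q2 Skip) (\<lambda>u s''. u \<le> 18 \<and> same 50 s s'' \<and>
      regs s'' 52 = L \<and> regs s'' 53 = R \<and> regs s'' 51 = m2) (set_reg 54 (?R mod 2) s')"
    if s': "same 50 s s'" "regs s' 52 = L" "regs s' 53 = ?R" "regs s' 51 = m1" for s'
  proof (cases "?R mod 2 = 1")
    case True
    let ?s = "set_reg 53 R (set_reg 54 1 s')"
    have "R > 0" using True lt bd(1) by (simp add: R_def)
    moreover have "R < 2 * M" using True lt bd(2) by (simp add: R_def)
    ultimately have "W (tree_min 53 b) (\<lambda>u s'. u \<le> 16 \<and> (\<forall>i<55. i \<noteq> 51 \<longrightarrow> regs s' i = regs ?s i) \<and>
      mem s' = mem ?s \<and> reported s' = reported ?s \<and> regs s' 51 = min (regs ?s 51) (tv (regs ?s 53))) ?s"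
      by (intro W_tree_min) (use s' holds[of ?s] ops in simp_all)
    moreover have "?R < 2 ^ w" "1 \<le> ?R" using lt bd Mw by linarith+
    ultimately show ?thesis
      using True s' unfolding q2_def
      apply (simp add: R_def m2_def)
      apply (erule W_mono)
      apply (auto simp: same_def)
      done
  next
    case False
    then show ?thesis using s' by (simp add: R_def m2_def)
  qed
  have Lw: "L < 2 ^ w" "R < 2 ^ w" using LR bd Mw by linarith+
  show ?thesis
    unfolding q1_def[symmetric] q2_def[symmetric]
    apply (simp del: W_Cond)
    apply (rule W_mono)
     apply (rule c1)
    apply (elim conjE)
    apply (simp del: W_Cond)
    apply (rule W_mono)
     apply (rule c2)
        apply assumption+
    using j by (auto intro!: half)
qed

lemma block_cover:
  assumes "F < K" "K \<le> M"
  shows "(\<forall>i\<in>{F + M..<K + M}. z \<le> tv i) \<longleftrightarrow> z \<le> Min (run_key n V ` {F * w..<K * w})"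
proof -
  have AK: "F * w < K * w" using assms wpos by simp
  have "(\<forall>i\<in>{F + M..<K + M}. z \<le> tv i) \<longleftrightarrow> (\<forall>b\<in>{F..<K}. z \<le> block_key w n V b)"
  proof
    assume *: "\<forall>i\<in>{F + M..<K + M}. z \<le> tv i"
    show "\<forall>b\<in>{F..<K}. z \<le> block_key w n V b"
    proof
      fix b assume "b \<in> {F..<K}"
      then have "z \<le> tv (b + M)" using * by simp
      then show "z \<le> block_key w n V b" by (simp add: tree_val_leaf)
    qed
  next
    assume *: "\<forall>b\<in>{F..<K}. z \<le> block_key w n V b"
    show "\<forall>i\<in>{F + M..<K + M}. z \<le> tv i"
    proof
      fix i assume i: "i \<in> {F + M..<K + M}"
      then have "i - M \<in> {F..<K}" by auto
      then show "z \<le> tv i" using * i by (simp add: tree_val_leaf)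
    qed
  qed
  also have "\<dots> \<longleftrightarrow> (\<forall>b\<in>{F..<K}. \<forall>i\<in>{b * w..<b * w + w}. z \<le> run_key n V i)"
    using wpos by (simp add: block_key_def)
  also have "\<dots> \<longleftrightarrow> (\<forall>i\<in>{F * w..<K * w}. z \<le> run_key n V i)"
  proof
    assume *: "\<forall>b\<in>{F..<K}. \<forall>i\<in>{b * w..<b * w + w}. z \<le> run_key n V i"
    show "\<forall>i\<in>{F * w..<K * w}. z \<le> run_key n V i"
    proof
      fix i assume i: "i \<in> {F * w..<K * w}"
      then have "i div w \<in> {F..<K}"
        using wpos by (simp add: less_eq_div_iff_mult_less_eq div_less_iff_less_mult)
      moreover have "i \<in> {i div w * w..<i div w * w + w}"
        using dividend_less_div_times[OF wpos, of i] by (simp add: add.commute)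
      ultimately show "z \<le> run_key n V i" using * by blast
    qed
  next
    assume *: "\<forall>i\<in>{F * w..<K * w}. z \<le> run_key n V i"
    show "\<forall>b\<in>{F..<K}. \<forall>i\<in>{b * w..<b * w + w}. z \<le> run_key n V i"
    proof (intro ballI)
      fix b i assume b: "b \<in> {F..<K}" and i: "i \<in> {b * w..<b * w + w}"
      have "F * w \<le> b * w" "Suc b * w \<le> K * w" using b by (intro mult_le_mono1; simp)+
      then have "F * w \<le> i" "i < K * w" using i unfolding mult_Suc atLeastLessThan_iff by linarith+
      then have "i \<in> {F * w..<K * w}" by simp
      then show "z \<le> run_key n V i" using * by blast
    qed
  qed
  also have "\<dots> \<longleftrightarrow> z \<le> Min (run_key n V ` {F * w..<K * w})"
    using AK by simp
  finally show ?thesis .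
qed

lemma Min_run_key:
  assumes "a < b" "b \<le> N"
  shows "argmin_on a b (Min (run_key n V ` {a..<b}) mod (n + 1))" "Min (run_key n V ` {a..<b}) < X"
proof -
  let ?G = "Min (run_key n V ` {a..<b})"
  have "?G \<in> run_key n V ` {a..<b}" using assms(1) by (intro Min_in) auto
  then obtain k where k: "a \<le> k" "k < b" "?G = run_key n V k" by auto
  then show "?G < X" using run_key_less assms by simp
  have "k < n + 1" using k(2) assms N_le by simp
  then have "?G mod (n + 1) = k" unfolding k(3) run_key_def by simp
  moreover have "V k \<le> V i" if "i \<in> {a..<b}" for i
  proof (rule ccontr)
    assume "\<not> V k \<le> V i"
    \<comment> \<open>Indices are below \<open>n + 1\<close>, so a difference of one in the value
      outweighs any difference of indices.\<close>
    then have "(V i + 1) * (n + 1) \<le> V k * (n + 1)" by (intro mult_le_mono1) simp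
    moreover have "i < n + 1" using that assms N_le by simp
    moreover have "run_key n V k \<le> run_key n V i" using k(3) that by (metis Min_le finite_atLeastLessThan finite_imageI imageI)
    ultimately show False by (simp add: run_key_def algebra_simps)
  qed
  ultimately show "argmin_on a b (?G mod (n + 1))" using k by (simp add: argmin_on_def)
qed

lemma W_block_range:
  assumes s: "ready s"
    and ops: "below 50 a" "operand_val w s a = F * w" "below 50 b" "operand_val w s b = K * w"
      "below 50 mo" "operand_val w s mo = M" "below 50 bo" "operand_val w s bo = B"
    and AK: "F < K" "K \<le> M"
  shows "W (block_range a b mo bo) (\<lambda>u s'. u \<le> 50 * w \<and> same 50 s s' \<and> argmin_on (F * w) (K * w) (regs s' 51)) s"
proof -
  define body where "body = block [
       Op Mod 54 (Reg 52) (Const 2),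
       Cond (Eq (Reg 54) (Const 1)) (block [tree_min 52 bo, Op Add 52 (Reg 52) (Const 1)]) Skip,
       Op Mod 54 (Reg 53) (Const 2),
       Cond (Eq (Reg 54) (Const 1)) (block [Op Sub 53 (Reg 53) (Const 1), tree_min 53 bo]) Skip,
       Op Div 52 (Reg 52) (Const 2),
       Op Div 53 (Reg 53) (Const 2)]"
  let ?G = "Min (run_key n V ` {F * w..<K * w})"
  have Aw: "F * w < K * w" using AK wpos by simp
  have "K * w \<le> M * w" using AK by simp
  also have "\<dots> \<le> N" by (rule div_times_less_eq_dividend)
  finally have KN: "K * w \<le> N" .
  note Gm = Min_run_key[OF Aw KN]
  have Mw: "2 * M < 2 ^ w"
    using div_le_dividend[of N w] N_le X_n pow_ge by linarith
  let ?s = "set_reg 51 (mask w) (set_reg 53 (K + M) (set_reg 53 K (set_reg 52 (F + M) (set_reg 52 F s))))"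
  have inv0: "range_inv s ?G w ?s"
  proof -
    have "?G \<le> mask w" using Gm(2) pow_ge by (simp add: mask_eq_exp_minus_1)
    then have "z \<le> ?G \<longleftrightarrow> z \<le> mask w \<and> (\<forall>i\<in>{F + M..<K + M}. z \<le> tv i)" for z
      unfolding block_cover[OF AK] by auto
    then show ?thesis using AK Mw unfolding range_inv_def by simp
  qed
  have loop: "W (While (Less (Reg 52) (Reg 53)) body) (\<lambda>u s'. u \<le> 46 * w + 1 \<and> same 50 s s' \<and> regs s' 51 = ?G) ?s"
  proof (rule W_mono[OF W_While[where \<phi> = "46 * w" and
        I = "\<lambda>\<phi> s'. \<exists>j. \<phi> = 46 * j \<and> range_inv s ?G j s'"]], goal_cases)
    case 1 then show ?case using inv0 by blast
  next
    case (2 \<phi> s')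
    then obtain j where j: "\<phi> = 46 * j" "range_inv s ?G j s'" by blast
    have lt: "regs s' 52 < regs s' 53" using 2(2) by simp
    show ?case unfolding body_def
    proof (rule W_mono[OF range_step[OF j(2) s ops(7,8) lt]])
      fix u :: nat and s'' assume *: "u \<le> 45 \<and> range_inv s ?G (j - 1) s'' \<and> j > 0"
      then have "Suc u + 46 * (j - 1) \<le> \<phi>" using j(1) by (auto simp: One_nat_def)
      then show "\<exists>\<phi>'. Suc u + \<phi>' \<le> \<phi> \<and> (\<exists>j. \<phi>' = 46 * j \<and> range_inv s ?G j s'')"
        using * by blast
    qed
  next
    case (3 u s')
    then obtain j where q: "u \<le> 46 * w + 1" "range_inv s ?G j s'" "\<not> regs s' 52 < regs s' 53"
      by auto
    then have "\<And>z. z \<le> ?G \<longleftrightarrow> z \<le> regs s' 51" unfolding range_inv_def by simp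
    then have "regs s' 51 = ?G" by (meson order.antisym order.refl)
    then show ?case using q by (simp add: range_inv_def)
  qed
  have ov: "operand_val w (set_reg x v s'') q = operand_val w s'' q" if "below 50 q" "x \<ge> 50" for x v s'' q
    using that by (rule operand_set_reg)
  have r1: "regs s 1 = w" using s by (simp add: ready_def)
  have n1: "n + 1 < 2 ^ w" using X_n pow_ge by linarith
  have AM: "F + M < 2 ^ w" "K + M < 2 ^ w" using AK Mw by linarith+
  have m0: "binop_val w Sub 0 1 = mask w"
    by (simp add: binop_val.simps mask_eq_exp_minus_1 take_bit_nat_eq_self)
  show ?thesis
    unfolding block_range_def body_def[symmetric] using AM wpos
    apply (simp add: ov ops r1 m0)
    apply (rule W_mono)
     apply (rule loop)
    using w20 n1 s Gm(1) apply (auto simp: same_def ready_def)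
    done
qed

end

section \<open>Listing documents\<close>

text \<open>Empty ranges are dropped here, so every range on the stack is nonempty. Left and right
  ends are kept in two arrays, based at registers 8 and 9.\<close>

definition push :: "operand \<Rightarrow> operand \<Rightarrow> com" where
  "push a b = Cond (Less a b) (block [
     Op Add 40 (Reg 8) (Reg 4),
     Store (Reg 40) a,
     Op Add 40 (Reg 9) (Reg 4),
     Store (Reg 40) b,
     Op Add 4 (Reg 4) (Const 1)]) Skip"

text \<open>Rows, positions and documents are counted from 0 inside the program, while
  \<open>Lookup\<close> takes and returns numbers counted from 1.\<close>

definition get_doc :: com where
  "get_doc = block [
     Op Add 26 (Reg 23) (Const 1),
     Lookup 26 (Reg 26),
     Op Sub 26 (Reg 26) (Const 1),
     pred False (Reg 13) (Reg 14) (Reg 15) (Reg 26),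
     Op Add 25 (Reg 63) (Const 0)]"

definition member :: com where
  "member = block [
     Op Add 26 (Reg 6) (Reg 25),
     Load 27 (Reg 26),
     Op Add 28 (Const 0) (Const 0),
     Cond (Less (Reg 27) (Reg 5)) (block [
       Op Add 26 (Reg 7) (Reg 27),
       Load 26 (Reg 26),
       Cond (Eq (Reg 26) (Reg 25)) (Op Add 28 (Const 1) (Const 0)) Skip]) Skip]"

definition report_doc :: com where
  "report_doc = block [
     get_doc,
     Op Add 26 (Reg 6) (Reg 25),
     Store (Reg 26) (Reg 5),
     Op Add 26 (Reg 7) (Reg 5),
     Store (Reg 26) (Reg 25),
     Op Add 5 (Reg 5) (Const 1),
     Op Add 26 (Reg 25) (Const 1),
     Report (Reg 26),
     Op Add 23 (Reg 23) (Const 1)]"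

text \<open>A range is cut at block boundaries so that what remains lies in one block or consists of
  whole blocks. The left piece is queried at once, the rest goes back to the stack.\<close>

definition choose_run :: com where
  "choose_run = block [
     Op Div 26 (Reg 20) (Reg 1),
     Op Add 26 (Reg 26) (Const 1),
     Op Mul 26 (Reg 26) (Reg 1),
     Cond (Less (Reg 26) (Reg 21))
       (block [
         Op Mod 27 (Reg 20) (Reg 1),
         Cond (Eq (Reg 27) (Const 0))
           (block [
             Op Div 28 (Reg 21) (Reg 1),
             Op Mul 28 (Reg 28) (Reg 1),
             push (Reg 28) (Reg 21),
             Op Add 21 (Reg 28) (Const 0),
             block_range (Reg 20) (Reg 21) (Reg 18) (Reg 16)])
           (block [
             push (Reg 26) (Reg 21),
             Op Add 21 (Reg 26) (Const 0),
             in_block (Reg 20) (Reg 21) (Reg 17)])])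
       (in_block (Reg 20) (Reg 21) (Reg 17)),
     Op Add 22 (Reg 51) (Const 0)]"

definition run_bounds :: com where
  "run_bounds = block [
     pred True (Reg 10) (Reg 11) (Reg 12) (Reg 22),
     Op Add 23 (Reg 64) (Const 0),
     Op Add 27 (Reg 22) (Const 1),
     Cond (Less (Reg 27) (Reg 11))
       (block [pred True (Reg 10) (Reg 11) (Reg 12) (Reg 27), Op Add 24 (Reg 64) (Const 0)])
       (Op Add 24 (Reg 0) (Const 0)),
     Cond (Less (Reg 23) (Reg 2)) (Op Add 23 (Reg 2) (Const 0)) Skip,
     Cond (Less (Reg 3) (Reg 24)) (Op Add 24 (Reg 3) (Const 0)) Skip]"

text \<open>
  Number of single-block or block-aligned ranges that a range of runs is cut into, for blocks of
  \<open>w\<close> runs.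
\<close>

definition weight :: "nat \<Rightarrow> nat \<times> nat \<Rightarrow> nat" where
  "weight w = (\<lambda>(a, b). if b \<le> (a div w + 1) * w then 1
     else of_bool (a mod w \<noteq> 0) + 1 + of_bool (b mod w \<noteq> 0))"

lemma weight_le: "weight w x \<le> 3"
  by (auto simp: weight_def split: prod.splits)

text \<open>The listing problem freed of strings: \<open>first\<close> is all that remains of the
  interleaved LCP array, for the half-open interval from \<open>lo\<close> to \<open>hi\<close> of
  rows counted from 0.\<close>

locale listing = ram w A c n P X E
  + R: ram_ef w A c n P X E \<rho> rs bR
  + D: ram_ef w A c n P X E d ds bD
  + Q: ram_rmq w A c n P X E \<rho> V bC bT
  for w :: nat and A :: "'a csa" and c n P X E \<rho> rs bR d ds bD V bC bT +
  fixes sa da :: "nat \<Rightarrow> nat" and lo hi m :: nat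
  assumes lookup: "\<And>i. i < n \<Longrightarrow> lookup A c (i + 1) = sa i"
    and sa: "\<And>i. i < n \<Longrightarrow> 1 \<le> sa i \<and> sa i \<le> n"
    and da: "\<And>i. i < n \<Longrightarrow> D.pred_index False (sa i - 1) (da i)"
    and lohi: "lo < hi" "hi \<le> n"
    and first: "\<And>i k. lo \<le> i \<Longrightarrow> i < hi \<Longrightarrow> R.pred_index False i k \<Longrightarrow>
      V k < m \<longleftrightarrow> da i \<notin> da ` {lo..<i}"
begin

lemma dn: "d \<le> n" and rn: "\<rho> \<le> n" and nX: "n < X" "n + 1 < X"
  using D.N_le R.N_le X_n by simp_all

lemma da_less: "i < n \<Longrightarrow> da i < d"
  using da by (auto simp: D.pred_index_def)

definition params :: "state \<Rightarrow> bool" where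
  "params s \<longleftrightarrow> ready s \<and> regs s 2 = lo \<and> regs s 3 = hi \<and>
     regs s 6 = X \<and> regs s 7 = 2 * X \<and> regs s 8 = 3 * X \<and> regs s 9 = 4 * X \<and>
     regs s 10 = bR \<and> regs s 11 = \<rho> \<and> regs s 12 = R.l \<and> regs s 13 = bD \<and> regs s 14 = d \<and> regs s 15 = D.l \<and>
     regs s 16 = bT \<and> regs s 17 = bC \<and> regs s 18 = Q.M"

definition keeps :: "nat set \<Rightarrow> state \<Rightarrow> state \<Rightarrow> bool" where
  "keeps S s s' \<longleftrightarrow> (\<forall>r<50. r \<notin> S \<longrightarrow> regs s' r = regs s r) \<and> mem s' = mem s \<and> reported s' = reported s"

text \<open>The top of the stack is the last entry of the list.\<close>

definition stack :: "(nat \<times> nat) list \<Rightarrow> state \<Rightarrow> bool" where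
  "stack ys s \<longleftrightarrow> regs s 4 = length ys \<and>
     (\<forall>i<length ys. mem s (3 * X + i) = fst (ys ! i) \<and> mem s (4 * X + i) = snd (ys ! i))"

text \<open>
  Testing membership without initialised memory: \<open>j\<close> is reported iff the entry found at
  \<open>X + j\<close> is the index of a cell, in use, of the list at \<open>2 * X\<close> that points back to \<open>j\<close>.
\<close>

definition marks :: "state \<Rightarrow> bool" where
  "marks s \<longleftrightarrow> regs s 5 = length (reported s) \<and> length (reported s) \<le> n \<and>
     (\<forall>i<length (reported s). mem s (2 * X + i) < d \<and> reported s ! i = mem s (2 * X + i) + 1 \<and>
        mem s (X + mem s (2 * X + i)) = i)"

lemma words: "5 * X + 5 * n < 2 ^ w" "hi < 2 ^ w" "lo < 2 ^ w" "\<rho> < 2 ^ w" "d < 2 ^ w" "n + 1 < 2 ^ w"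
  using nX dn rn lohi pow_ge Xw by linarith+

lemma params_same: "params s \<Longrightarrow> same 50 s s' \<Longrightarrow> params s'"
  by (auto simp: params_def ready_def same_def)

lemma params_set_reg [simp]: "x = 4 \<or> x = 5 \<or> x \<ge> 19 \<Longrightarrow> params (set_reg x v s) \<longleftrightarrow> params s"
  by (elim disjE) (simp_all add: params_def ready_def)

lemma stack_set_reg [simp]: "x \<noteq> 4 \<Longrightarrow> stack ys (set_reg x v s) \<longleftrightarrow> stack ys s"
  by (simp add: stack_def)

lemma marks_set_reg [simp]: "x \<noteq> 5 \<Longrightarrow> marks (set_reg x v s) \<longleftrightarrow> marks s"
  by (simp add: marks_def)

lemma stack_same: "stack ys s \<Longrightarrow> same 50 s s' \<Longrightarrow> stack ys s'"
  by (auto simp: stack_def same_def)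

lemma marks_same: "marks s \<Longrightarrow> same 50 s s' \<Longrightarrow> marks s'"
  by (auto simp: marks_def same_def)

lemma params_cong:
  assumes "params s" "holds_bits w (mem s') E"
    and "\<And>r. r < 19 \<Longrightarrow> r \<noteq> 4 \<Longrightarrow> r \<noteq> 5 \<Longrightarrow> regs s' r = regs s r"
  shows "params s'"
  using assms(1,2) by (simp add: params_def ready_def assms(3))

lemma keeps_params:
  assumes "keeps S s s'" "S \<subseteq> {4, 5} \<union> {19..}" "params s"
  shows "params s'"
proof (rule params_cong[OF assms(3)])
  show "holds_bits w (mem s') E" using assms by (simp add: keeps_def params_def ready_def)
  fix r :: nat assume "r < 19" "r \<noteq> 4" "r \<noteq> 5"
  then have "r \<notin> {4, 5} \<union> {19..}" by simp
  then have "r \<notin> S" using assms(2) by blast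
  then show "regs s' r = regs s r" using assms(1) \<open>r < 19\<close> by (simp add: keeps_def)
qed

text \<open>\<open>E\<close> has fewer than \<open>X\<close> bits and so occupies only words at
  addresses below \<open>X\<close>.\<close>

lemma holds_store:
  assumes "holds_bits w M E" "X \<le> p" "v < 2 ^ w"
  shows "holds_bits w (M(p := v)) E"
proof -
  have "k div w \<noteq> p" if "k < length E" for k
    using that assms(2) E div_le_dividend[of k w] by linarith
  then show ?thesis using assms by (auto simp: holds_bits_def)
qed

section \<open>The stack, the reported documents and the bounds of a run\<close>

lemma W_push:
  assumes s: "params s" "marks s" "stack ys s" and len: "length ys \<le> n"
    and ops: "below 40 a" "operand_val w s a = av" "below 40 b" "operand_val w s b = bv"
    and small: "av \<le> n" "bv \<le> n" and r4: "a \<noteq> Reg 4" "b \<noteq> Reg 4"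
  shows "W (push a b) (\<lambda>u s'. u \<le> 10 \<and> params s' \<and> marks s' \<and>
     stack (if av < bv then ys @ [(av, bv)] else ys) s' \<and> reported s' = reported s \<and>
     (\<forall>r<40. r \<noteq> 4 \<longrightarrow> regs s' r = regs s r)) s"
proof -
  have r: "regs s 4 = length ys" "regs s 8 = 3 * X" "regs s 9 = 4 * X"
    using s by (auto simp: stack_def params_def)
  have ws: "3 * X + length ys < 2 ^ w" "4 * X + length ys < 2 ^ w" "length ys + 1 < 2 ^ w" "av < 2 ^ w" "bv < 2 ^ w"
    using len words small by linarith+
  have lX: "length ys < X" using len nX by simp
  have ov: "operand_val w (set_reg 40 v s'') q = operand_val w s'' q" if "below 40 q" for v s'' q
    using that by (rule operand_set_reg) simp
  have ov': "operand_val w (s''\<lparr>mem := M\<rparr>) q = operand_val w s'' q" for s'' M q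
    by (cases q) (auto simp: operand_val.simps)
  let ?M = "(mem s)(3 * X + length ys := av, 4 * X + length ys := bv)"
  have st: "stack (ys @ [(av, bv)]) (set_reg 4 (length ys + 1) s')" if "mem s' = ?M" for s'
    using s(3) lX that unfolding stack_def by (auto simp: nth_append less_Suc_eq)
  have mk: "marks s'" if "mem s' = ?M" "reported s' = reported s" "regs s' 5 = regs s 5" for s'
  proof -
    have "length (reported s) \<le> n" using s(2) by (simp add: marks_def)
    then show ?thesis using s(2) that nX dn unfolding marks_def by auto
  qed
  show ?thesis
  proof (cases "av < bv")
    case False
    then show ?thesis using s ops by (simp add: push_def)
  next
    case True
    have hold: "holds_bits w ?M E"
      using s(1) ws by (intro holds_store) (auto simp: params_def ready_def)
    show ?thesis
      using True ws
      apply (simp add: push_def r ov ov' ops)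
      apply (intro conjI params_cong[OF s(1)] mk st)
      apply (simp_all add: hold r)
      done
  qed
qed

abbreviation "lt \<equiv> lookup_time A n"

lemma pred_unique: "D.pred_index False t i \<Longrightarrow> D.pred_index False t j \<Longrightarrow> i = j"
  unfolding D.pred_index_def by (meson order.antisym)

lemma W_get_doc:
  assumes s: "params s" and i: "regs s 23 = i" "i < n"
  shows "W get_doc (\<lambda>u s'. u \<le> 80 * w + 4 + lt \<and> keeps {25, 26} s s' \<and> regs s' 25 = da i) s"
proof -
  have sai: "1 \<le> sa i" "sa i \<le> n" "sa i - 1 < n" using sa[OF i(2)] by (auto simp: One_nat_def)
  have ws: "i + 1 < 2 ^ w" "sa i < 2 ^ w" using i(2) sai words by simp_all
  let ?s = "set_reg 26 (sa i - 1) (set_reg 26 (sa i) (set_reg 26 (i + 1) s))"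
  have par: "params ?s" using s by simp
  have pr: "W (pred False (Reg 13) (Reg 14) (Reg 15) (Reg 26)) (\<lambda>u s'. u \<le> 80 * w \<and> same 50 ?s s' \<and>
      D.pred_index False (sa i - 1) (regs s' 63) \<and> regs s' 64 = ds (regs s' 63)) ?s"
    by (rule D.W_pred) (use par sai in \<open>simp_all add: params_def ready_def\<close>)
  have pr': "W (pred False (Reg 13) (Reg 14) (Reg 15) (Reg 26)) (\<lambda>u s'. u \<le> 80 * w \<and> same 50 ?s s' \<and>
      regs s' 63 = da i) ?s"
    by (rule W_mono[OF pr]) (use pred_unique[OF _ da[OF i(2)]] in blast)
  have dw: "da i < 2 ^ w" using da_less[OF i(2)] words by simp
  show ?thesis
    using ws sai
    apply (simp add: get_doc_def i lookup take_bit_nat_eq_self)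
    apply (rule W_mono)
     apply (rule pr')
    using dw by (auto simp: keeps_def same_def)
qed

lemma member_iff:
  assumes "marks s" "j < d"
  shows "j + 1 \<in> set (reported s) \<longleftrightarrow>
    mem s (X + j) < regs s 5 \<and> mem s (2 * X + mem s (X + j)) = j"
proof
  assume "j + 1 \<in> set (reported s)"
  then obtain i where "i < length (reported s)" "reported s ! i = j + 1" by (metis in_set_conv_nth)
  then show "mem s (X + j) < regs s 5 \<and> mem s (2 * X + mem s (X + j)) = j"
    using assms(1) by (auto simp: marks_def)
next
  assume *: "mem s (X + j) < regs s 5 \<and> mem s (2 * X + mem s (X + j)) = j"
  then have i: "mem s (X + j) < length (reported s)" using assms(1) by (simp add: marks_def)
  then have "reported s ! mem s (X + j) = j + 1" using * assms(1) by (simp add: marks_def)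
  then show "j + 1 \<in> set (reported s)" using i nth_mem by metis
qed

lemma W_member:
  assumes s: "params s" "marks s" and j: "regs s 25 = j" "j < d"
  shows "W member (\<lambda>u s'. u \<le> 10 \<and> keeps {26, 27, 28} s s' \<and>
    (regs s' 28 = 1 \<longleftrightarrow> j + 1 \<in> set (reported s))) s"
proof -
  have r: "regs s 6 = X" "regs s 7 = 2 * X" using s(1) by (simp_all add: params_def)
  have len: "regs s 5 \<le> n" using s(2) by (simp add: marks_def)
  have ws: "X + j < 2 ^ w" using j words dn by linarith
  have w2: "2 * X + mem s (X + j) < 2 ^ w" if "mem s (X + j) < regs s 5"
    using that len words by linarith
  show ?thesis
    using ws w2
    by (auto simp: member_def r j member_iff[OF s(2) j(2)] keeps_def)
qed

lemma W_report_doc: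
  assumes s: "params s" "marks s" "stack ys s" and i: "regs s 23 = i" "i < n"
    and new: "da i + 1 \<notin> set (reported s)" "length (reported s) < n" and len: "length ys \<le> n"
  shows "W report_doc (\<lambda>u s'. u \<le> 80 * w + 12 + lt \<and> params s' \<and> marks s' \<and> stack ys s' \<and>
    reported s' = reported s @ [da i + 1] \<and> regs s' 23 = i + 1 \<and> regs s' 24 = regs s 24) s"
proof -
  let ?j = "da i" and ?k = "length (reported s)"
  have j: "?j < d" using da_less i by simp
  have jX: "?j < X" "?k < X" using j dn new nX by simp_all
  have ws: "X + ?j < 2 ^ w" "2 * X + ?k < 2 ^ w" "?k + 1 < 2 ^ w" "?j + 1 < 2 ^ w" "i + 1 < 2 ^ w" "?j < 2 ^ w" "?k < 2 ^ w"
    using j i dn new words by linarith+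
  let ?M = "(mem s)(X + ?j := ?k, 2 * X + ?k := ?j)"
  have hold: "holds_bits w ?M E"
    using s(1) ws by (intro holds_store) (auto simp: params_def ready_def)
  have mk: "marks s'" if "mem s' = ?M" "reported s' = reported s @ [?j + 1]" "regs s' 5 = ?k + 1" for s'
  proof -
    have *: "mem s (2 * X + q) < d" "reported s ! q = mem s (2 * X + q) + 1" "mem s (X + mem s (2 * X + q)) = q"
      if "q < ?k" for q using s(2) that by (auto simp: marks_def)
    \<comment> \<open>The new document is not in the list yet, so setting its pointer leaves those
      of the earlier entries intact.\<close>
    have ne: "mem s (2 * X + q) \<noteq> ?j" if "q < ?k" for q
      using *(2)[OF that] new(1) nth_mem[OF that] by metis
    have old: "?M (2 * X + q) = mem s (2 * X + q)" "?M (X + mem s (2 * X + q)) = q" if "q < ?k" for q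
      using *[OF that] ne[OF that] that jX dn nX by auto
    have new': "?M (2 * X + ?k) = ?j" "?M (X + ?j) = ?k" using jX by auto
    have "?M (2 * X + q) < d \<and> reported s' ! q = ?M (2 * X + q) + 1 \<and> ?M (X + ?M (2 * X + q)) = q"
      if q: "q < ?k + 1" for q
    proof (cases "q < ?k")
      case True
      then show ?thesis using old[OF True] *[OF True] that(1) \<open>reported s' = _\<close>
        by (simp add: nth_append del: fun_upd_apply)
    next
      case False
      then have "q = ?k" using q by simp
      then show ?thesis using new' j \<open>reported s' = _\<close> by (simp del: fun_upd_apply)
    qed
    then show ?thesis using that new(2) unfolding marks_def by simp
  qed
  have st: "stack ys s'" if "mem s' = ?M" "regs s' 4 = regs s 4" for s'
    using s(3) that jX len nX unfolding stack_def by auto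
  have r: "regs s 6 = X" "regs s 7 = 2 * X" "regs s 5 = ?k" using s by (simp_all add: params_def marks_def)
  have fin: "params s'' \<and> marks s'' \<and> stack ys s''"
    if "keeps {25, 26} s s'" "mem s'' = ?M" "reported s'' = reported s @ [?j + 1]" "regs s'' 5 = ?k + 1"
      "\<And>r. r < 19 \<Longrightarrow> r \<noteq> 5 \<Longrightarrow> regs s'' r = regs s' r" for s' s''
  proof (intro conjI mk st params_cong[OF s(1)])
    show "holds_bits w (mem s'') E" using hold that by simp
    have sr: "regs s'' r = regs s r" if "r < 19" "r \<noteq> 5" for r
      using \<open>keeps {25, 26} s s'\<close> that \<open>\<And>r. r < 19 \<Longrightarrow> r \<noteq> 5 \<Longrightarrow> regs s'' r = regs s' r\<close>[of r]
      by (auto simp: keeps_def)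
    then show "regs s'' 4 = regs s 4" by simp
    show "regs s'' r = regs s r" if "r < 19" "r \<noteq> 4" "r \<noteq> 5" for r using sr that by blast
  qed (use that in auto)
  have kp: "regs s' 6 = X" "regs s' 7 = 2 * X" "regs s' 5 = ?k" "regs s' 23 = i" "regs s' 24 = regs s 24"
    "mem s' = mem s" "reported s' = reported s" if "keeps {25, 26} s s'" for s'
    using that r i by (simp_all add: keeps_def)
  show ?thesis
    unfolding report_doc_def
    apply (simp only: block.simps W_Seq)
    apply (rule W_mono[OF W_get_doc[OF s(1) i]])
    apply (elim conjE)
    subgoal premises prems for u s'
    proof -
      note k = kp[OF prems(2)]
      show ?thesis
        using ws prems
        apply (simp add: k)
        apply (intro fin[OF prems(2), THEN conjunct1] fin[OF prems(2), THEN conjunct2, THEN conjunct1]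
            fin[OF prems(2), THEN conjunct2, THEN conjunct2] conjI)
                     apply (simp_all add: k)
        done
    qed
    done
qed

definition run_end :: "nat \<Rightarrow> nat" where
  "run_end k = (if k + 1 < \<rho> then rs (k + 1) else n)"

lemma pred_True: "R.pred_index True t i \<Longrightarrow> t < \<rho> \<Longrightarrow> i = t"
  by (auto simp: R.pred_index_def R.key_def intro: order.antisym)

text \<open>Among indices, the largest one not above \<open>t\<close> is \<open>t\<close> itself;
  this turns the predecessor query into a selection.\<close>

lemma W_select:
  assumes s: "params s" and T: "T < 50" "regs s T = t" "t < \<rho>"
  shows "W (pred True (Reg 10) (Reg 11) (Reg 12) (Reg T)) (\<lambda>u s'. u \<le> 80 * w \<and> same 50 s s' \<and>
    regs s' 64 = rs t) s"
proof (rule W_mono[OF R.W_pred[where t = t]])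
  fix u s' assume *: "u \<le> 80 * w \<and> same 50 s s' \<and> R.pred_index True t (regs s' 63) \<and> regs s' 64 = rs (regs s' 63)"
  then have "regs s' 63 = t" using pred_True T(3) by blast
  then show "u \<le> 80 * w \<and> same 50 s s' \<and> regs s' 64 = rs t" using * by simp
qed (use s T in \<open>simp_all add: params_def ready_def\<close>)

lemma W_run_bounds:
  assumes s: "params s" and k: "regs s 22 = k" "k < \<rho>"
  shows "W run_bounds (\<lambda>u s'. u \<le> 165 * w \<and> keeps {23, 24, 27} s s' \<and>
    regs s' 23 = max lo (rs k) \<and> regs s' 24 = min hi (run_end k)) s"
proof -
  have ws: "rs k < 2 ^ w" "k + 1 < 2 ^ w" "n < 2 ^ w" "hi < 2 ^ w" "lo < 2 ^ w"
    using R.an[OF k(2)] k rn words by linarith+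
  have ws': "rs (k + 1) < 2 ^ w" if "k + 1 < \<rho>" using R.an[OF that] words by linarith
  define c1 where "c1 = Cond (Less (Reg 23) (Reg 2)) (Op Add 23 (Reg 2) (Const 0)) Skip"
  define c2 where "c2 = Cond (Less (Reg 3) (Reg 24)) (Op Add 24 (Reg 3) (Const 0)) Skip"
  have clip: "W (Seq c1 c2) (\<lambda>u s''. u \<le> 4 \<and> keeps {23, 24} s' s'' \<and> regs s'' 23 = max lo (regs s' 23) \<and>
      regs s'' 24 = min hi (regs s' 24)) s'" if "regs s' 2 = lo" "regs s' 3 = hi" for s'
    unfolding c1_def c2_def using that ws by (auto simp: keeps_def max_def min_def)
  have r: "regs s 2 = lo" "regs s 3 = hi" "regs s 11 = \<rho>" "regs s 0 = n" using s by (simp_all add: params_def ready_def)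
  note sel1 = W_select[OF s _ k, simplified]
  define cc where "cc = Cond (Less (Reg 27) (Reg 11))
       (block [pred True (Reg 10) (Reg 11) (Reg 12) (Reg 27), Op Add 24 (Reg 64) (Const 0)])
       (Op Add 24 (Reg 0) (Const 0))"
  have br: "W cc (\<lambda>u s''. u \<le> 80 * w + 2 \<and> keeps {23, 24, 27} s s'' \<and> regs s'' 23 = rs k \<and> regs s'' 24 = run_end k)
     (set_reg 27 (k + 1) (set_reg 23 (rs k) s'))" if s': "same 50 s s'" for s'
  proof -
    have par: "params s'" using params_same[OF s s'] .
    have r': "regs s' 11 = \<rho>" "regs s' 0 = n" using same_reg[OF s'] r by simp_all
    let ?s = "set_reg 27 (k + 1) (set_reg 23 (rs k) s')"
    show ?thesis
    proof (cases "k + 1 < \<rho>")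
      case True
      have "W (pred True (Reg 10) (Reg 11) (Reg 12) (Reg 27)) (\<lambda>u s''. u \<le> 80 * w \<and> same 50 ?s s'' \<and>
        regs s'' 64 = rs (k + 1)) ?s"
        by (rule W_select) (use par True in simp_all)
      then show ?thesis
        using True ws'[OF True]
        apply (simp add: cc_def r')
        apply (erule W_mono)
        apply (use s' in \<open>auto simp: run_end_def keeps_def same_def\<close>)
        done
    next
      case False
      then show ?thesis using ws s' by (auto simp: cc_def r' run_end_def keeps_def same_def)
    qed
  qed
  show ?thesis
    unfolding run_bounds_def c1_def[symmetric] c2_def[symmetric] cc_def[symmetric]
    apply (simp only: block.simps W_Seq)
    apply (rule W_mono[OF sel1])
    apply (elim conjE)
    subgoal premises prems for u s'
    proof -
      have q: "regs s' 22 = k" using same_reg[OF prems(2)] k by simp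
      show ?thesis
        apply (simp add: prems(3) q ws)
        apply (rule W_mono[OF br[OF prems(2)]])
        apply (elim conjE)
        subgoal premises pr for u2 s2
        proof -
          have "regs s2 2 = lo" "regs s2 3 = hi" using pr(2) r by (simp_all add: keeps_def)
          from clip[OF this]
          show ?thesis
            apply (rule W_mono)
            using prems(1) pr w20 by (auto simp: keeps_def)
        qed
        done
    qed
    done
qed

end

section \<open>Cutting a range of runs at block boundaries\<close>

context listing
begin

lemma W_in_block_run:
  assumes s: "params s" and ab: "regs s 20 = a" "regs s 21 = b" "a < b" "b \<le> \<rho>" "b \<le> (a div w + 1) * w"
  shows "W (in_block (Reg 20) (Reg 21) (Reg 17)) (\<lambda>u s'. u \<le> 50 * w \<and> same 50 s s' \<and>
    Q.argmin_on a b (regs s' 51)) s"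
  by (rule Q.W_in_block) (use assms in \<open>simp_all add: params_def ready_def add_mult_distrib\<close>)

lemma W_choose_run:
  assumes s: "params s" "marks s" "stack ys s" "length ys \<le> n"
    and ab: "regs s 20 = a" "regs s 21 = b" "a < b" "b \<le> \<rho>"
  shows "W choose_run (\<lambda>u s'. u \<le> 50 * w + 30 \<and> params s' \<and> marks s' \<and> reported s' = reported s \<and>
    (\<exists>b'. a < b' \<and> b' \<le> b \<and> regs s' 20 = a \<and> regs s' 21 = b' \<and>
      stack (ys @ (if b' < b then [(b', b)] else [])) s' \<and> Q.argmin_on a b' (regs s' 22) \<and>
      (if b' < b then weight w (b', b) else 0) + 1 \<le> weight w (a, b))) s"
    (is "W _ ?Q s")
proof -
  let ?e = "(a div w + 1) * w"
  have wpos: "0 < w" using w20 by simp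
  have r: "regs s 1 = w" using s(1) by (simp add: params_def ready_def)
  have ae: "a < ?e" using dividend_less_div_times[OF wpos, of a] by (simp add: add_mult_distrib add.commute)
  have "a div w * w \<le> a" by (rule div_times_less_eq_dividend)
  then have ew: "?e < 2 ^ w" unfolding add_mult_distrib mult_1 using ab rn nX Xw ww by linarith
  have aw: "a div w + 1 < 2 ^ w" using div_le_dividend[of a w] ab rn words by linarith
  have bw: "b div w * w \<le> b" by (rule div_times_less_eq_dividend)
  have ws: "b < 2 ^ w" "b \<le> n" using ab rn words by linarith+
  define q1 where "q1 = block [
             Op Div 28 (Reg 21) (Reg 1),
             Op Mul 28 (Reg 28) (Reg 1),
             push (Reg 28) (Reg 21),
             Op Add 21 (Reg 28) (Const 0),
             block_range (Reg 20) (Reg 21) (Reg 18) (Reg 16)]"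
  define q2 where "q2 = block [
             push (Reg 26) (Reg 21),
             Op Add 21 (Reg 26) (Const 0),
             in_block (Reg 20) (Reg 21) (Reg 17)]"
  define R1 where "R1 = (\<lambda>u s'. u \<le> 50 * w + 20 \<and> params s' \<and> marks s' \<and> reported s' = reported s \<and>
    (\<exists>b'. a < b' \<and> b' \<le> b \<and> regs s' 20 = a \<and> regs s' 21 = b' \<and>
      stack (ys @ (if b' < b then [(b', b)] else [])) s' \<and> Q.argmin_on a b' (regs s' 51) \<and>
      (if b' < b then weight w (b', b) else 0) + 1 \<le> weight w (a, b)))"
  define cc where "cc = Cond (Less (Reg 26) (Reg 21))
       (block [
         Op Mod 27 (Reg 20) (Reg 1),
         Cond (Eq (Reg 27) (Const 0)) q1 q2])
       (in_block (Reg 20) (Reg 21) (Reg 17))"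
  let ?s = "set_reg 26 ?e (set_reg 26 (a div w + 1) (set_reg 26 (a div w) s))"
  have cond: "W cc (\<lambda>u. R1 (u)) ?s"
  proof (cases "?e < b")
    case False
    have "W (in_block (Reg 20) (Reg 21) (Reg 17)) (\<lambda>u s'. u \<le> 50 * w \<and> same 50 ?s s' \<and>
      Q.argmin_on a b (regs s' 51)) ?s"
      by (rule W_in_block_run) (use s ab False in simp_all)
    moreover have "weight w (a, b) = 1" using False by (simp add: weight_def)
    moreover have "R1 (Suc u) s'" if "u \<le> 50 * w \<and> same 50 ?s s' \<and> Q.argmin_on a b (regs s' 51)"
        "weight w (a, b) = 1" for u s'
    proof -
      have sm: "same 50 ?s s'" using that by simp
      have "params s'" "marks s'" "stack ys s'" "reported s' = reported s"
        using params_same[OF _ sm] marks_same[OF _ sm] stack_same[OF _ sm] s sm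
        by (simp_all add: same_def)
      moreover have "regs s' 20 = a" "regs s' 21 = b" using same_reg[OF sm] ab by simp_all
      ultimately show ?thesis unfolding R1_def using that ab by (intro conjI exI[of _ b]) simp_all
    qed
    ultimately show ?thesis
      using False unfolding cc_def by (simp add: ab) (erule W_mono, blast)
  next
    case spans: True
    show ?thesis
    proof (cases "a mod w = 0")
      case al: True
      let ?b = "b div w * w"
      have aw: "a = a div w * w" using al by auto
      have AK: "a div w < b div w" using spans wpos
        by (metis add.commute div_mult_self_is_m div_times_less_eq_dividend less_eq_div_iff_mult_less_eq
            less_iff_succ_less_eq less_imp_le)
      have KM: "b div w \<le> Q.M" using ab(4) by (rule div_le_mono)
      let ?s1 = "set_reg 28 ?b (set_reg 28 (b div w) (set_reg 27 0 ?s))"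
      have bb: "?b < 2 ^ w" "b div w < 2 ^ w" "?b \<le> n" using bw ws div_le_dividend[of b w] by linarith+
      have p: "W (push (Reg 28) (Reg 21)) (\<lambda>u s'. u \<le> 10 \<and> params s' \<and> marks s' \<and>
         stack (if ?b < b then ys @ [(?b, b)] else ys) s' \<and> reported s' = reported ?s1 \<and>
         (\<forall>r<40. r \<noteq> 4 \<longrightarrow> regs s' r = regs ?s1 r)) ?s1"
        by (rule W_push) (use s ab bb ws in simp_all)
      \<comment> \<open>If there is a rest, it begins at a boundary and ends in the same block; it
        weighs 1 and is the piece counted by \<open>b mod w \<noteq> 0\<close>.\<close>
      have wt: "(if ?b < b then weight w (?b, b) else 0) + 1 \<le> weight w (a, b)"
      proof (cases "?b < b")
        case True
        have "b mod w \<noteq> 0" using True by (metis less_irrefl mod_0_imp_dvd dvd_div_mult_self)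
        moreover have "b \<le> (?b div w + 1) * w"
          using dividend_less_div_times[OF wpos, of b] wpos by (simp add: add_mult_distrib add.commute)
        ultimately show ?thesis using True spans by (simp add: weight_def)
      next
        case False
        then show ?thesis by (simp add: weight_def)
      qed
      have lt: "a < ?b" using mult_less_mono1[OF AK wpos] aw by linarith
      show ?thesis
        unfolding cc_def
        apply (simp add: ab spans r al)
        unfolding q1_def
        apply (simp add: ab r bb)
        apply (rule W_mono[OF p])
        apply (elim conjE)
        subgoal premises pr for u s'
        proof -
          have q: "regs s' 20 = a" "regs s' 28 = ?b" using pr(6) ab by simp_all
          let ?s2 = "set_reg 21 ?b s'"
          have "W (block_range (Reg 20) (Reg 21) (Reg 18) (Reg 16)) (\<lambda>u s''. u \<le> 50 * w \<and>
              same 50 ?s2 s'' \<and> Q.argmin_on (a div w * w) ?b (regs s'' 51)) ?s2"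
            by (rule Q.W_block_range[OF _ _ _ _ _ _ _ _ _ AK KM])
              (use pr(2) q aw in \<open>simp_all add: params_def ready_def\<close>)
          then show ?thesis
            using bb
            apply (simp add: q)
            apply (erule W_mono)
            subgoal premises prems for u2 s3
            proof -
              have sm: "same 50 ?s2 s3" and am: "Q.argmin_on a ?b (regs s3 51)" and u2: "u2 \<le> 50 * w"
                using prems aw by simp_all
              have "params s3" "marks s3" "stack (ys @ (if ?b < b then [(?b, b)] else [])) s3" "reported s3 = reported s"
                using params_same[OF _ sm] marks_same[OF _ sm] stack_same[OF _ sm] sm pr
                by (simp_all add: same_def split: if_splits)
              moreover have "regs s3 20 = a" "regs s3 21 = ?b" using same_reg[OF sm] q by simp_all
              ultimately show ?thesis
                unfolding R1_def using am lt bw wt u2 pr(1) by (intro conjI exI[of _ ?b]) simp_all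
            qed
            done
        qed
        done
    next
      case al: False
      let ?s1 = "set_reg 27 (a mod w) ?s"
      have p: "W (push (Reg 26) (Reg 21)) (\<lambda>u s'. u \<le> 10 \<and> params s' \<and> marks s' \<and>
         stack (if ?e < b then ys @ [(?e, b)] else ys) s' \<and> reported s' = reported ?s1 \<and>
         (\<forall>r<40. r \<noteq> 4 \<longrightarrow> regs s' r = regs ?s1 r)) ?s1"
        by (rule W_push) (use s ab spans ws in simp_all)
      \<comment> \<open>The rest begins at a boundary, so the summand for an unaligned left end is
        freed.\<close>
      have wt: "weight w (?e, b) + 1 \<le> weight w (a, b)"
        using spans al by (auto simp: weight_def)
      show ?thesis
        unfolding cc_def
        apply (simp add: ab spans r al)
        unfolding q2_def
        apply (simp add: ab r)
        apply (rule W_mono[OF p])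
        apply (elim conjE)
        subgoal premises pr for u s'
        proof -
          have q: "regs s' 20 = a" "regs s' 26 = ?e" using pr(6) ab by simp_all
          let ?s2 = "set_reg 21 ?e s'"
          have "W (in_block (Reg 20) (Reg 21) (Reg 17)) (\<lambda>u s''. u \<le> 50 * w \<and>
              same 50 ?s2 s'' \<and> Q.argmin_on a ?e (regs s'' 51)) ?s2"
            by (rule W_in_block_run) (use pr(2) q ae spans ab in simp_all)
          then show ?thesis
            using ew
            apply (simp add: q)
            apply (erule W_mono)
            subgoal premises prems for u2 s3
            proof -
              have sm: "same 50 ?s2 s3" and am: "Q.argmin_on a ?e (regs s3 51)" and u2: "u2 \<le> 50 * w"
                using prems by simp_all
              have "params s3" "marks s3" "stack (ys @ (if ?e < b then [(?e, b)] else [])) s3" "reported s3 = reported s"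
                using params_same[OF _ sm] marks_same[OF _ sm] stack_same[OF _ sm] sm pr spans
                by (simp_all add: same_def split: if_splits)
              moreover have "regs s3 20 = a" "regs s3 21 = ?e" using same_reg[OF sm] q by simp_all
              ultimately show ?thesis
                unfolding R1_def using am ae spans wt u2 pr(1) by (intro conjI exI[of _ ?e]) simp_all
            qed
            done
        qed
        done
    qed
  qed
  show ?thesis
    unfolding choose_run_def q1_def[symmetric] q2_def[symmetric] cc_def[symmetric]
    using ew aw
    apply (simp add: ab r)
    apply (rule W_mono[OF cond])
    unfolding R1_def
    apply (elim conjE exE)
    subgoal premises prems for u s' b'
    proof -
      have "regs s' 51 < b'" using prems by (simp add: Q.argmin_on_def)
      then have "regs s' 51 < 2 ^ w" using prems ws by linarith
      then show ?thesis using prems by (auto simp: stack_def split: if_splits)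
    qed
    done
qed

section \<open>First occurrences and the ranges of runs that are still open\<close>

definition fresh :: "nat \<Rightarrow> bool" where
  "fresh i \<longleftrightarrow> lo \<le> i \<and> i < hi \<and> da i \<notin> da ` {lo..<i}"

definition run_of :: "nat \<Rightarrow> nat" where
  "run_of i = Max {k. k < \<rho> \<and> rs k \<le> i}"

definition covered :: "(nat \<times> nat) list \<Rightarrow> nat \<Rightarrow> bool" where
  "covered ys k \<longleftrightarrow> (\<exists>(a, b)\<in>set ys. a \<le> k \<and> k < b)"

definition queue :: "(nat \<times> nat) list \<Rightarrow> bool" where
  "queue ys \<longleftrightarrow> sorted_wrt (\<lambda>(a, b) (a', b'). b' \<le> a) ys \<and>
     (\<forall>(a, b)\<in>set ys. run_of lo \<le> a \<and> a < b \<and> b \<le> run_of (hi - 1) + 1)"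

text \<open>
  The documents reported so far are those whose first occurrence lies in a run that is no longer
  on the stack; the leftmost range is on top of the stack, so everything to its left is done.
\<close>

definition reported_ok :: "(nat \<times> nat) list \<Rightarrow> nat list \<Rightarrow> bool" where
  "reported_ok ys rep \<longleftrightarrow> distinct rep \<and> set rep = (\<lambda>i. da i + 1) ` {i. fresh i \<and> \<not> covered ys (run_of i)}"

lemma pred_run_of: "R.pred_index False i (run_of i)"
proof -
  let ?S = "{k. k < \<rho> \<and> rs k \<le> i}"
  have "0 \<in> ?S" using R.N R.a0 by simp
  then have "run_of i \<in> ?S" unfolding run_of_def by (intro Max_in) auto
  moreover have "k \<le> run_of i" if "k \<in> ?S" for k
    unfolding run_of_def by (rule Max_ge) (use that in auto)
  ultimately show ?thesis by (auto simp: R.pred_index_def R.key_def)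
qed

lemma run_of_eq_iff: assumes "i < n" "k < \<rho>" shows "run_of i = k \<longleftrightarrow> rs k \<le> i \<and> i < run_end k"
proof -
  have r: "run_of i < \<rho>" "rs (run_of i) \<le> i" "\<And>k. k < \<rho> \<Longrightarrow> rs k \<le> i \<Longrightarrow> k \<le> run_of i"
    using pred_run_of[of i] by (auto simp: R.pred_index_def R.key_def)
  show ?thesis
  proof
    assume k: "run_of i = k"
    then show "rs k \<le> i \<and> i < run_end k"
      using r(2) r(3)[of "k + 1"] assms by (auto simp: run_end_def not_le[symmetric])
  next
    assume *: "rs k \<le> i \<and> i < run_end k"
    then have "k \<le> run_of i" using r(3) assms by blast
    moreover have "\<not> k < run_of i"
    proof
      assume "k < run_of i"
      then have "k + 1 \<le> run_of i" by simp
      then have "k + 1 < \<rho>" "rs (k + 1) \<le> rs (run_of i)" using r(1) R.mono_le by simp_all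
      then show False using * r(2) by (simp add: run_end_def)
    qed
    ultimately show "run_of i = k" by simp
  qed
qed

lemma run_of_less: "run_of i < \<rho>"
  using pred_run_of by (auto simp: R.pred_index_def)

lemma run_of_mono: "i \<le> j \<Longrightarrow> run_of i \<le> run_of j"
  using pred_run_of[of i] pred_run_of[of j] by (auto simp: R.pred_index_def R.key_def)

lemma fresh_iff: "lo \<le> i \<Longrightarrow> i < hi \<Longrightarrow> fresh i \<longleftrightarrow> V (run_of i) < m"
  using first[OF _ _ pred_run_of] by (simp add: fresh_def)

lemma fresh_inj: "fresh i \<Longrightarrow> fresh j \<Longrightarrow> da i = da j \<Longrightarrow> i = j"
  unfolding fresh_def by (metis atLeastLessThan_iff imageI linorder_neqE_nat)

lemma ex_fresh:
  assumes "lo \<le> i" "i < hi" obtains j where "fresh j" "j \<le> i" "da j = da i"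
proof -
  define j where "j = (LEAST j. lo \<le> j \<and> da j = da i)"
  have j: "lo \<le> j \<and> da j = da i" unfolding j_def by (rule LeastI[of _ i]) (use assms in simp)
  have ji: "j \<le> i" unfolding j_def by (rule Least_le) (use assms in simp)
  have "da q \<noteq> da j" if "lo \<le> q" "q < j" for q
    using not_less_Least[of q "\<lambda>j. lo \<le> j \<and> da j = da i"] that j by (auto simp: j_def)
  then have "da j \<notin> da ` {lo..<j}" by (metis atLeastLessThan_iff imageE)
  then have "fresh j" using j ji assms by (simp add: fresh_def)
  then show ?thesis using that j ji by blast
qed

lemma covered_simps [simp]:
  "covered [] k = False"
  "covered (xs @ ys) k \<longleftrightarrow> covered xs k \<or> covered ys k"
  "covered [(a, b)] k \<longleftrightarrow> a \<le> k \<and> k < b"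
  by (auto simp: covered_def)

lemma queue_snoc: "queue (ys @ [(a, b)]) \<longleftrightarrow> queue ys \<and> (\<forall>(a', b')\<in>set ys. b \<le> a') \<and>
    run_of lo \<le> a \<and> a < b \<and> b \<le> run_of (hi - 1) + 1"
  by (auto simp: queue_def sorted_wrt_append)

text \<open>The ranges are disjoint and nonempty, so their left ends are distinct runs. This bounds
  the stack, which therefore fits between the other work areas.\<close>

lemma queue_length: assumes "queue ys" shows "length ys \<le> \<rho>"
proof -
  have "sorted_wrt (\<lambda>x y. fst y < fst x) ys"
    using assms unfolding queue_def
    by (auto intro!: sorted_wrt_mono_rel[of ys "\<lambda>(a, b) (a', b'). b' \<le> a"])
  then have "distinct (map fst ys)" by (induction ys) auto
  moreover have "set (map fst ys) \<subseteq> {..<\<rho>}"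
    using assms run_of_less[of "hi - 1"] unfolding queue_def by fastforce
  ultimately show ?thesis
    by (metis card_mono distinct_card finite_lessThan card_lessThan length_map)
qed

section \<open>One step: the window from \<open>a\<close> to \<open>b'\<close> of the topmost range,
  with a minimum at \<open>k\<close>\<close>

context
  fixes ys rep a b b' k
  assumes q: "queue (ys @ [(a, b)])" and dn: "reported_ok (ys @ [(a, b)]) rep"
    and b': "a < b'" "b' \<le> b" and k: "Q.argmin_on a b' k"
begin

definition "rest_stack = ys @ (if b' < b then [(b', b)] else [])"
definition "run_first = max lo (rs k)"
definition "run_stop = min hi (run_end k)"

lemma zs_queue: "queue rest_stack" "\<And>x y. (x, y) \<in> set rest_stack \<Longrightarrow> b' \<le> x"
  using q b' by (auto simp: rest_stack_def queue_snoc)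

lemma zs_covered: "covered (ys @ [(a, b)]) i \<longleftrightarrow> covered rest_stack i \<or> (a \<le> i \<and> i < b')"
  using b' by (auto simp: rest_stack_def)

lemma not_covered: "i < b' \<Longrightarrow> \<not> covered rest_stack i"
  using zs_queue(2) by (fastforce simp: covered_def)

lemma k_bounds: "a \<le> k" "k < b'" "k < \<rho>" "run_of lo \<le> k" "k \<le> run_of (hi - 1)"
  using k q b' run_of_less[of "hi - 1"] by (auto simp: Q.argmin_on_def queue_snoc)

lemma V_min: "a \<le> i \<Longrightarrow> i < b' \<Longrightarrow> V k \<le> V i"
  using k by (simp add: Q.argmin_on_def)

lemma in_run: "run_first \<le> i \<and> i < run_stop \<longleftrightarrow> lo \<le> i \<and> i < hi \<and> run_of i = k"
  using run_of_eq_iff[of i k] k_bounds(3) lohi by (auto simp: run_first_def run_stop_def)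

text \<open>Run \<open>k\<close> lies between the runs of \<open>lo\<close> and
  \<open>hi - 1\<close>, so it meets the interval and its clipped part has a first row to be
  tested.\<close>

lemma run_nonempty: "run_first < run_stop"
proof -
  have "rs k \<le> rs (run_of (hi - 1))" using k_bounds(5) run_of_less by (rule R.mono_le)
  also have "\<dots> \<le> hi - 1" using pred_run_of[of "hi - 1"] by (simp add: R.pred_index_def R.key_def)
  finally have 1: "rs k < hi" using lohi by simp
  have 2: "lo < run_end k"
  proof (cases "k + 1 < \<rho>")
    case True
    show ?thesis
    proof (rule ccontr)
      assume "\<not> lo < run_end k"
      then have "rs (k + 1) \<le> lo" using True by (simp add: run_end_def)
      then have "k + 1 \<le> run_of lo" using pred_run_of[of lo] True by (simp add: R.pred_index_def R.key_def)
      then show False using k_bounds(4) by simp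
    qed
  next
    case False
    then show ?thesis using lohi by (simp add: run_end_def)
  qed
  have "rs k < run_end k"
    using R.mono[of k "k + 1"] R.an[OF k_bounds(3)] by (simp add: run_end_def)
  then show ?thesis using 1 2 lohi by (simp add: run_first_def run_stop_def)
qed

lemma st_in: "lo \<le> run_first" "run_first < hi" "run_of run_first = k" "run_first < n"
  using in_run[of run_first] run_nonempty lohi by auto

text \<open>If the first row of the clipped run were fresh, its document could only have been
  reported because of this row, but its run is still on the stack. So the minimum is at least
  \<open>m\<close>, and no row of the window is fresh.\<close>

lemma stop_case:
  assumes "da run_first + 1 \<in> set rep" shows "reported_ok rest_stack rep"
proof -
  obtain i where i: "fresh i" "\<not> covered (ys @ [(a, b)]) (run_of i)" "da i = da run_first"
    using assms dn by (auto simp: reported_ok_def)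
  have "\<not> fresh run_first"
  proof
    assume "fresh run_first"
    then have "i = run_first" using fresh_inj i by blast
    then show False using i(2)[unfolded zs_covered] st_in(3) k_bounds(1,2) by simp
  qed
  then have "\<not> V k < m" using fresh_iff[of run_first] st_in by simp
  then have "\<not> fresh i" if "a \<le> run_of i" "run_of i < b'" for i
    using fresh_iff[of i] V_min[OF that] by (auto simp: fresh_def)
  then have "{i. fresh i \<and> \<not> covered rest_stack (run_of i)} = {i. fresh i \<and> \<not> covered (ys @ [(a, b)]) (run_of i)}"
    using zs_covered by blast
  then show ?thesis using dn by (simp add: reported_ok_def)
qed

text \<open>If the minimum were at least \<open>m\<close>, the fresh row of the tested document
  would lie outside the window and not to its right, hence in a finished run to its left, and the
  document would have been reported. So the minimum is below \<open>m\<close>, the run yields new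
  documents only, and the parts of the window on both sides of it stay open.\<close>

lemma report_case:
  assumes new: "da run_first + 1 \<notin> set rep"
  defines "us \<equiv> rest_stack @ (if k + 1 < b' then [(k + 1, b')] else [])"
  defines "vs \<equiv> us @ (if a < k then [(a, k)] else [])"
  defines "rep' \<equiv> rep @ map (\<lambda>i. da i + 1) [run_first..<run_stop]"
  shows "queue us" "queue vs" "reported_ok vs rep'"
proof -
  have "V k < m"
  proof (rule ccontr)
    assume V: "\<not> V k < m"
    obtain i where i: "fresh i" "i \<le> run_first" "da i = da run_first" using ex_fresh st_in by blast
    have "\<not> (a \<le> run_of i \<and> run_of i < b')"
      using fresh_iff[of i] V_min[of "run_of i"] i(1) V by (auto simp: fresh_def)
    moreover have "run_of i < b'" using run_of_mono[OF i(2)] st_in(3) k_bounds(2) by simp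
    ultimately have "\<not> covered (ys @ [(a, b)]) (run_of i)"
      unfolding zs_covered using not_covered by blast
    then have "da i + 1 \<in> set rep" using dn i(1) by (auto simp: reported_ok_def)
    then show False using new i(3) by simp
  qed
  \<comment> \<open>All rows of a run share one value, so the whole clipped run is fresh and can be
    reported without further tests.\<close>
  then have fr: "fresh i \<longleftrightarrow> lo \<le> i \<and> i < hi" if "run_of i = k" for i
    using fresh_iff[of i] that by (auto simp: fresh_def)
  have in_fresh: "i \<in> {run_first..<run_stop} \<longleftrightarrow> fresh i \<and> run_of i = k" for i
    using in_run[of i] fr[of i] by auto
  show "queue us"
    using zs_queue k_bounds b' q unfolding us_def by (auto simp: queue_snoc)
  moreover have "k \<le> x" if "(x, y) \<in> set us" for x y
    using that zs_queue(2)[of x y] k_bounds(2) by (auto simp: us_def split: if_splits)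
  ultimately show "queue vs"
    using k_bounds q unfolding vs_def by (auto simp: queue_snoc)
  have cov: "covered (ys @ [(a, b)]) i \<longleftrightarrow> covered vs i \<or> i = k" "\<not> covered vs k" for i
    using k_bounds not_covered[of k] not_covered[of i] unfolding zs_covered vs_def us_def by auto
  have set: "{i. fresh i \<and> \<not> covered vs (run_of i)} =
      {i. fresh i \<and> \<not> covered (ys @ [(a, b)]) (run_of i)} \<union> {run_first..<run_stop}"
    using cov in_fresh by auto
  have "distinct (map (\<lambda>i. da i + 1) [run_first..<run_stop])"
    using fresh_inj in_fresh by (auto simp: distinct_map inj_on_def)
  moreover have "da i + 1 \<notin> set rep" if "i \<in> {run_first..<run_stop}" for i
  proof
    assume "da i + 1 \<in> set rep"
    then obtain j where "fresh j" "\<not> covered (ys @ [(a, b)]) (run_of j)" "da j = da i"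
      using dn by (auto simp: reported_ok_def)
    moreover have "fresh i" "run_of i = k" using that in_fresh by blast+
    ultimately show False using fresh_inj cov(1) by metis
  qed
  moreover have "distinct rep" using dn by (simp add: reported_ok_def)
  ultimately have "distinct rep'"
    unfolding rep'_def distinct_append by auto
  moreover have "set rep' = set rep \<union> (\<lambda>i. da i + 1) ` {run_first..<run_stop}" by (simp add: rep'_def)
  ultimately show "reported_ok vs rep'"
    using dn unfolding reported_ok_def set image_Un by simp
qed

end

end

text \<open>The part to the right of the run is pushed before the part to its left, which keeps the
  leftmost range on top.\<close>

definition list_step :: com where
  "list_step = block [
     Op Sub 4 (Reg 4) (Const 1),
     Op Add 40 (Reg 8) (Reg 4),
     Load 20 (Reg 40),
     Op Add 40 (Reg 9) (Reg 4),
     Load 21 (Reg 40),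
     choose_run,
     run_bounds,
     get_doc,
     member,
     Cond (Eq (Reg 28) (Const 1)) Skip (block [
       Op Add 27 (Reg 22) (Const 1),
       push (Reg 27) (Reg 21),
       push (Reg 20) (Reg 22),
       While (Less (Reg 23) (Reg 24)) report_doc])]"

definition start_list :: com where
  "start_list = block [
     pred False (Reg 10) (Reg 11) (Reg 12) (Reg 2),
     Op Add 20 (Reg 63) (Const 0),
     Op Sub 26 (Reg 3) (Const 1),
     pred False (Reg 10) (Reg 11) (Reg 12) (Reg 26),
     Op Add 21 (Reg 63) (Const 1),
     Op Add 4 (Const 0) (Const 0),
     Op Add 5 (Const 0) (Const 0),
     push (Reg 20) (Reg 21),
     While (Less (Const 0) (Reg 4)) list_step]"

section \<open>Amortised analysis of the main loop\<close>

context listing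
begin

lemma keeps_marks: "keeps S s s' \<Longrightarrow> 5 \<notin> S \<Longrightarrow> marks s \<Longrightarrow> marks s'"
  by (simp add: keeps_def marks_def)

lemma keeps_stack: "keeps S s s' \<Longrightarrow> 4 \<notin> S \<Longrightarrow> stack ys s \<Longrightarrow> stack ys s'"
  by (simp add: keeps_def stack_def)

lemma W_report_loop:
  assumes s: "params s" "marks s" "stack ys s" "length ys \<le> n"
    and r: "regs s 23 = i0" "regs s 24 = e" "i0 \<le> e" "e \<le> n"
    and new: "distinct (reported s @ map (\<lambda>i. da i + 1) [i0..<e])"
      "length (reported s @ map (\<lambda>i. da i + 1) [i0..<e]) \<le> n"
  shows "W (While (Less (Reg 23) (Reg 24)) report_doc) (\<lambda>u s'. u \<le> (80 * w + 13 + lt) * (e - i0) + 1 \<and>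
    params s' \<and> marks s' \<and> stack ys s' \<and> reported s' = reported s @ map (\<lambda>i. da i + 1) [i0..<e]) s"
proof (rule W_mono[OF W_While[where \<phi> = "(80 * w + 13 + lt) * (e - i0)" and
      I = "\<lambda>\<phi> s'. \<exists>i. \<phi> = (80 * w + 13 + lt) * (e - i) \<and> i0 \<le> i \<and> i \<le> e \<and> regs s' 23 = i \<and> regs s' 24 = e \<and>
        params s' \<and> marks s' \<and> stack ys s' \<and> reported s' = reported s @ map (\<lambda>i. da i + 1) [i0..<i]"]], goal_cases)
  case 1
  show ?case using s r by (intro exI[of _ i0]) simp
next
  case (2 \<phi> s')
  then obtain i where i: "\<phi> = (80 * w + 13 + lt) * (e - i)" "i0 \<le> i" "regs s' 23 = i" "regs s' 24 = e"
      "params s'" "marks s'" "stack ys s'" "reported s' = reported s @ map (\<lambda>i. da i + 1) [i0..<i]" by blast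
  have ie: "i < e" using 2(2) i by simp
  have up: "[i0..<e] = [i0..<i] @ i # [Suc i..<e]"
    using upt_add_eq_append[OF i(2), of "e - i"] upt_conv_Cons[OF ie] ie by simp
  have 3: "da i + 1 \<notin> set (reported s')" "length (reported s') < n"
    using new ie i(2) unfolding up i(8) by auto
  show ?case
  proof (rule W_mono[OF W_report_doc[OF i(5-7,3) _ 3 s(4)]])
    show "i < n" using ie r by simp
    fix u s'' assume u: "u \<le> 80 * w + 12 + lt \<and> params s'' \<and> marks s'' \<and> stack ys s'' \<and>
      reported s'' = reported s' @ [da i + 1] \<and> regs s'' 23 = i + 1 \<and> regs s'' 24 = regs s' 24"
    have "e - i = Suc (e - (i + 1))" using ie by simp
    then have "Suc u + (80 * w + 13 + lt) * (e - (i + 1)) \<le> \<phi>" using u i(1) by simp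
    moreover have "reported s'' = reported s @ map (\<lambda>i. da i + 1) [i0..<i + 1]"
      using u i(8) upt_Suc_append[OF i(2), unfolded Suc_eq_plus1] by simp
    ultimately show "\<exists>\<phi>'. Suc u + \<phi>' \<le> \<phi> \<and> (\<exists>i. \<phi>' = (80 * w + 13 + lt) * (e - i) \<and> i0 \<le> i \<and> i \<le> e \<and>
      regs s'' 23 = i \<and> regs s'' 24 = e \<and> params s'' \<and> marks s'' \<and> stack ys s'' \<and>
      reported s'' = reported s @ map (\<lambda>i. da i + 1) [i0..<i])"
      using u i(2,4) ie by (intro exI[of _ "(80 * w + 13 + lt) * (e - (i + 1))"] conjI exI[of _ "i + 1"]) simp_all
  qed
next
  case (3 u s')
  then obtain i where i: "u \<le> (80 * w + 13 + lt) * (e - i0) + 1" "i0 \<le> i" "i \<le> e" "regs s' 23 = i" "regs s' 24 = e"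
      "params s'" "marks s'" "stack ys s'" "reported s' = reported s @ map (\<lambda>i. da i + 1) [i0..<i]"
      "\<not> test_val w s' (Less (Reg 23) (Reg 24))" by auto
  then have "i = e" by simp
  then show ?case using i by simp
qed

definition main_inv :: "(nat \<times> nat) list \<Rightarrow> state \<Rightarrow> bool" where
  "main_inv ys s \<longleftrightarrow> params s \<and> marks s \<and> stack ys s \<and> queue ys \<and> reported_ok ys (reported s)"

definition df :: nat where
  "df = card (da ` {lo..<hi})"

text \<open>The factor 7 is chosen for steps that report \<open>D \<ge> 1\<close> documents: they
  free \<open>7 * D + 1\<close>, pay at most 6 for two new ranges of weight at most 3, and keep
  \<open>7 * D - 5\<close>, which is at least the \<open>D + 1\<close> units of time they are
  charged. A step without a report frees 1.\<close>

definition potential :: "(nat \<times> nat) list \<Rightarrow> nat list \<Rightarrow> nat" where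
  "potential ys rep = sum_list (map (weight w) ys) + 7 * (df - length rep)"

text \<open>One unit covers one report, or the fixed part of a step: \<open>50 * w\<close> for the
  range minimum, \<open>165 * w\<close> for the bounds of the run, \<open>80 * w\<close> and a
  lookup for the tested document, and a constant absorbed by the remaining
  \<open>15 * w\<close>.\<close>

definition unit_time :: nat where
  "unit_time = 310 * w + lt"

lemma reported_le: assumes "reported_ok ys rep" shows "length rep \<le> df" "length rep \<le> n"
proof -
  have "set rep \<subseteq> (\<lambda>j. j + 1) ` da ` {lo..<hi}"
    using assms by (auto simp: reported_ok_def fresh_def)
  then have "card (set rep) \<le> card ((\<lambda>j. j + 1) ` da ` {lo..<hi})" by (intro card_mono) auto
  also have "\<dots> = df" unfolding df_def by (rule card_image) (simp add: inj_on_def)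
  finally show 1: "length rep \<le> df" using assms distinct_card by (fastforce simp: reported_ok_def)
  have "df \<le> card {lo..<hi}" unfolding df_def by (rule card_image_le) simp
  then show "length rep \<le> n" using 1 lohi by simp
qed

lemma W_list_step:
  assumes "main_inv (ys @ [(a, b)]) s"
  shows "W list_step (\<lambda>u s'. \<exists>ys'. main_inv ys' s' \<and>
    Suc u + unit_time * potential ys' (reported s') \<le> unit_time * potential (ys @ [(a, b)]) (reported s)) s"
    (is "W _ ?Q s")
proof -
  have s: "params s" "marks s" "stack (ys @ [(a, b)]) s" and q: "queue (ys @ [(a, b)])"
    and ok: "reported_ok (ys @ [(a, b)]) (reported s)" using assms by (simp_all add: main_inv_def)
  let ?k = "length ys" and ?rep = "reported s"
  have ylen: "?k < n" using queue_length[OF q] rn by simp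
  have ab: "a < b" "b \<le> \<rho>" using q run_of_less[of "hi - 1"] by (auto simp: queue_snoc)
  have r: "regs s 4 = ?k + 1" "regs s 8 = 3 * X" "regs s 9 = 4 * X"
      "mem s (3 * X + ?k) = a" "mem s (4 * X + ?k) = b"
    using s by (auto simp: stack_def params_def nth_append)
  have ws: "?k + 1 < 2 ^ w" "3 * X + ?k < 2 ^ w" "4 * X + ?k < 2 ^ w" using ylen words by linarith+
  let ?s1 = "set_reg 21 b (set_reg 40 (4 * X + ?k) (set_reg 20 a (set_reg 40 (3 * X + ?k) (set_reg 4 ?k s))))"
  have st1: "stack ys ?s1" using s(3) by (auto simp: stack_def nth_append)
  have choose: "W choose_run (\<lambda>u s'. u \<le> 50 * w + 30 \<and> params s' \<and> marks s' \<and> reported s' = ?rep \<and>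
    (\<exists>b'. a < b' \<and> b' \<le> b \<and> regs s' 20 = a \<and> regs s' 21 = b' \<and>
      stack (ys @ (if b' < b then [(b', b)] else [])) s' \<and> Q.argmin_on a b' (regs s' 22) \<and>
      (if b' < b then weight w (b', b) else 0) + 1 \<le> weight w (a, b))) ?s1"
    using W_choose_run[of ?s1 ys a b] s st1 ylen ab by simp
  define tail where "tail = Cond (Eq (Reg 28) (Const 1)) Skip (block [
       Op Add 27 (Reg 22) (Const 1),
       push (Reg 27) (Reg 21),
       push (Reg 20) (Reg 22),
       While (Less (Reg 23) (Reg 24)) report_doc])"
  have main: "W (Seq run_bounds (Seq get_doc (Seq member tail))) (\<lambda>u s'. \<exists>ys'. main_inv ys' s' \<and>
      u + 50 * w + 40 + unit_time * potential ys' (reported s') \<le> unit_time * potential (ys @ [(a, b)]) ?rep) s2"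
    if s2: "params s2" "marks s2" "reported s2 = ?rep" "a < b'" "b' \<le> b" "regs s2 20 = a" "regs s2 21 = b'"
      "stack (ys @ (if b' < b then [(b', b)] else [])) s2" "Q.argmin_on a b' (regs s2 22)"
      "(if b' < b then weight w (b', b) else 0) + 1 \<le> weight w (a, b)" for s2 b'
  proof -
    obtain k where k: "regs s2 22 = k" by simp
    note am = s2(9)[unfolded k]
    note ctx = q ok s2(4,5) am
    let ?zs = "rest_stack ys b b'" and ?i0 = "run_first k" and ?e = "run_stop k"
    have zs: "?zs = ys @ (if b' < b then [(b', b)] else [])" by (simp add: rest_stack_def[OF ctx])
    note kb = k_bounds[OF ctx]
    note st_in' = st_in[OF ctx]
    have e_n: "?e \<le> n" using lohi by (simp add: run_stop_def[OF ctx])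
    have ne: "?i0 < ?e" by (rule run_nonempty[OF ctx])
    have pot: "potential (ys @ [(a, b)]) ?rep \<ge> sum_list (map (weight w) ?zs) + 1 + 7 * (df - length ?rep)"
      using s2(10) by (auto simp: potential_def zs split: if_splits)
    show ?thesis
      apply (simp only: W_Seq)
      apply (rule W_mono[OF W_run_bounds[OF s2(1) k kb(3)]])
      apply (elim conjE)
      subgoal premises p3 for u3 s3
      proof -
        have par3: "params s3" by (rule keeps_params[OF p3(2) _ s2(1)]) auto
        have i3: "regs s3 23 = ?i0" "regs s3 24 = ?e" using p3 by (simp_all add: run_first_def[OF ctx] run_stop_def[OF ctx])
        show ?thesis
          apply (simp only: W_Seq)
          apply (rule W_mono[OF W_get_doc[OF par3 i3(1) st_in'(4)]])
          apply (elim conjE)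
          subgoal premises p4 for u4 s4
          proof -
            have par4: "params s4" by (rule keeps_params[OF p4(2) _ par3]) auto
            have mk4: "marks s4" by (rule keeps_marks[OF p4(2) _ keeps_marks[OF p3(2) _ s2(2)]]) auto
            have rep4: "reported s4 = ?rep" using p3(2) p4(2) s2(3) by (simp add: keeps_def)
            show ?thesis
              apply (simp only: W_Seq)
              apply (rule W_mono[OF W_member[OF par4 mk4 p4(3) da_less[OF st_in'(4)]]])
              apply (elim conjE)
              subgoal premises p5 for u5 s5
              proof -
                have par5: "params s5" by (rule keeps_params[OF p5(2) _ par4]) auto
                have mk5: "marks s5" by (rule keeps_marks[OF p5(2) _ mk4]) auto
                have rep5: "reported s5 = ?rep" using p5(2) rep4 by (simp add: keeps_def)
                have st5: "stack ?zs s5"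
                  using s2(8) unfolding zs
                  by (intro keeps_stack[OF p5(2)] keeps_stack[OF p4(2)] keeps_stack[OF p3(2)]) auto
                have r5: "regs s5 20 = a" "regs s5 21 = b'" "regs s5 22 = k" "regs s5 23 = ?i0" "regs s5 24 = ?e"
                  using p3(2) p4(2) p5(2) s2 k i3 by (simp_all add: keeps_def)
                have time: "u3 + (u4 + u5) \<le> 245 * w + 14 + lt" using p3(1) p4(1) p5(1) by linarith
                show ?thesis
                proof (cases "da ?i0 + 1 \<in> set ?rep")
                  case True
                  then have "regs s5 28 = 1" using p5(3) rep4 by simp
                  moreover have "main_inv ?zs s5"
                    using par5 mk5 st5 zs_queue(1)[OF ctx] stop_case[OF ctx True] rep5 by (simp add: main_inv_def)
                  moreover have "u3 + (u4 + (u5 + 2)) + 50 * w + 40 + unit_time * potential ?zs ?rep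
                      \<le> unit_time * potential (ys @ [(a, b)]) ?rep"
                  proof -
                    have "potential ?zs ?rep + 1 \<le> potential (ys @ [(a, b)]) ?rep"
                      using pot by (simp add: potential_def)
                    then have "unit_time * (potential ?zs ?rep + 1) \<le> unit_time * potential (ys @ [(a, b)]) ?rep"
                      by (rule mult_le_mono2)
                    moreover have "u3 + (u4 + (u5 + 2)) + 50 * w + 40 \<le> unit_time"
                      using time w20 by (simp add: unit_time_def)
                    ultimately show ?thesis by (simp add: add_mult_distrib2)
                  qed
                  ultimately show ?thesis
                    unfolding tail_def using rep5 by (auto simp: add.assoc intro!: exI[of _ ?zs])
                next
                  case new: False
                  define us where "us = ?zs @ (if k + 1 < b' then [(k + 1, b')] else [])"
                  define vs where "vs = us @ (if a < k then [(a, k)] else [])"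
                  define rep' where "rep' = ?rep @ map (\<lambda>i. da i + 1) [?i0..<?e]"
                  note rc = report_case[OF ctx new, folded us_def, folded vs_def rep'_def]
                  have f28: "regs s5 28 \<noteq> 1" using p5(3) rep4 new by simp
                  have lens: "length ?zs \<le> n" "length us \<le> n" "length vs \<le> n"
                    using queue_length[OF zs_queue(1)[OF ctx]] queue_length[OF rc(1)] queue_length[OF rc(2)] rn
                    by linarith+
                  have kn: "k + 1 \<le> n" "k + 1 < 2 ^ w" "b' \<le> n" "a \<le> n" using kb(3) rn s2(4,5) ab words by linarith+
                  let ?s6 = "set_reg 27 (k + 1) s5"
                  have push1: "W (push (Reg 27) (Reg 21)) (\<lambda>u s'. u \<le> 10 \<and> params s' \<and> marks s' \<and>
                     stack us s' \<and> reported s' = reported ?s6 \<and>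
                     (\<forall>r<40. r \<noteq> 4 \<longrightarrow> regs s' r = regs ?s6 r)) ?s6"
                    by (rule W_mono[OF W_push[where ys = ?zs and av = "k + 1" and bv = b']])
                      (use par5 mk5 st5 lens kn r5 in \<open>auto simp: us_def split: if_splits\<close>)
                  have t_new: "(80 * w + 13 + lt) * (?e - ?i0) + 50 * w + 80 + (245 * w + 14 + lt) +
                      unit_time * potential vs rep' \<le> unit_time * potential (ys @ [(a, b)]) ?rep"
                  proof -
                    let ?D = "?e - ?i0"
                    have D: "?D \<ge> 1" using ne by simp
                    have len': "length ?rep + ?D \<le> df" using reported_le(1)[OF rc(3)] by (simp add: rep'_def)
                    have sums: "sum_list (map (weight w) vs) \<le> sum_list (map (weight w) ?zs) + 6"
                      using weight_le[of w "(k + 1, b')"] weight_le[of w "(a, k)"]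
                      by (simp add: vs_def us_def)
                    have "potential vs rep' + (?D + 1) \<le> potential (ys @ [(a, b)]) ?rep"
                    proof -
                      have "7 * (df - length rep') + 7 * ?D = 7 * (df - length ?rep)"
                        using len' by (simp add: rep'_def)
                      then show ?thesis using pot sums D unfolding potential_def by linarith
                    qed
                    then have "unit_time * (potential vs rep' + (?D + 1)) \<le> unit_time * potential (ys @ [(a, b)]) ?rep"
                      by (rule mult_le_mono2)
                    moreover have "(80 * w + 13 + lt) * ?D + 50 * w + 80 + (245 * w + 14 + lt) \<le> unit_time * (?D + 1)"
                    proof -
                      have "(80 * w + 13 + lt) * ?D \<le> unit_time * ?D"
                        using w20 by (intro mult_le_mono1) (simp add: unit_time_def)
                      moreover have "50 * w + 80 + (245 * w + 14 + lt) \<le> unit_time" using w20 by (simp add: unit_time_def)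
                      ultimately show ?thesis unfolding add_mult_distrib2 mult_1_right by linarith
                    qed
                    ultimately show ?thesis unfolding add_mult_distrib2 by linarith
                  qed
                  show ?thesis
                    unfolding tail_def
                    using f28 kn
                    apply (simp add: r5)
                    apply (rule W_mono[OF push1])
                    apply (elim conjE)
                    subgoal premises p7 for u7 s7
                    proof -
                      have ss: "params s7" "marks s7" "stack us s7" "reported s7 = ?rep" "u7 \<le> 10"
                        "\<forall>r<40. r \<noteq> 4 \<longrightarrow> regs s7 r = regs ?s6 r" using p7 rep5 by simp_all
                      have r7: "regs s7 20 = a" "regs s7 22 = k" "regs s7 23 = ?i0" "regs s7 24 = ?e"
                        using ss(6) r5 by simp_all
                      have push2: "W (push (Reg 20) (Reg 22)) (\<lambda>u s'. u \<le> 10 \<and> params s' \<and> marks s' \<and>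
                         stack vs s' \<and> reported s' = reported s7 \<and>
                         (\<forall>r<40. r \<noteq> 4 \<longrightarrow> regs s' r = regs s7 r)) s7"
                        by (rule W_mono[OF W_push[where ys = us and av = a and bv = k]])
                          (use ss lens kn r7 in \<open>auto simp: vs_def split: if_splits\<close>)
                      show ?thesis
                        apply (simp only: W_Seq)
                        apply (rule W_mono[OF push2])
                        apply (elim conjE)
                        subgoal premises p8 for u8 s8
                        proof -
                          have r8: "regs s8 23 = ?i0" "regs s8 24 = ?e" "reported s8 = ?rep" using p8 r7 ss by simp_all
                          have dd: "distinct (reported s8 @ map (\<lambda>i. da i + 1) [?i0..<?e])"
                            "length (reported s8 @ map (\<lambda>i. da i + 1) [?i0..<?e]) \<le> n"
                            using rc(3) reported_le(2)[OF rc(3)] r8 by (simp_all add: reported_ok_def rep'_def)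
                          show ?thesis
                            apply (rule W_mono[OF W_report_loop[OF p8(2-4) lens(3) r8(1,2) less_imp_le[OF ne] e_n dd]])
                            apply (elim conjE)
                            subgoal premises p9 for u9 s9
                            proof -
                              have "main_inv vs s9" "reported s9 = rep'"
                                using p9 rc(2,3) r8(3) by (simp_all add: main_inv_def rep'_def)
                              then show ?thesis
                                using t_new time p9(1) p8(1) ss(5) by (intro exI[of _ vs]) simp
                            qed
                            done
                        qed
                        done
                    qed
                    done
                qed
              qed
              done
          qed
          done
      qed
      done
  qed
  show ?thesis
    unfolding list_step_def tail_def[symmetric]
    using ws
    apply (simp add: r)
    apply (rule W_mono[OF choose])
    apply (elim conjE exE)
    subgoal premises p for u2 s2 b'
      apply (rule W_mono[OF main[of s2 b']])
      using p apply simp_all[10]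
      apply (elim exE conjE)
      subgoal premises p' for u3 s3 ys'
        using p p' by (intro exI[of _ ys']) simp
      done
    done
qed

lemma W_list_loop:
  assumes "main_inv ys s"
  shows "W (While (Less (Const 0) (Reg 4)) list_step) (\<lambda>u s'.
    u \<le> unit_time * potential ys (reported s) + 1 \<and> main_inv [] s') s"
proof (rule W_mono[OF W_While[where \<phi> = "unit_time * potential ys (reported s)" and
      I = "\<lambda>\<phi> s'. \<exists>ys. \<phi> = unit_time * potential ys (reported s') \<and> main_inv ys s'"]], goal_cases)
  case 1 then show ?case using assms by blast
next
  case (2 \<phi> s')
  then obtain ys where ys: "\<phi> = unit_time * potential ys (reported s')" "main_inv ys s'" by blast
  then have "ys \<noteq> []" using 2(2) by (auto simp: main_inv_def stack_def)
  then obtain zs a b where zs: "ys = zs @ [(a, b)]" by (metis rev_exhaust surj_pair)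
  show ?case
    by (rule W_mono[OF W_list_step[OF ys(2)[unfolded zs]]]) (use ys(1) zs in blast)
next
  case (3 u s')
  then obtain ys' where ys': "u \<le> unit_time * potential ys (reported s) + 1" "main_inv ys' s'"
      "\<not> test_val w s' (Less (Const 0) (Reg 4))" by (metis (no_types, lifting) add_leD1)
  then have "ys' = []" by (auto simp: main_inv_def stack_def)
  then show ?case using ys' by simp
qed

text \<open>The first row of a document in the interval is fresh, so nothing is missing once no run
  is covered.\<close>

lemma reported_all: "reported_ok [] rep \<Longrightarrow> distinct rep \<and> set rep = (\<lambda>i. da i + 1) ` {lo..<hi}"
proof -
  assume r: "reported_ok [] rep"
  have "da ` {i. fresh i} = da ` {lo..<hi}"
  proof
    show "da ` {i. fresh i} \<subseteq> da ` {lo..<hi}" by (auto simp: fresh_def)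
    show "da ` {lo..<hi} \<subseteq> da ` {i. fresh i}"
    proof (rule image_subsetI)
      fix i assume "i \<in> {lo..<hi}"
      then obtain j where "fresh j" "da j = da i" using ex_fresh[of i] by auto
      then show "da i \<in> da ` {i. fresh i}" by (metis (mono_tags) image_eqI mem_Collect_eq)
    qed
  qed
  then have "(\<lambda>i. da i + 1) ` {i. fresh i} = (\<lambda>i. da i + 1) ` {lo..<hi}"
    by (simp only: image_image[of "\<lambda>j. j + 1" da, symmetric])
  then show ?thesis using r by (simp add: reported_ok_def)
qed

lemma W_pred_run:
  assumes s: "params s" and T: "T < 50" "regs s T = i" "i < n"
  shows "W (pred False (Reg 10) (Reg 11) (Reg 12) (Reg T)) (\<lambda>u s'. u \<le> 80 * w \<and> same 50 s s' \<and>
    regs s' 63 = run_of i) s"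
proof (rule W_mono[OF R.W_pred[where t = i]])
  fix u s' assume *: "u \<le> 80 * w \<and> same 50 s s' \<and> R.pred_index False i (regs s' 63) \<and> regs s' 64 = rs (regs s' 63)"
  then have "regs s' 63 = run_of i"
    using pred_run_of[of i] unfolding R.pred_index_def by (meson order.antisym)
  then show "u \<le> 80 * w \<and> same 50 s s' \<and> regs s' 63 = run_of i" using * by simp
qed (use s T in \<open>simp_all add: params_def ready_def\<close>)

lemma W_start_list:
  assumes s: "params s" "reported s = []"
  shows "W start_list (\<lambda>u s'. u \<le> unit_time * (11 * df) \<and> params s' \<and> distinct (reported s') \<and>
    set (reported s') = (\<lambda>i. da i + 1) ` {lo..<hi}) s"
proof -
  have l2: "regs s 2 = lo" "regs s 3 = hi" using s by (simp_all add: params_def)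
  let ?a = "run_of lo" and ?b = "run_of (hi - 1) + 1"
  have hi1: "lo \<le> hi - 1" using lohi by (auto simp: One_nat_def)
  then have ab: "?a < ?b" using run_of_mono[of lo "hi - 1"] by linarith
  have bn: "?a \<le> n" "?b \<le> n" using run_of_less[of lo] run_of_less[of "hi - 1"] rn by simp_all
  have ws: "?a < 2 ^ w" "?b < 2 ^ w" "hi < 2 ^ w" "1 \<le> hi" using bn words lohi by linarith+
  have df1: "df \<ge> 1" using lohi unfolding df_def by (simp add: Suc_le_eq card_gt_0_iff One_nat_def)
  define loop where "loop = While (Less (Const 0) (Reg 4)) list_step"
  have fin: "W (Seq (push (Reg 20) (Reg 21)) loop) (\<lambda>u s'. u \<le> 20 + unit_time * (10 * df) \<and> params s' \<and> distinct (reported s') \<and>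
    set (reported s') = (\<lambda>i. da i + 1) ` {lo..<hi}) s1"
    if s1: "params s1" "reported s1 = []" "regs s1 4 = 0" "regs s1 5 = 0" "regs s1 20 = ?a" "regs s1 21 = ?b" for s1
  proof -
    have mk: "marks s1" using s1 by (simp add: marks_def)
    have st: "stack [] s1" using s1 by (simp add: stack_def)
    have "run_of lo \<le> run_of i \<and> run_of i < ?b" if "fresh i" for i
    proof -
      have "lo \<le> i" "i \<le> hi - 1" using that by (auto simp: fresh_def One_nat_def)
      from run_of_mono[OF this(1)] run_of_mono[OF this(2)] show ?thesis by linarith
    qed
    then have ok: "reported_ok [(?a, ?b)] []"
      using covered_simps(3)[of ?a ?b] by (auto simp: reported_ok_def)
    have q: "queue [(?a, ?b)]" using ab by (simp add: queue_def)
    \<comment> \<open>The initial range weighs at most 3 and \<open>df\<close> is at least 1, so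
      \<open>3 + 7 * df\<close> is at most \<open>10 * df\<close>; an eleventh multiple of
      \<open>df\<close> later pays for the two predecessor queries of the setup.\<close>
    have "potential [(?a, ?b)] [] \<le> 10 * df"
      using weight_le[of w "(?a, ?b)"] df1 by (simp add: potential_def)
    then have pot: "unit_time * potential [(?a, ?b)] [] \<le> unit_time * (10 * df)" by (rule mult_le_mono2)
    show ?thesis
      apply (simp only: W_Seq)
      apply (rule W_mono[OF W_push[OF s1(1) mk st _ _ _ _ _ bn]])
      using s1 apply simp_all[7]
      apply (elim conjE)
      subgoal premises p for u2 s2
      proof -
        have "main_inv [(?a, ?b)] s2" using p ab q ok s1 by (simp add: main_inv_def)
        have rep2: "reported s2 = []" using p s1 by simp
        have "W loop (\<lambda>t s'. t \<le> unit_time * (10 * df) + 1 \<and> main_inv [] s') s2"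
          unfolding loop_def
        proof (rule W_mono[OF W_list_loop[OF \<open>main_inv _ s2\<close>]])
          fix t s' assume "t \<le> unit_time * potential [(?a, ?b)] (reported s2) + 1 \<and> main_inv [] s'"
          then show "t \<le> unit_time * (10 * df) + 1 \<and> main_inv [] s'"
            unfolding rep2 using pot by linarith
        qed
        then show ?thesis
          by (rule W_mono) (use p(1) reported_all in \<open>auto simp: main_inv_def\<close>)
      qed
      done
  qed
  show ?thesis
    unfolding start_list_def loop_def[symmetric]
    apply (simp only: block.simps W_Seq)
    apply (rule W_mono[OF W_pred_run[OF s(1) _ l2(1)]])
    using lohi apply simp_all[2]
    apply (elim conjE)
    subgoal premises p for u1 s1
    proof -
      have par1: "params s1" by (rule params_same[OF s(1) p(2)])
      have h1: "regs s1 3 = hi" using same_reg[OF p(2), of 3] l2 by simp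
      let ?s2 = "set_reg 26 (hi - 1) (set_reg 20 ?a s1)"
      have pr: "W (pred False (Reg 10) (Reg 11) (Reg 12) (Reg 26)) (\<lambda>u s'. u \<le> 80 * w \<and> same 50 ?s2 s' \<and>
          regs s' 63 = run_of (hi - 1)) ?s2"
        by (rule W_pred_run) (use par1 lohi in simp_all)
      show ?thesis
        apply (simp add: p(3) h1 ws)
        apply (rule W_mono[OF pr])
        apply (elim conjE)
        subgoal premises p2 for u2 s2
        proof -
          let ?s3 = "set_reg 5 0 (set_reg 4 0 (set_reg 21 ?b s2))"
          have par2: "params s2" by (rule params_same[OF _ p2(2)]) (use par1 in simp)
          have "W (Seq (push (Reg 20) (Reg 21)) loop) (\<lambda>u s'. u \<le> 20 + unit_time * (10 * df) \<and> params s' \<and> distinct (reported s') \<and>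
              set (reported s') = (\<lambda>i. da i + 1) ` {lo..<hi}) ?s3"
          proof (rule fin)
            show "params ?s3" using par2 by simp
            show "reported ?s3 = []" using p2(2) p(2) s(2) by (simp add: same_def)
            show "regs ?s3 20 = ?a" using same_reg[OF p2(2), of 20] by simp
          qed simp_all
          moreover have "unit_time * (10 * df) + 170 * w \<le> unit_time * (11 * df)"
          proof -
            have "170 * w \<le> unit_time * df" using df1 by (cases df) (simp_all add: unit_time_def)
            then show ?thesis by (simp add: algebra_simps)
          qed
          ultimately show ?thesis
            using ws
            apply (simp add: p2(3))
            apply (erule W_mono)
            apply (erule W_mono)
            using p(1) p2(1) w20 by (auto simp: algebra_simps)
        qed
        done
    qed
    done
qed

end

section \<open>Recovering the parameters from the stored bits\<close>

definition flog :: "nat \<Rightarrow> nat \<Rightarrow> com" where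
  "flog x y = block [
     Op Div 33 (Reg 0) (Reg y),
     Op Add x (Const 0) (Const 0),
     While (Less (Const 1) (Reg 33)) (block [
       Op Div 33 (Reg 33) (Const 2),
       Op Add x (Reg x) (Const 1)])]"

definition read_header :: com where
  "read_header = block [
     Op Add 30 (Const 0) (Const 0),
     read (Reg 30) (Const 1),
     While (Eq (Reg 100) (Const 1)) (block [
       Op Add 30 (Reg 30) (Const 1),
       read (Reg 30) (Const 1)]),
     Op Add 31 (Reg 30) (Const 1),
     read (Reg 31) (Reg 30),
     Op Add 11 (Reg 100) (Const 0),
     Op Add 31 (Reg 31) (Reg 30),
     read (Reg 31) (Reg 30),
     Op Add 14 (Reg 100) (Const 0),
     Op Add 10 (Reg 31) (Reg 30)]"

definition skip_ef :: "nat \<Rightarrow> nat \<Rightarrow> nat \<Rightarrow> nat \<Rightarrow> com" where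
  "skip_ef x b y z = block [
     Op Mul x (Reg y) (Reg z),
     Op Add x (Reg x) (Reg b),
     Op Mul 32 (Const 3) (Reg y),
     Op Add x (Reg x) (Reg 32),
     Op Div 32 (Reg 32) (Reg 1),
     Op Mul 32 (Reg 32) (Reg 1),
     Op Add x (Reg x) (Reg 32)]"

text \<open>Only \<rho> and \<open>d\<close> are stored. The widths of the lower parts and the
  addresses of all components follow from them together with \<open>n\<close> and \<open>w\<close>,
  so they are recomputed for each query and take no space.\<close>

definition load_params :: com where
  "load_params = block [
     read_header,
     flog 12 11,
     flog 15 14,
     skip_ef 13 10 11 12,
     skip_ef 16 13 14 15,
     Op Div 18 (Reg 11) (Reg 1),
     Op Add 32 (Reg 18) (Reg 18),
     Op Mul 32 (Reg 32) (Reg 1),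
     Op Add 17 (Reg 16) (Reg 32),
     Op Add 7 (Reg 0) (Const 1),
     Op Mul 6 (Const 64) (Reg 7),
     Op Mul 6 (Reg 6) (Reg 7),
     Op Add 7 (Reg 6) (Reg 6),
     Op Add 8 (Reg 7) (Reg 6),
     Op Add 9 (Reg 8) (Reg 6)]"

text \<open>The interval found by \<open>Search\<close> is counted from 1 and includes both ends;
  lowering only its left end turns it into a half-open interval counted from 0.\<close>

definition list_docs :: com where
  "list_docs = block [
     Search 2 3,
     Cond (Less (Reg 3) (Reg 2)) Skip (block [
       Op Sub 2 (Reg 2) (Const 1),
       load_params,
       start_list])]"

context ram
begin

lemma W_flog:
  assumes r: "regs s 0 = n" "regs s y = N" "N > 0" "N \<le> n" and xy: "x \<noteq> 33" "y \<noteq> x" "y \<noteq> 33" "x \<noteq> 0" "y \<noteq> 0"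
  shows "W (flog x y) (\<lambda>u s'. u \<le> 3 * w + 3 \<and> (\<forall>i. i \<noteq> x \<longrightarrow> i \<noteq> 33 \<longrightarrow> regs s' i = regs s i) \<and>
    mem s' = mem s \<and> reported s' = reported s \<and> regs s' x = floor_log (n div N)) s"
proof -
  let ?s = "set_reg x 0 (set_reg 33 (n div N) s)"
  have p: "0 < n div N" using r(3,4) by (simp add: div_greater_zero_iff)
  have "2 ^ floor_log (n div N) \<le> n div N" using p by (rule floor_log_exp2_le)
  also have "\<dots> \<le> n" by (rule div_le_dividend)
  also have "\<dots> < 2 ^ w" using pow_ge by simp
  finally have lw: "floor_log (n div N) < w" by simp
  define body where "body = block [
       Op Div 33 (Reg 33) (Const 2),
       Op Add x (Reg x) (Const 1)]"
  have loop: "W (While (Less (Const 1) (Reg 33)) body) (\<lambda>u s'. u \<le> 3 * w + 1 \<and>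
    (\<forall>i. i \<noteq> x \<longrightarrow> i \<noteq> 33 \<longrightarrow> regs s' i = regs s i) \<and>
    mem s' = mem s \<and> reported s' = reported s \<and> regs s' x = floor_log (n div N)) ?s"
  proof (rule W_mono[OF W_While[where \<phi> = "3 * floor_log (n div N)" and
        I = "\<lambda>\<phi> s'. \<phi> = 3 * floor_log (regs s' 33) \<and> regs s' x + floor_log (regs s' 33) = floor_log (n div N) \<and>
          0 < regs s' 33 \<and>
          (\<forall>i. i \<noteq> x \<longrightarrow> i \<noteq> 33 \<longrightarrow> regs s' i = regs s i) \<and> mem s' = mem s \<and> reported s' = reported s"]], goal_cases)
    case 1 then show ?case using p xy by simp
  next
    case (2 \<phi> s')
    then have "2 \<le> regs s' 33" by simp
    then have fl: "floor_log (regs s' 33) = Suc (floor_log (regs s' 33 div 2))" "0 < regs s' 33 div 2"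
      by (rule floor_log_rec, simp)
    have "regs s' x + 1 < 2 ^ w" using 2 lw pow_ge fl by linarith
    then show ?case
      unfolding body_def using 2 fl xy by (simp del: floor_log_half)
  next
    case (3 u s')
    then have "regs s' 33 = 1" by auto
    then have "floor_log (regs s' 33) = 0" by simp
    then show ?case using 3 lw by auto
  qed
  show ?thesis
    unfolding flog_def body_def[symmetric] using xy r
    apply simp
    apply (rule W_mono[OF loop])
    apply simp
    done
qed

lemma W_skip_ef:
  assumes r: "regs s 1 = w" "regs s b = B" "regs s y = N" "regs s z = l"
    and len: "B + (N * l + 3 * N + 3 * N div w * w) < 2 ^ w"
    and x: "x < 32" "x > 1" "y < 32" "z < 32" "b < 32" "y \<noteq> x" "z \<noteq> x" "b \<noteq> x"
  shows "W (skip_ef x b y z) (\<lambda>u s'. u \<le> 7 \<and> (\<forall>i. i \<noteq> x \<longrightarrow> i \<noteq> 32 \<longrightarrow> regs s' i = regs s i) \<and>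
    mem s' = mem s \<and> reported s' = reported s \<and> regs s' x = B + (N * l + 3 * N + 3 * N div w * w)) s"
proof -
  have "N * l < 2 ^ w" "N * l + B < 2 ^ w" "3 * N < 2 ^ w" "N * l + B + 3 * N < 2 ^ w"
    "3 * N div w * w < 2 ^ w" "N * l + B + 3 * N + 3 * N div w * w < 2 ^ w"
    using len by linarith+
  then show ?thesis
    unfolding skip_ef_def using x by (simp add: r)
qed

lemma W_read_header:
  assumes s: "ready s"
    and seg: "segment E 0 (table k 1 (\<lambda>_. 1) @ table 1 1 (\<lambda>_. 0) @ table 1 k (\<lambda>_. \<rho>) @ table 1 k (\<lambda>_. d))"
    and k: "k \<le> w" "\<rho> < 2 ^ k" "d < 2 ^ k"
  shows "W read_header (\<lambda>u s'. u \<le> 14 * w + 50 \<and> (\<forall>i<30. i \<notin> {10, 11, 14} \<longrightarrow> regs s' i = regs s i) \<and>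
    mem s' = mem s \<and> reported s' = reported s \<and> regs s' 11 = \<rho> \<and> regs s' 14 = d \<and> regs s' 10 = 3 * k + 1) s"
proof -
  have segs: "segment E 0 (table k 1 (\<lambda>_. 1))" "segment E k (table 1 1 (\<lambda>_. 0))"
    "segment E (k + 1) (table 1 k (\<lambda>_. \<rho>))" "segment E (k + 1 + k) (table 1 k (\<lambda>_. d))"
    using seg by (simp_all add: segment_append)
  have un: "bits_at E i 1 = of_bool (i < k)" "i + 1 \<le> length E" if "i \<le> k" for i
    using bits_at_table[OF segs(1), of i] bits_at_table[OF segs(2), of 0] that
    by (cases "i < k"; simp)+
  have v1: "bits_at E (k + 1) k = \<rho>" "k + 1 + k \<le> length E"
    using bits_at_table[OF segs(3), of 0] k by (simp_all add: take_bit_nat_eq_self)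
  have v2: "bits_at E (k + 1 + k) k = d" "k + 1 + k + k \<le> length E"
    using bits_at_table[OF segs(4), of 0] k by (simp_all add: take_bit_nat_eq_self)
  have ws: "k + 1 < 2 ^ w" "k + 1 + k < 2 ^ w" "k + 1 + k + k < 2 ^ w"
    using v2(2) E pow_ge by linarith+
  have w1: "1 \<le> w" using w20 by simp
  have rd: "W (read (Reg 30) (Const 1)) (\<lambda>u s'. u = 12 \<and> same 100 s1 s' \<and> regs s' 100 = of_bool (i < k)) s1"
    if "same 30 s s1" "regs s1 30 = i" "i \<le> k" for s1 i
    using W_read[of s1 "Reg 30" "Const 1"] that un[OF that(3)] s w1 by (simp add: ready_def same_def)
  have rd2: "W (read (Reg 31) (Reg 30)) (\<lambda>u s'. u = 12 \<and> same 100 s1 s' \<and> regs s' 100 = bits_at E q k) s1"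
    if "regs s1 1 = w" "mem s1 = mem s" "regs s1 31 = q" "regs s1 30 = k" "q + k \<le> length E" for s1 q
    using W_read[of s1 "Reg 31" "Reg 30"] that s k by (simp add: ready_def)
  define body where "body = block [Op Add 30 (Reg 30) (Const 1), read (Reg 30) (Const 1)]"
  define loop where "loop = While (Eq (Reg 100) (Const 1)) body"
  have lp: "W loop (\<lambda>u s'. u \<le> 14 * k + 1 \<and> same 30 s s' \<and> regs s' 30 = k) s1"
    if s1: "same 30 s s1" "regs s1 30 = 0" "regs s1 100 = of_bool (0 < k)" for s1
    unfolding loop_def
  proof (rule W_mono[OF W_While[where \<phi> = "14 * k" and
        I = "\<lambda>\<phi> s'. \<exists>i\<le>k. \<phi> = 14 * (k - i) \<and> same 30 s s' \<and> regs s' 30 = i \<and> regs s' 100 = of_bool (i < k)"]], goal_cases)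
    case 1 then show ?case using s1 by (intro exI[of _ 0]) simp
  next
    case (2 \<phi> s')
    then obtain i where i: "i \<le> k" "\<phi> = 14 * (k - i)" "same 30 s s'" "regs s' 30 = i" "regs s' 100 = of_bool (i < k)"
      by blast
    have ik: "i < k" using 2(2) i by (simp split: if_splits)
    let ?s = "set_reg 30 (i + 1) s'"
    have i1: "i + 1 \<le> k" "i + 1 < 2 ^ w" using ik ws by simp_all
    have s30: "same 30 s ?s" using i(3) by simp
    have ph: "14 + 14 * (k - (i + 1)) \<le> \<phi>" using ik i(2) by (auto simp: One_nat_def)
    define x :: nat where "x = of_bool (i + 1 < k)"
    have rdx: "W (read (Reg 30) (Const 1)) (\<lambda>u s'. u = 12 \<and> same 100 ?s s' \<and> regs s' 100 = x) ?s"
      unfolding x_def by (rule rd[OF s30 _ i1(1)]) simp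
    have bd: "W body (\<lambda>t s'. t = 13 \<and> same 30 s s' \<and> regs s' 30 = i + 1 \<and> regs s' 100 = of_bool (i + 1 < k)) s'"
      unfolding body_def x_def[symmetric] using i1(2)
      apply (simp add: i)
      apply (rule W_mono[OF rdx])
      using same_trans[OF s30] by (auto simp: same_reg)
    show ?case
    proof (rule W_mono[OF bd])
      fix u :: nat and s2 assume *: "u = 13 \<and> same 30 s s2 \<and> regs s2 30 = i + 1 \<and> regs s2 100 = of_bool (i + 1 < k)"
      then have "Suc u + 14 * (k - (i + 1)) \<le> \<phi>" using ph by simp
      then show "\<exists>\<phi>'. Suc u + \<phi>' \<le> \<phi> \<and> (\<exists>i\<le>k. \<phi>' = 14 * (k - i) \<and> same 30 s s2 \<and> regs s2 30 = i \<and>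
          regs s2 100 = of_bool (i < k))"
        using * i1(1) by blast
    qed
  next
    case (3 u s')
    then obtain i where i: "i \<le> k" "u \<le> 14 * k + 1" "same 30 s s'" "regs s' 30 = i" "regs s' 100 = of_bool (i < k)"
      "\<not> test_val w s' (Eq (Reg 100) (Const 1))" by (metis (no_types, lifting) add_leD1)
    then have "i = k" by (cases "i < k") simp_all
    then show ?case using i by simp
  qed
  show ?thesis
    unfolding read_header_def body_def[symmetric] loop_def[symmetric]
    apply (simp only: block.simps W_Seq)
    apply simp
    apply (rule W_mono[OF rd[of _ 0]])
       apply simp_all[3]
    apply (elim conjE)
    subgoal premises p for u1 s1
    proof -
      have sm1: "same 30 s s1" using p(2) by (auto simp: same_def)
      have z: "regs s1 30 = 0" using same_reg[OF p(2), of 30] by simp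
      show ?thesis
        apply (subst W_Seq)
        apply (rule W_mono[OF lp[OF sm1 z p(3)]])
        apply (elim conjE)
        subgoal premises p2 for u2 s2
        proof -
          have r2: "regs s2 1 = w" "mem s2 = mem s" "reported s2 = reported s"
            using same_reg[OF p2(2), of 1] p2(2) s by (simp_all add: ready_def same_def)
          let ?s2 = "set_reg 31 (k + 1) s2"
          have a: "W (read (Reg 31) (Reg 30)) (\<lambda>u s'. u = 12 \<and> same 100 ?s2 s' \<and> regs s' 100 = \<rho>) ?s2"
            using rd2[of ?s2 "k + 1"] r2 p2(3) v1 by simp
          show ?thesis
            using ws
            apply (simp add: p2(3))
            apply (rule W_mono[OF a])
            apply (elim conjE)
            subgoal premises p3 for u3 s3
            proof -
              have r3: "regs s3 1 = w" "mem s3 = mem s" "reported s3 = reported s" "regs s3 30 = k" "regs s3 31 = k + 1"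
                using same_reg[OF p3(3)] p3(3) r2 p2(3) by (simp_all add: same_def)
              have rw: "\<rho> < 2 ^ w" "d < 2 ^ w" using k power_increasing[OF k(1), of "2::nat"] by linarith+
              let ?s3 = "set_reg 31 (k + 1 + k) (set_reg 11 \<rho> s3)"
              have b: "W (read (Reg 31) (Reg 30)) (\<lambda>u s'. u = 12 \<and> same 100 ?s3 s' \<and> regs s' 100 = d) ?s3"
                using rd2[of ?s3 "k + 1 + k"] r3 v2 by simp
              show ?thesis
                using ws rw
                apply (simp add: p3(4) r3)
                apply (rule W_mono[OF b])
                apply (elim conjE)
                subgoal premises p4 for u4 s4
                proof -
                  have r4: "regs s4 30 = k" "regs s4 31 = k + 1 + k" "regs s4 11 = \<rho>" "mem s4 = mem s" "reported s4 = reported s"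
                    "regs s4 100 = d"
                    using p4 r3 by (simp_all add: same_def)
                  have fr: "regs s4 i = regs s i" if "i < 30" "i \<noteq> 11" for i
                    using that p4 p3(3) p2(2) by (simp add: same_def)
                  show ?thesis
                    using ws rw p(1) p2(1) p3(2) k(1) by (simp add: r4 fr p4)
                qed
                done
            qed
            done
        qed
        done
    qed
    done
qed

end

context listing
begin

lemma W_load_params:
  assumes s: "ready s" "regs s 2 = lo" "regs s 3 = hi"
    and seg: "segment E 0 (table k 1 (\<lambda>_. 1) @ table 1 1 (\<lambda>_. 0) @ table 1 k (\<lambda>_. \<rho>) @ table 1 k (\<lambda>_. d))"
    and k: "k \<le> w" "\<rho> < 2 ^ k" "d < 2 ^ k"
    and base: "bR = 3 * k + 1" "bD = bR + length (ef_bits w n \<rho> rs)" "bT = bD + length (ef_bits w n d ds)"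
      "bC = bT + 2 * Q.M * w"
  shows "W load_params (\<lambda>u s'. u \<le> 30 * w \<and> params s' \<and> reported s' = reported s) s"
proof -
  have lR: "bD = bR + (\<rho> * R.l + 3 * \<rho> + 3 * \<rho> div w * w)"
    and lD: "bT = bD + (d * D.l + 3 * d + 3 * d div w * w)"
    using base by (simp_all add: length_ef_bits)
  have bEs: "bD \<le> length E" "bT \<le> length E" "bC \<le> length E"
    using D.seg Q.tree Q.codes by (simp_all add: segment_def)
  have words': "bD < 2 ^ w" "bT < 2 ^ w" "bC < 2 ^ w" using bEs E pow_ge by linarith+
  have QM: "2 * Q.M * w < 2 ^ w" "Q.M + Q.M < 2 ^ w" "Q.M < 2 ^ w"
    using base(4) words' div_le_dividend[of \<rho> w] rn words by linarith+
  have Xs: "n + 1 < 2 ^ w" "64 * (n + 1) < 2 ^ w" "X < 2 ^ w" "X + X < 2 ^ w" "2 * X + X < 2 ^ w" "3 * X + X < 2 ^ w"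
  proof -
    have "64 * (n + 1) = 64 * n + 64" by simp
    then show "n + 1 < 2 ^ w" "64 * (n + 1) < 2 ^ w" "X < 2 ^ w" "X + X < 2 ^ w" "2 * X + X < 2 ^ w" "3 * X + X < 2 ^ w"
      using words X_n nX pow_ge by linarith+
  qed
  have Xe: "(64 * n + 64) * (n + 1) = X" by (simp add: X_def)
  define rest where "rest = block [
     Op Div 18 (Reg 11) (Reg 1),
     Op Add 32 (Reg 18) (Reg 18),
     Op Mul 32 (Reg 32) (Reg 1),
     Op Add 17 (Reg 16) (Reg 32),
     Op Add 7 (Reg 0) (Const 1),
     Op Mul 6 (Const 64) (Reg 7),
     Op Mul 6 (Reg 6) (Reg 7),
     Op Add 7 (Reg 6) (Reg 6),
     Op Add 8 (Reg 7) (Reg 6),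
     Op Add 9 (Reg 8) (Reg 6)]"
  have rest: "W rest (\<lambda>u s'. u \<le> 10 \<and> params s' \<and> reported s' = reported s) s5"
    if r5: "regs s5 0 = n" "regs s5 1 = w" "regs s5 2 = lo" "regs s5 3 = hi" "mem s5 = mem s" "reported s5 = reported s"
      "regs s5 10 = bR" "regs s5 11 = \<rho>" "regs s5 12 = R.l" "regs s5 13 = bD" "regs s5 14 = d" "regs s5 15 = D.l"
      "regs s5 16 = bT" for s5
    unfolding rest_def using QM Xs words'(3) s(1)
    apply (simp add: r5 Xe mult_2[symmetric] base(4)[symmetric])
    apply (simp add: params_def r5 ready_def add_mult_distrib)
    done
  show ?thesis
    unfolding load_params_def
    apply (simp only: block.simps)
    apply (subst W_Seq)
    apply (rule W_mono[OF W_read_header[OF s(1) seg k]])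
    apply (elim conjE)
    subgoal premises p1 for u1 s1
    proof -
      have f1: "regs s1 i = regs s i" if "i < 30" "i \<notin> {10, 11, 14}" for i using p1(2) that by blast
      have v1: "regs s1 0 = n" "regs s1 1 = w" "regs s1 2 = lo" "regs s1 3 = hi"
        using s by (simp_all add: f1 ready_def)
      show ?thesis
        apply (subst W_Seq)
        apply (rule W_mono[OF W_flog[where N = \<rho>]])
        using v1 p1(5) R.N rn apply simp_all[9]
        apply (elim conjE)
        subgoal premises p2 for u2 s2
        proof -
          have v2: "regs s2 0 = n" "regs s2 1 = w" "regs s2 2 = lo" "regs s2 3 = hi" "regs s2 11 = \<rho>" "regs s2 14 = d"
            "regs s2 10 = bR" "mem s2 = mem s" "reported s2 = reported s"
            using p2 v1 p1 base(1) by simp_all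
          show ?thesis
            apply (subst W_Seq)
            apply (rule W_mono[OF W_flog[where N = d]])
            using v2 D.N dn apply simp_all[9]
            apply (elim conjE)
            subgoal premises p3 for u3 s3
            proof -
              have v3: "regs s3 0 = n" "regs s3 1 = w" "regs s3 2 = lo" "regs s3 3 = hi" "regs s3 11 = \<rho>" "regs s3 14 = d"
                "regs s3 10 = bR" "mem s3 = mem s" "reported s3 = reported s" "regs s3 12 = R.l" "regs s3 15 = D.l"
                using p3 v2 p2 by simp_all
              show ?thesis
                apply (subst W_Seq)
                apply (rule W_mono[OF W_skip_ef[where B = bR and N = \<rho> and l = R.l]])
                using v3 words'(1) lR apply simp_all[13]
                apply (elim conjE)
                subgoal premises p4 for u4 s4
                proof -
                  have v4: "regs s4 0 = n" "regs s4 1 = w" "regs s4 2 = lo" "regs s4 3 = hi" "regs s4 11 = \<rho>" "regs s4 14 = d"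
                    "regs s4 10 = bR" "mem s4 = mem s" "reported s4 = reported s" "regs s4 12 = R.l" "regs s4 15 = D.l"
                    "regs s4 13 = bD"
                    using p4 v3 lR by simp_all
                  show ?thesis
                    apply (subst W_Seq)
                    apply (rule W_mono[OF W_skip_ef[where B = bD and N = d and l = D.l]])
                    using v4 words'(2) lD apply simp_all[13]
                    apply (elim conjE)
                    subgoal premises p5 for u5 s5
                    proof -
                      have "W rest (\<lambda>u s'. u \<le> 10 \<and> params s' \<and> reported s' = reported s) s5"
                        by (rule rest) (use p5 v4 lD in simp_all)
                      then show ?thesis
                        unfolding rest_def block.simps
                        apply (rule W_mono)
                        using p1(1) p2(1) p3(1) p4(1) p5(1) w20 by simp
                    qed
                    done
                qed
                done
            qed
            done
        qed
        done
    qed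
    done
qed

end

section \<open>The index and its size\<close>

definition run_start :: "'a::linorder list list \<Rightarrow> nat \<Rightarrow> nat" where
  "run_start Ss k = run_starts (ilcp Ss) ! k"

definition run_val :: "'a::linorder list list \<Rightarrow> nat \<Rightarrow> nat" where
  "run_val Ss k = ilcp Ss ! run_start Ss k"

text \<open>A self-delimiting code: the common width \<open>k\<close> comes first in unary, ended by
  a zero, since nothing about \<rho> and \<open>d\<close> can be assumed before reading
  them.\<close>

definition header_bits :: "nat \<Rightarrow> nat \<Rightarrow> nat \<Rightarrow> bool list" where
  "header_bits k \<rho> d = table k 1 (\<lambda>_. 1) @ table 1 1 (\<lambda>_. 0) @ table 1 k (\<lambda>_. \<rho>) @ table 1 k (\<lambda>_. d)"

definition header_size :: "nat \<Rightarrow> nat \<Rightarrow> nat" where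
  "header_size \<rho> d = floor_log (max \<rho> d) + 1"

definition index_bits :: "nat \<Rightarrow> 'a::linorder list list \<Rightarrow> bool list" where
  "index_bits w Ss = (let n = length (concat Ss); \<rho> = length (run_starts (ilcp Ss)); d = length Ss in
     header_bits (header_size \<rho> d) \<rho> d @ ef_bits w n \<rho> (run_start Ss) @
     ef_bits w n d (doc_start Ss) @ tree_bits w n \<rho> (run_val Ss) @ code_bits w \<rho> (run_val Ss))"

lemma length_ilcp [simp]: "length (ilcp Ss) = length (concat Ss)"
  by (simp add: ilcp_def del: upt_Suc)

lemma nth_mono_run_starts:
  "i < j \<Longrightarrow> j < length (run_starts xs) \<Longrightarrow> run_starts xs ! i < run_starts xs ! j"
  by (rule sorted_wrt_nth_less[where P = "(<)"]) (simp_all add: run_starts_def sorted_wrt_filter strict_sorted_iff)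

lemma set_run_starts: "set (run_starts xs) = {p. p < length xs \<and> (p = 0 \<or> xs ! (p - 1) \<noteq> xs ! p)}"
  by (auto simp: run_starts_def)

lemma run_starts_0: "xs \<noteq> [] \<Longrightarrow> run_starts xs \<noteq> [] \<and> run_starts xs ! 0 = 0"
  by (cases xs) (simp_all add: run_starts_def upt_conv_Cons del: upt_Suc)

text \<open>No run starts strictly between the start of run \<open>k\<close> and position
  \<open>i\<close>, so the value is carried along unchanged.\<close>

lemma nth_eq_run_start:
  assumes "run_starts xs ! k \<le> i" "i < length xs" "k < length (run_starts xs)"
    and "\<And>j. j < length (run_starts xs) \<Longrightarrow> run_starts xs ! j \<le> i \<Longrightarrow> j \<le> k"
  shows "xs ! i = xs ! (run_starts xs ! k)"
proof -
  have "i' \<le> i \<Longrightarrow> xs ! i' = xs ! (run_starts xs ! k)" if "run_starts xs ! k \<le> i'" for i'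
    using that
  proof (induction i' rule: dec_induct)
    case base then show ?case by simp
  next
    case (step q)
    have "Suc q \<notin> set (run_starts xs)"
    proof
      assume "Suc q \<in> set (run_starts xs)"
      then obtain j where j: "j < length (run_starts xs)" "run_starts xs ! j = Suc q"
        by (auto simp: in_set_conv_nth)
      then have "j \<le> k" using assms(4)[OF j(1)] step.prems by simp
      then have "run_starts xs ! j \<le> run_starts xs ! k"
        using nth_mono_run_starts[of j k xs] assms(3) by (cases "j = k") auto
      then show False using j step.hyps by simp
    qed
    then show ?case using step assms(2) by (auto simp: set_run_starts)
  qed
  then show ?thesis using assms(1) by blast
qed

lemma lcp_le: "lcp u v \<le> length v"
  unfolding lcp_def by (rule prefix_length_le) (rule longest_common_prefix_prefix2)

lemma floor_log_less: "0 < m \<Longrightarrow> floor_log m < m"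
  by (metis floor_log_exp2_le less_exp less_le_trans)

lemma less_floor_log: "m < 2 ^ (floor_log m + 1)"
  using floor_log_exp2_gt[of m] by simp

lemma header_size: "0 < d \<Longrightarrow> header_size \<rho> d \<le> \<rho> + d" "\<rho> < 2 ^ header_size \<rho> d" "d < 2 ^ header_size \<rho> d"
proof -
  show "\<rho> < 2 ^ header_size \<rho> d" "d < 2 ^ header_size \<rho> d"
    using less_floor_log[of "max \<rho> d"] by (simp_all add: header_size_def)
  assume "0 < d"
  then have "0 < max \<rho> d" by (simp add: less_max_iff_disj)
  then have "header_size \<rho> d \<le> max \<rho> d"
    using floor_log_less[of "max \<rho> d"] by (simp add: header_size_def)
  also have "\<dots> \<le> \<rho> + d" by simp
  finally show "header_size \<rho> d \<le> \<rho> + d" .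
qed

section \<open>Size and layout of the index\<close>

context
  fixes Ss :: "'a::{linorder,order_bot} list list" and n d \<rho> :: nat
  assumes coll: "collection Ss"
  defines "n \<equiv> length (concat Ss)" and "d \<equiv> length Ss" and "\<rho> \<equiv> length (run_starts (ilcp Ss))"
begin

lemma docs_pos: "d > 0"
  using coll by (simp add: d_def collection_def)

lemma ef_docs: "ef_seq n d (doc_start Ss)"
proof
  show "d > 0" by (rule docs_pos)
  show "doc_start Ss i < doc_start Ss j" if "i < j" "j < d" for i j
    using doc_start_less[OF coll that(1)] that(2) by (simp add: d_def)
  show "doc_start Ss i < n" if "i < d" for i
    using doc_start_less[OF coll that[unfolded d_def]] by (simp add: n_def doc_start_length)
qed simp

lemma text_pos: "n > 0"
  using ef_seq.an[OF ef_docs docs_pos] by simp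

lemma ef_runs: "ef_seq n \<rho> (run_start Ss)"
proof
  have ne: "ilcp Ss \<noteq> []" using text_pos by (simp add: n_def flip: length_greater_0_conv)
  show "\<rho> > 0" "run_start Ss 0 = 0" using run_starts_0[OF ne] by (simp_all add: \<rho>_def run_start_def)
  show "run_start Ss i < run_start Ss j" if "i < j" "j < \<rho>" for i j
    using nth_mono_run_starts that by (simp add: \<rho>_def run_start_def)
  show "run_start Ss i < n" if "i < \<rho>" for i
    using nth_mem[of i "run_starts (ilcp Ss)"] that by (simp add: \<rho>_def run_start_def set_run_starts n_def)
qed

lemma ilcp_le: "i < n \<Longrightarrow> ilcp Ss ! i \<le> n"
proof -
  assume i: "i < n"
  let ?SA = "suffix_array (concat Ss)"
  have "?SA ! i \<in> {1..length (concat Ss)}"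
    using i set_suffix_array[of "concat Ss"] nth_mem[of i ?SA] by (simp add: n_def length_suffix_array)
  then obtain j where j: "j < length Ss" "doc_of Ss (?SA ! i) = Suc j" using ex_doc doc_ofI by metis
  have "length (Ss ! j) \<le> n"
    using doc_start_Suc[OF j(1)] doc_start_mono[of "Suc j" "length Ss" Ss] j(1) by (simp add: n_def doc_start_length)
  moreover have "length (suffix_from (Ss ! j) q) \<le> length (Ss ! j)" for q
    by (simp add: suffix_from_def)
  ultimately have "lcp u (suffix_from (Ss ! j) q) \<le> n" for u q
    using lcp_le[of u "suffix_from (Ss ! j) q"] by (meson le_trans)
  then show ?thesis
    using ilcp_nth[OF coll i[unfolded n_def] j] by simp
qed

lemma run_val_le: "k < \<rho> \<Longrightarrow> run_val Ss k \<le> n"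
  unfolding run_val_def by (intro ilcp_le ef_seq.an[OF ef_runs])

lemma length_index_bits: "length (index_bits w Ss) = 3 * header_size \<rho> d + 1 + (\<rho> * floor_log (n div \<rho>) + 3 * \<rho> + 3 * \<rho> div w * w) +
   (d * floor_log (n div d) + 3 * d + 3 * d div w * w) + 2 * (\<rho> div w) * w + 2 * \<rho>"
  unfolding index_bits_def Let_def n_def[symmetric] d_def[symmetric] \<rho>_def[symmetric]
  by (simp add: header_bits_def length_ef_bits tree_bits_def code_bits_def)

text \<open>Besides the lower parts, each run costs at most 3 bits in the header, 3 for upper parts,
  3 in the directory, 2 in the tree and 2 in the stack codes; a document costs only the first
  three.\<close>

lemma length_index_le: "length (index_bits w Ss) \<le>
    \<rho> * floor_log (n div \<rho>) + d * floor_log (n div d) + 14 * \<rho> + 10 * d"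
proof -
  have "3 * \<rho> div w * w \<le> 3 * \<rho>" "3 * d div w * w \<le> 3 * d" "\<rho> div w * w \<le> \<rho>"
    by (rule div_times_less_eq_dividend)+
  moreover have "2 * (\<rho> div w) * w = 2 * (\<rho> div w * w)" by simp
  ultimately show ?thesis
    unfolding length_index_bits using header_size(1)[OF docs_pos, of \<rho>] docs_pos by linarith
qed

lemma mult_floor_log_le: "0 < N \<Longrightarrow> N \<le> n \<Longrightarrow> N * floor_log (n div N) \<le> n"
proof -
  assume N: "0 < N" "N \<le> n"
  then have "floor_log (n div N) \<le> n div N"
    using floor_log_less[of "n div N"] by (simp add: div_greater_zero_iff)
  then have "N * floor_log (n div N) \<le> N * (n div N)" by (rule mult_le_mono2)
  also have "\<dots> \<le> n" by simp
  finally show ?thesis .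
qed

lemma length_index_less: "length (index_bits w Ss) < 64 * (n + 1) * (n + 1)"
proof -
  have rn: "0 < \<rho>" "\<rho> \<le> n" "0 < d" "d \<le> n"
    using ef_seq.N[OF ef_runs] ef_seq.N_le[OF ef_runs] ef_seq.N[OF ef_docs] ef_seq.N_le[OF ef_docs] by blast+
  \<comment> \<open>Each table of lower parts has at most \<open>n\<close> bits, and \<rho> and
    \<open>d\<close> are at most \<open>n\<close>: 1 + 1 + 14 + 10.\<close>
  have "length (index_bits w Ss) \<le> 26 * n"
    using length_index_le[of w] mult_floor_log_le[OF rn(1,2)] mult_floor_log_le[OF rn(3,4)] rn by linarith
  also have "\<dots> < 64 * (n + 1)" by simp
  also have "\<dots> \<le> 64 * (n + 1) * (n + 1)" by simp
  finally show ?thesis .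
qed

text \<open>The division and the logarithm are both rounded down, so the leading terms of the space
  bound get the coefficient 1.\<close>

lemma mult_floor_log_le_log:
  assumes "0 < N" "N \<le> n" shows "real (N * floor_log (n div N)) \<le> real N * log 2 (real n / real N)"
proof -
  have "0 < n div N" using assms by (simp add: div_greater_zero_iff)
  then have "2 ^ floor_log (n div N) \<le> n div N" by (rule floor_log_exp2_le)
  then have "2 ^ floor_log (n div N) \<le> real (n div N)" by (metis of_nat_le_iff of_nat_numeral of_nat_power)
  also have "\<dots> \<le> real n / real N" by (rule of_nat_div_le_of_nat)
  finally have "real (floor_log (n div N)) \<le> log 2 (real n / real N)"
    by (intro le_log_of_power) simp_all
  then show ?thesis by (simp add: mult_left_mono)
qed

lemma space:
  "real (length (index_bits w Ss)) \<le> real \<rho> * log 2 (real n / real \<rho>) + 14 * real \<rho> +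
     real d * log 2 (real n / real d) + 14 * real d"
proof -
  have rn: "0 < \<rho>" "\<rho> \<le> n" "0 < d" "d \<le> n"
    using ef_seq.N[OF ef_runs] ef_seq.N_le[OF ef_runs] ef_seq.N[OF ef_docs] ef_seq.N_le[OF ef_docs] by blast+
  have "real (length (index_bits w Ss)) \<le>
      real (\<rho> * floor_log (n div \<rho>)) + real (d * floor_log (n div d)) + 14 * real \<rho> + 10 * real d"
    using length_index_le[of w] by linarith
  then show ?thesis
    using mult_floor_log_le_log[OF rn(1,2)] mult_floor_log_le_log[OF rn(3,4)] by simp
qed

lemma segments:
  fixes w :: nat
  defines "bR \<equiv> 3 * header_size \<rho> d + 1"
  defines "bD \<equiv> bR + length (ef_bits w n \<rho> (run_start Ss))"
  defines "bT \<equiv> bD + length (ef_bits w n d (doc_start Ss))"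
  defines "bC \<equiv> bT + 2 * (\<rho> div w) * w"
  shows "segment (index_bits w Ss) 0 (header_bits (header_size \<rho> d) \<rho> d)"
    "segment (index_bits w Ss) bR (ef_bits w n \<rho> (run_start Ss))"
    "segment (index_bits w Ss) bD (ef_bits w n d (doc_start Ss))"
    "segment (index_bits w Ss) bT (tree_bits w n \<rho> (run_val Ss))"
    "segment (index_bits w Ss) bC (code_bits w \<rho> (run_val Ss))"
proof -
  have l: "length (header_bits (header_size \<rho> d) \<rho> d) = bR"
    "length (tree_bits w n \<rho> (run_val Ss)) = 2 * (\<rho> div w) * w"
    by (simp_all add: header_bits_def tree_bits_def bR_def)
  have "segment (index_bits w Ss) 0 (header_bits (header_size \<rho> d) \<rho> d @ ef_bits w n \<rho> (run_start Ss) @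
      ef_bits w n d (doc_start Ss) @ tree_bits w n \<rho> (run_val Ss) @ code_bits w \<rho> (run_val Ss))"
    using segment_self[of "index_bits w Ss"]
    by (subst (asm) (2) index_bits_def) (simp add: Let_def n_def d_def \<rho>_def)
  then show "segment (index_bits w Ss) 0 (header_bits (header_size \<rho> d) \<rho> d)"
    "segment (index_bits w Ss) bR (ef_bits w n \<rho> (run_start Ss))"
    "segment (index_bits w Ss) bD (ef_bits w n d (doc_start Ss))"
    "segment (index_bits w Ss) bT (tree_bits w n \<rho> (run_val Ss))"
    "segment (index_bits w Ss) bC (code_bits w \<rho> (run_val Ss))"
    by (simp_all add: segment_append l bC_def bT_def bD_def add.assoc)
qed

section \<open>Answering one pattern\<close>

context
  fixes w :: nat and A :: "'a csa" and c :: "bool list" and P :: "'a list" and l r :: nat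
  assumes csa: "is_csa A c (concat Ss)" and pat: "pattern P" and sr: "search A c P = (l, r)"
begin

text \<open>The specification of the search describes a set of text positions; since the entries of
  the suffix array are distinct, it determines the rows as well.\<close>

lemma interval:
  assumes "i < n"
  shows "prefix P (suffix_from (concat Ss) (suffix_array (concat Ss) ! i)) \<longleftrightarrow> l - 1 \<le> i \<and> i < r \<and> l \<le> r"
proof -
  let ?SA = "suffix_array (concat Ss)"
  have img: "{l..r} \<subseteq> {1..n}" "(\<lambda>i. ?SA !\<^sub>1 i) ` {l..r} = {p \<in> {1..n}. prefix P (suffix_from (concat Ss) p)}"
    using csa pat sr unfolding is_csa_def n_def by blast+
  have i: "?SA ! i \<in> {1..n}"
    using assms set_suffix_array[of "concat Ss"] nth_mem[of i ?SA] by (simp add: n_def length_suffix_array)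
  have "prefix P (suffix_from (concat Ss) (?SA ! i)) \<longleftrightarrow> ?SA ! i \<in> (\<lambda>i. ?SA !\<^sub>1 i) ` {l..r}"
    unfolding img(2) using i by blast
  also have "\<dots> \<longleftrightarrow> Suc i \<in> {l..r}"
  proof
    assume "?SA ! i \<in> (\<lambda>i. ?SA !\<^sub>1 i) ` {l..r}"
    then obtain q where q: "q \<in> {l..r}" "?SA ! i = ?SA ! (q - 1)" by (auto simp: nth1_def)
    then have "1 \<le> q" "q \<le> n" using img(1) by auto
    then have "i = q - 1"
      using q(2) assms distinct_suffix_array[of "concat Ss"]
      by (subst (asm) nth_eq_iff_index_eq) (auto simp: n_def length_suffix_array One_nat_def)
    then show "Suc i \<in> {l..r}" using q(1) \<open>1 \<le> q\<close> by (simp add: One_nat_def)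
  next
    assume "Suc i \<in> {l..r}"
    then show "?SA ! i \<in> (\<lambda>i. ?SA !\<^sub>1 i) ` {l..r}"
      by (intro image_eqI[of _ _ "Suc i"]) (simp_all add: nth1_def One_nat_def)
  qed
  also have "\<dots> \<longleftrightarrow> l - 1 \<le> i \<and> i < r \<and> l \<le> r" by (auto simp: One_nat_def)
  finally show ?thesis .
qed

lemma search_bounds: "l \<le> n + 1" "r \<le> n" "l \<le> r \<Longrightarrow> 1 \<le> l"
proof -
  have b: "l \<le> n + 1 \<and> r \<le> n \<and> {l..r} \<subseteq> {1..n}" using csa pat sr unfolding is_csa_def n_def by blast
  then show "l \<le> n + 1" "r \<le> n" by blast+
  assume "l \<le> r"
  then have "l \<in> {l..r}" by simp
  then show "1 \<le> l" using b by auto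
qed

lemma SA_range: "i < n \<Longrightarrow> 1 \<le> suffix_array (concat Ss) ! i \<and> suffix_array (concat Ss) ! i \<le> n"
  using set_suffix_array[of "concat Ss"] nth_mem[of i "suffix_array (concat Ss)"]
  by (simp add: n_def length_suffix_array)

lemma doc_array_bounds:
  assumes "i < n"
  obtains j where "j < d" "doc_array Ss ! i = Suc j" "doc_start Ss j < suffix_array (concat Ss) ! i"
    "suffix_array (concat Ss) ! i \<le> doc_start Ss (Suc j)"
proof -
  have "suffix_array (concat Ss) ! i \<in> {1..length (concat Ss)}" using SA_range[OF assms] by (simp add: n_def)
  then obtain j where j: "j < length Ss" "doc_start Ss j < suffix_array (concat Ss) ! i"
    "suffix_array (concat Ss) ! i \<le> doc_start Ss (Suc j)" by (rule ex_doc)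
  moreover have "doc_array Ss ! i = Suc j"
    using doc_ofI[OF j] assms by (simp add: doc_array_def n_def length_suffix_array)
  ultimately show ?thesis using that by (simp add: d_def)
qed

text \<open>The form \<open>- 1 + 1\<close> matches the program, which numbers documents from 0 and
  adds 1 when it reports.\<close>

lemma docs_with_interval:
  "docs_with Ss P = (if l \<le> r then (\<lambda>i. doc_array Ss ! i - 1 + 1) ` {l - 1..<r} else {})"
proof -
  let ?SA = "suffix_array (concat Ss)"
  have "docs_with Ss P = doc_of Ss ` {p \<in> {1..n}. prefix P (suffix_from (concat Ss) p)}"
    using docs_with_eq[OF coll pat] by (simp add: n_def)
  also have "{p \<in> {1..n}. prefix P (suffix_from (concat Ss) p)} =
      (\<lambda>i. ?SA ! i) ` {i. i < n \<and> prefix P (suffix_from (concat Ss) (?SA ! i))}"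
  proof -
    have "{1..n} = set ?SA" by (simp add: set_suffix_array n_def)
    also have "\<dots> = (\<lambda>i. ?SA ! i) ` {..<n}" by (auto simp: set_conv_nth length_suffix_array n_def)
    finally show ?thesis by auto
  qed
  also have "{i. i < n \<and> prefix P (suffix_from (concat Ss) (?SA ! i))} = {i. i < n \<and> l - 1 \<le> i \<and> i < r \<and> l \<le> r}"
    using interval by blast
  also have "\<dots> = (if l \<le> r then {l - 1..<r} else {})"
    using search_bounds(2) by auto
  finally have "docs_with Ss P = (if l \<le> r then (\<lambda>i. doc_of Ss (?SA ! i)) ` {l - 1..<r} else {})"
    by (simp add: image_image)
  moreover have "doc_of Ss (?SA ! i) = doc_array Ss ! i - 1 + 1" if "i \<in> {l - 1..<r}" for i
  proof -
    have "i < n" using that search_bounds(2) by simp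
    then show ?thesis using doc_array_bounds[of i]
      by (metis add.commute add_diff_cancel_left' doc_array_def length_suffix_array n_def nth_map plus_1_eq_Suc)
  qed
  then have "(\<lambda>i. doc_of Ss (?SA ! i)) ` {l - 1..<r} = (\<lambda>i. doc_array Ss ! i - 1 + 1) ` {l - 1..<r}"
    by (rule image_cong[OF refl])
  ultimately show ?thesis by (simp only:)
qed

lemma listing_run:
  defines "X \<equiv> 64 * (n + 1) * (n + 1)"
  assumes lr: "l \<le> r" and w: "20 \<le> w" "1000 * X \<le> 2 ^ w" "1000 * w \<le> 2 ^ w"
    and hold: "holds_bits w M (index_bits w Ss)"
  shows "\<exists>t s. exec w A c n P list_docs (init_state w n M) t s \<and>
      distinct (reported s) \<and> set (reported s) = docs_with Ss P \<and> holds_bits w (mem s) (index_bits w Ss) \<and>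
      t \<le> search_time A (length P) + 33 * w + (310 * w + lookup_time A n) * (11 * card (docs_with Ss P))"
proof -
  let ?E = "index_bits w Ss" and ?SA = "suffix_array (concat Ss)"
  let ?bR = "3 * header_size \<rho> d + 1"
  let ?bD = "?bR + length (ef_bits w n \<rho> (run_start Ss))"
  let ?bT = "?bD + length (ef_bits w n d (doc_start Ss))"
  let ?bC = "?bT + 2 * (\<rho> div w) * w"
  let ?da = "\<lambda>i. doc_array Ss ! i - 1"
  note seg = segments[of w]
  interpret ram w A c n P X ?E
    by unfold_locales (use length_index_less[of w] w in \<open>simp_all add: X_def\<close>)
  interpret R: ef_seq n \<rho> "run_start Ss" by (rule ef_runs)
  interpret R: ram_ef w A c n P X ?E \<rho> "run_start Ss" ?bR
    by unfold_locales (rule seg)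
  interpret D: ef_seq n d "doc_start Ss" by (rule ef_docs)
  interpret D: ram_ef w A c n P X ?E d "doc_start Ss" ?bD
    by unfold_locales (rule seg)
  interpret Q: ram_rmq w A c n P X ?E \<rho> "run_val Ss" ?bC ?bT
    by unfold_locales (use R.N_le run_val_le seg in simp_all)
  interpret listing w A c n P X ?E \<rho> "run_start Ss" ?bR d "doc_start Ss" ?bD "run_val Ss" ?bC ?bT
    "\<lambda>i. ?SA ! i" ?da "l - 1" r "length P"
  proof unfold_locales
    show "lookup A c (i + 1) = ?SA ! i" if "i < n" for i
      using csa that by (auto simp: is_csa_def n_def nth1_def)
    show "1 \<le> ?SA ! i \<and> ?SA ! i \<le> n" if "i < n" for i using SA_range that .
    show "D.pred_index False (?SA ! i - 1) (?da i)" if "i < n" for i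
    proof -
      obtain j where j: "j < d" "doc_array Ss ! i = Suc j" "doc_start Ss j < ?SA ! i" "?SA ! i \<le> doc_start Ss (Suc j)"
        using doc_array_bounds \<open>i < n\<close> by blast
      have "j' \<le> j" if "j' < d" "doc_start Ss j' \<le> ?SA ! i - 1" for j'
      proof (rule ccontr)
        assume "\<not> j' \<le> j"
        then have "doc_start Ss (Suc j) \<le> doc_start Ss j'" by (intro doc_start_mono) simp
        then show False using that(2) j(3,4) by linarith
      qed
      then show ?thesis using j by (simp add: D.pred_index_def D.key_def One_nat_def)
    qed
    show "l - 1 < r" using lr search_bounds(3) by simp
    show "r \<le> n" by (rule search_bounds)
    \<comment> \<open>Here the interleaved LCP array enters: row \<open>i\<close> has the value
      stored for its run, and \<open>ilcp_less_iff\<close> applies to the row. Lowering all document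
      numbers by 1 does not affect which of them coincide.\<close>
    show "run_val Ss k < length P \<longleftrightarrow> ?da i \<notin> ?da ` {l - 1..<i}"
      if i: "l - 1 \<le> i" "i < r" and k: "R.pred_index False i k" for i k
    proof -
      have inn: "i < n" using i search_bounds(2) by simp
      have k': "k < \<rho>" "run_start Ss k \<le> i" "\<And>j. j < \<rho> \<Longrightarrow> run_start Ss j \<le> i \<Longrightarrow> j \<le> k"
        using k by (auto simp: R.pred_index_def R.key_def)
      have "run_val Ss k = ilcp Ss ! i"
        unfolding run_val_def run_start_def
        using k' inn by (intro nth_eq_run_start[symmetric]) (auto simp: run_start_def \<rho>_def n_def)
      moreover have il: "ilcp Ss ! i < length P \<longleftrightarrow> doc_array Ss ! i \<notin> (\<lambda>q. doc_array Ss ! q) ` {l - 1..<i}"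
        by (rule ilcp_less_iff[OF coll pat, of r])
          (use i interval search_bounds(2) lr in \<open>auto simp: n_def\<close>)
      have da_eq: "?da i = ?da q \<longleftrightarrow> doc_array Ss ! i = doc_array Ss ! q" if "q < i" for q
      proof -
        have "q < n" using that inn by simp
        obtain j where "doc_array Ss ! i = Suc j" using doc_array_bounds[OF inn] .
        moreover obtain j' where "doc_array Ss ! q = Suc j'" using doc_array_bounds[OF \<open>q < n\<close>] .
        ultimately show ?thesis by simp
      qed
      have "(\<exists>q\<in>{l - 1..<i}. ?da i = ?da q) \<longleftrightarrow> (\<exists>q\<in>{l - 1..<i}. doc_array Ss ! i = doc_array Ss ! q)"
        by (rule bex_cong[OF refl]) (simp add: da_eq)
      then have "?da i \<in> ?da ` {l - 1..<i} \<longleftrightarrow> doc_array Ss ! i \<in> (\<lambda>q. doc_array Ss ! q) ` {l - 1..<i}"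
        by (simp only: image_iff)
      ultimately show ?thesis using il by (simp only:)
    qed
  qed
  have df: "df = card (docs_with Ss P)"
  proof -
    have "docs_with Ss P = (\<lambda>j. j + 1) ` ?da ` {l - 1..<r}"
      using docs_with_interval lr by (simp only: image_image if_True)
    then show ?thesis unfolding df_def by (simp add: card_image inj_on_def)
  qed
  have k: "header_size \<rho> d \<le> w"
  proof -
    have "max \<rho> d \<le> n" using R.N_le D.N_le by simp
    moreover have "0 < max \<rho> d" using docs_pos by (simp add: less_max_iff_disj)
    then have "2 ^ floor_log (max \<rho> d) \<le> max \<rho> d" by (rule floor_log_exp2_le)
    ultimately have "2 ^ floor_log (max \<rho> d) < (2::nat) ^ w" using pow_ge by linarith
    then show ?thesis by (simp add: header_size_def)
  qed
  have ws: "l < 2 ^ w" "r < 2 ^ w" using search_bounds words by linarith+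
  let ?s0 = "set_reg 2 (l - 1) (set_reg 3 r (set_reg 2 l (init_state w n M)))"
  have rdy: "ready ?s0" using hold pow_ge by (simp add: ready_def init_state_def take_bit_nat_eq_self)
  have lp: "W load_params (\<lambda>u s'. u \<le> 30 * w \<and> params s' \<and> reported s' = reported ?s0) ?s0"
    by (rule W_load_params[OF rdy _ _ seg(1)[unfolded header_bits_def] k header_size(2,3)]) simp_all
  have "W list_docs (\<lambda>u s'. distinct (reported s') \<and> set (reported s') = docs_with Ss P \<and> holds_bits w (mem s') ?E \<and>
    u \<le> search_time A (length P) + 33 * w + (310 * w + lookup_time A n) * (11 * card (docs_with Ss P))) (init_state w n M)"
    unfolding list_docs_def
    using lr ws search_bounds(3)
    apply (simp add: sr take_bit_nat_eq_self)
    apply (rule W_mono[OF lp])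
    apply (elim conjE)
    subgoal premises p for u1 s1
    proof -
      have "reported s1 = []" using p by (simp add: init_state_def)
      show ?thesis
        apply (rule W_mono[OF W_start_list[OF _ \<open>reported s1 = []\<close>]])
        using p apply blast
        using p w(1) docs_with_interval lr
        apply (auto simp: unit_time_def df params_def ready_def)
        done
    qed
    done
  then show ?thesis unfolding W_def by blast
qed

lemma listing_empty:
  assumes lr: "\<not> l \<le> r" and w: "20 \<le> w" "1000 * (64 * (n + 1) * (n + 1)) \<le> 2 ^ w" "1000 * w \<le> 2 ^ w"
    and hold: "holds_bits w M (index_bits w Ss)"
  shows "\<exists>t s. exec w A c n P list_docs (init_state w n M) t s \<and>
      distinct (reported s) \<and> set (reported s) = docs_with Ss P \<and> holds_bits w (mem s) (index_bits w Ss) \<and>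
      t \<le> search_time A (length P) + 2"
proof -
  let ?X = "64 * (n + 1) * (n + 1)"
  interpret ram w A c n P ?X "index_bits w Ss"
    by unfold_locales (use length_index_less[of w] w in simp_all)
  have ws: "l < 2 ^ w" "r < 2 ^ w" using search_bounds X_n pow_ge by linarith+
  have "W list_docs (\<lambda>u s'. distinct (reported s') \<and> set (reported s') = docs_with Ss P \<and>
    holds_bits w (mem s') (index_bits w Ss) \<and> u \<le> search_time A (length P) + 2) (init_state w n M)"
    unfolding list_docs_def using lr ws hold docs_with_interval
    by (simp add: sr take_bit_nat_eq_self init_state_def)
  then show ?thesis unfolding W_def by blast
qed

end

end

section \<open>Word size and constants\<close>

lemma thousand_mult_le_power: "20 \<le> w \<Longrightarrow> 1000 * w \<le> 2 ^ w" for w :: nat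
  by (induction w rule: dec_induct) simp_all

text \<open>The origin of the constant 20: it makes \<open>2 ^ w\<close> at least
  \<open>(n + 1) ^ 20\<close>, of which two powers match the quadratic factor and the other 18
  exceed 64000, as \<open>n + 1\<close> is at least 2.\<close>

lemma word_size:
  assumes "20 * log 2 (real n + 1) \<le> real w" "n > 0"
  shows "20 \<le> w" "1000 * (64 * (n + 1) * (n + 1)) \<le> 2 ^ w" "1000 * w \<le> 2 ^ w"
proof -
  have "1 \<le> log 2 (real n + 1)" using assms(2) by (simp add: le_log_iff)
  then show "20 \<le> w" using assms(1) by linarith
  then show "1000 * w \<le> 2 ^ w" by (rule thousand_mult_le_power)
  have "2 powr (20 * log 2 (real n + 1)) = (2 powr log 2 (real n + 1)) powr 20"
    by (simp only: powr_powr mult.commute)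
  also have "\<dots> = (real n + 1) powr 20" by simp
  also have "\<dots> = real ((n + 1) ^ 20)" by (simp add: add.commute)
  finally have "real ((n + 1) ^ 20) = 2 powr (20 * log 2 (real n + 1))" by (rule sym)
  also have "\<dots> \<le> 2 powr real w" using assms(1) by simp
  also have "\<dots> = real (2 ^ w)" by (simp add: powr_realpow)
  finally have "(n + 1) ^ 20 \<le> 2 ^ w" by linarith
  have "(64000::nat) \<le> 2 ^ 18" by simp
  also have "(2::nat) ^ 18 \<le> (n + 1) ^ 18" using assms(2) by (intro power_mono) simp_all
  finally have "64000 * (n + 1) ^ 2 \<le> (n + 1) ^ 18 * (n + 1) ^ 2" by (rule mult_le_mono1)
  also have "\<dots> = (n + 1) ^ 20" by (simp flip: power_add)
  also note \<open>(n + 1) ^ 20 \<le> 2 ^ w\<close>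
  finally show "1000 * (64 * (n + 1) * (n + 1)) \<le> 2 ^ w"
    by (simp add: power2_eq_square algebra_simps)
qed

lemma lists_docs_within_list_docs:
  fixes Ss :: "'a::{linorder,order_bot} list list"
  defines "n \<equiv> length (concat Ss)"
  assumes coll: "collection Ss" and csa: "is_csa A c (concat Ss)" and pat: "pattern P"
    and w: "20 * log 2 (real n + 1) \<le> real w" "real w \<le> \<kappa> * log 2 (real n + 1)" and \<kappa>: "\<kappa> \<ge> 20"
    and C: "C \<ge> 3500 * \<kappa>"
  shows "lists_docs_within w A c (index_bits w Ss) list_docs Ss P
    (C * (real (search_time A (length P)) + real (card (docs_with Ss P)) * (real (lookup_time A n) + log 2 (real n))))"
proof -
  let ?L = "log 2 (real n)" and ?ST = "search_time A (length P)" and ?lt = "lookup_time A n"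
  let ?df = "card (docs_with Ss P)"
  have n: "n > 0" using text_pos[OF coll] by (simp add: n_def)
  note ws = word_size[OF w(1) n]
  have L: "?L \<ge> 0" using n by simp
  have "length P \<ge> 1" using pat by (simp add: pattern_def Suc_le_eq One_nat_def)
  then have times: "1 \<le> ?ST" "1 \<le> ?lt" using csa by (simp_all add: is_csa_def n_def)
  \<comment> \<open>The word length is compared with \<open>lg n\<close>, which vanishes for
    \<open>n = 1\<close>; the missing summand 1 is supplied by the lookup time, which is at least
    1.\<close>
  have "log 2 (real n + 1) \<le> log 2 (2 * real n)" using n by simp
  also have "\<dots> = 1 + ?L" using n by (simp add: log_mult)
  finally have "real w \<le> \<kappa> * (1 + ?L)"
    using w(2) \<kappa> by (meson mult_left_mono order.trans dual_order.trans zero_le_numeral)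
  also have "\<dots> \<le> \<kappa> * (real ?lt + ?L)" using times \<kappa> by (intro mult_left_mono) simp_all
  finally have wl: "real w \<le> \<kappa> * (real ?lt + ?L)" .
  have C1: "C \<ge> 2" "C \<ge> 0" using C \<kappa> by simp_all
  obtain l r where sr: "search A c P = (l, r)" by force
  show ?thesis
    unfolding lists_docs_within_def n_def[symmetric]
  proof (intro allI impI)
    fix M assume hold: "holds_bits w M (index_bits w Ss)"
    show "\<exists>t s. exec w A c n P list_docs (init_state w n M) t s \<and> distinct (reported s) \<and>
      set (reported s) = docs_with Ss P \<and> holds_bits w (mem s) (index_bits w Ss) \<and>
      real t \<le> C * (real ?ST + real ?df * (real ?lt + ?L))"
    proof (cases "l \<le> r")
      case False
      obtain t s where ts: "exec w A c n P list_docs (init_state w n M) t s" "distinct (reported s)"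
          "set (reported s) = docs_with Ss P" "holds_bits w (mem s) (index_bits w Ss)" "t \<le> ?ST + 2"
        using listing_empty[OF coll csa pat sr False ws[unfolded n_def] hold] by (auto simp: n_def)
      \<comment> \<open>Without an occurrence only the search time can be charged; being at least 1,
        it absorbs the two extra steps.\<close>
      have "real t \<le> 3 * real ?ST" using ts(5) times(1) by linarith
      also have "\<dots> \<le> C * real ?ST" using C \<kappa> by (intro mult_right_mono) simp_all
      also have "\<dots> \<le> C * (real ?ST + real ?df * (real ?lt + ?L))"
        using C1 L by (intro mult_left_mono) simp_all
      finally show ?thesis using ts by blast
    next
      case True
      obtain t s where ts: "exec w A c n P list_docs (init_state w n M) t s" "distinct (reported s)"
          "set (reported s) = docs_with Ss P" "holds_bits w (mem s) (index_bits w Ss)"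
          "t \<le> ?ST + 33 * w + (310 * w + ?lt) * (11 * ?df)"
        using listing_run[OF coll csa pat sr True ws[unfolded n_def] hold] by (auto simp: n_def)
      have "l - 1 < r" using search_bounds(3)[OF coll csa pat sr True] True by simp
      then have "docs_with Ss P \<noteq> {}" using docs_with_interval[OF coll csa pat sr] True by simp
      moreover have "finite (docs_with Ss P)" by (simp add: docs_with_def)
      ultimately have df: "1 \<le> ?df" by (simp add: Suc_le_eq card_gt_0_iff One_nat_def)
      \<comment> \<open>With an occurrence at least one document is listed, so the setup is charged
        to the reports: 33 + 310 * 11 = 3443, and \<open>3443 * \<kappa> + 11\<close> is at most
        \<open>3500 * \<kappa>\<close>.\<close>
      have "33 * w \<le> 33 * w * ?df" using df by simp
      moreover have "33 * w * ?df + (310 * w + ?lt) * (11 * ?df) = (3443 * w + 11 * ?lt) * ?df"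
        by (simp add: algebra_simps)
      ultimately have "t \<le> ?ST + (3443 * w + 11 * ?lt) * ?df" using ts(5) by linarith
      then have "real t \<le> real (?ST + (3443 * w + 11 * ?lt) * ?df)" by (simp only: of_nat_le_iff)
      also have "\<dots> = real ?ST + real ?df * (3443 * real w + 11 * real ?lt)" by simp
      also have "\<dots> \<le> real ?ST + real ?df * (C * (real ?lt + ?L))"
      proof -
        have "11 * real ?lt \<le> 11 * (real ?lt + ?L)" using L by simp
        moreover have "(3443 * \<kappa> + 11) * (real ?lt + ?L) = 3443 * (\<kappa> * (real ?lt + ?L)) + 11 * (real ?lt + ?L)"
          by (simp only: distrib_right mult.assoc)
        ultimately have "3443 * real w + 11 * real ?lt \<le> (3443 * \<kappa> + 11) * (real ?lt + ?L)"
          using wl by linarith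
        also have "\<dots> \<le> C * (real ?lt + ?L)" using C \<kappa> L by (intro mult_right_mono) simp_all
        finally show ?thesis by (intro add_left_mono mult_left_mono) simp_all
      qed
      also have "\<dots> \<le> C * (real ?ST + real ?df * (real ?lt + ?L))"
      proof -
        have "real ?ST \<le> C * real ?ST" using mult_right_mono[of 1 C "real ?ST"] C1 by simp
        moreover have "C * (real ?ST + real ?df * (real ?lt + ?L)) =
            C * real ?ST + real ?df * (C * (real ?lt + ?L))"
          by (simp only: distrib_left mult.left_commute)
        ultimately show ?thesis by linarith
      qed
      finally show ?thesis using ts by blast
    qed
  qed
qed

unused_thms

theorem theorem1:
  "\<exists>\<kappa>\<ge>1. \<forall>\<kappa>'\<ge>\<kappa>. \<exists>q C. \<forall>(Ss :: 'a::{linorder,order_bot} list list) A c w T n d \<rho>.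
     collection Ss \<and> T = concat Ss \<and> n = length T \<and> d = length Ss \<and> \<rho> = card (runs (ilcp Ss)) \<and>
     is_csa A c T \<and> \<kappa> * log 2 (real n + 1) \<le> real w \<and> real w \<le> \<kappa>' * log 2 (real n + 1) \<longrightarrow>
     (\<exists>E.
        real (length c + length E) \<le>
          real (length c) + real \<rho> * log 2 (real n / real \<rho>) + C * real \<rho>
            + real d * log 2 (real n / real d) + C * real d \<and>
        (n \<ge> 2 \<longrightarrow>
          real (length c + length E) \<le> real (length c) + C * ((real \<rho> + real d) * log 2 (real n))) \<and>
        (\<forall>P. pattern P \<longrightarrow>
          lists_docs_within w A c E q Ss P
            (C * (real (search_time A (length P))
              + real (card (docs_with Ss P)) * (real (lookup_time A n) + log 2 (real n))))))"
proof (intro exI[of _ 20] conjI allI impI, goal_cases)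
  case 1 show ?case by simp
next
  case (2 \<kappa>')
  show ?case
  \<comment> \<open>The program is the same for every bound \<open>\<kappa>'\<close> on the word
    size; only the constant grows with it. The constant for the time also dominates those for the
    space, which are 14 and 15.\<close>
  proof (intro exI[of _ list_docs] exI[of _ "3500 * \<kappa>'"] allI impI, elim conjE)
    fix Ss :: "'a list list" and A c w T n d \<rho>
    assume coll: "collection Ss" and T: "T = concat Ss" and n: "n = length T" and d: "d = length Ss"
      and \<rho>: "\<rho> = card (runs (ilcp Ss))" and csa: "is_csa A c T"
      and w: "20 * log 2 (real n + 1) \<le> real w" "real w \<le> \<kappa>' * log 2 (real n + 1)"
    let ?C = "3500 * \<kappa>'" and ?E = "index_bits w Ss"
    have C: "?C \<ge> 15" using 2 by simp
    have sp: "real (length ?E) \<le> real \<rho> * log 2 (real n / real \<rho>) + 14 * real \<rho> +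
        real d * log 2 (real n / real d) + 14 * real d"
      using space[OF coll, of w] by (simp add: T n d \<rho> card_runs)
    have C14: "14 * real \<rho> \<le> ?C * real \<rho>" "14 * real d \<le> ?C * real d"
      using C by (intro mult_right_mono; simp)+
    have pos: "\<rho> > 0" "d > 0"
      using ef_seq.N[OF ef_runs[OF coll]] docs_pos[OF coll] by (simp_all add: \<rho> d card_runs)
    have "real (length c + length ?E) \<le> real (length c) + real \<rho> * log 2 (real n / real \<rho>) + ?C * real \<rho>
            + real d * log 2 (real n / real d) + ?C * real d"
      using sp C14 by simp
    moreover have "real (length c + length ?E) \<le> real (length c) + ?C * ((real \<rho> + real d) * log 2 (real n))"
      if n2: "n \<ge> 2"
    proof -
      \<comment> \<open>From \<open>n = 2\<close> on the logarithm is at least 1 and absorbs the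
        linear terms: 1 + 14 = 15.\<close>
      have L: "1 \<le> log 2 (real n)" using n2 by (simp add: le_log_iff)
      have lg: "real N * log 2 (real n / real N) \<le> real N * log 2 (real n)" if "N > 0" for N
        using that n2 by (intro mult_left_mono) (simp_all add: field_simps)
      have 14: "14 * real N \<le> 14 * (real N * log 2 (real n))" for N
        using mult_left_mono[OF L, of "real N"] by simp
      have "real (length ?E) \<le> 15 * ((real \<rho> + real d) * log 2 (real n))"
        using sp lg[OF pos(1)] lg[OF pos(2)] 14[of \<rho>] 14[of d] by (simp add: algebra_simps)
      also have "\<dots> \<le> ?C * ((real \<rho> + real d) * log 2 (real n))"
        using C L by (intro mult_right_mono) simp_all
      finally show ?thesis by simp
    qed
    moreover have "lists_docs_within w A c ?E list_docs Ss P
        (?C * (real (search_time A (length P))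
          + real (card (docs_with Ss P)) * (real (lookup_time A n) + log 2 (real n))))" if "pattern P" for P
      using lists_docs_within_list_docs[OF coll csa[unfolded T] that, of w \<kappa>' ?C] w 2 by (simp add: n T)
    ultimately show "\<exists>E.
        real (length c + length E) \<le>
          real (length c) + real \<rho> * log 2 (real n / real \<rho>) + ?C * real \<rho>
            + real d * log 2 (real n / real d) + ?C * real d \<and>
        (n \<ge> 2 \<longrightarrow>
          real (length c + length E) \<le> real (length c) + ?C * ((real \<rho> + real d) * log 2 (real n))) \<and>
        (\<forall>P. pattern P \<longrightarrow>
          lists_docs_within w A c E list_docs Ss P
            (?C * (real (search_time A (length P))
              + real (card (docs_with Ss P)) * (real (lookup_time A n) + log 2 (real n)))))"
      by blast
  qed
qed

end
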